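(* Let $N\in\mathbb N$ and $\xi=\sum_{j=1}^N\delta_{u_j}$ with $u_1<\dots<u_N$ even integers. The noncolliding random walk $(\Xi(t),t\in\mathbb N_0,\mathbb P_\xi)$ is determinantal with the kernel $$\mathbb K_\xi(s,x;t,y)=\sum_{j=1}^Np(s,x|u_j)\,\mathcal M_\xi^{u_j}(t,y)-\mathbf 1(s>t)\,p(s-t,x|y)$$ if $(s,x),(t,y)\in\mathbb N_0\times\mathbb Z$ with $s+x$ and $t+y$ even, and $\mathbb K_\xi(s,x;t,y)=0$ otherwise. That is, for every $M\in\mathbb N$, integers $0<t_1<\dots<t_M$ and finitely supported $f_{t_1},\dots,f_{t_M}:\mathbb Z\to\mathbb R$, with $\chi_{t_m}=e^{f_{t_m}}-1$, $$\mathbb E_\xi\Big[\exp\Big\{\sum_{m=1}^M\int f_{t_m}(x)\,\Xi(t_m,dx)\Big\}\Big]=\mathop{\mathrm{Det}}_{s,t\in\{t_1,\dots,t_M\},\ x,y\in\mathbb Z}\big[\delta_{st}\delta_x(y)+\mathbb K_\xi(s,x;t,y)\chi_t(y)\big],$$ and all spatio-temporal correlation functions are given, for $0\le N_m\le N$, by $$\rho_\xi(t_1,\boldsymbol x^{(1)}_{N_1};\dots;t_M,\boldsymbol x^{(M)}_{N_M})=\det_{\substack{1\le j\le N_m,\,1\le k\le N_n\\1\le m,n\le M}}\big[\mathbb K_\xi(t_m,x_j^{(m)};t_n,x_k^{(n)})\big]$$ if for each $1\le m\le M$ the points $x^{(m)}_1<\dots<x^{(m)}_{N_m}$ are all even integers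 when $t_m$ is even and all odd integers when $t_m$ is odd, and $\rho_\xi=0$ otherwise.
   Context: $\boldsymbol V(t)=(V_1(t),\dots,V_N(t))$, $t\in\mathbb N_0$: independent simple symmetric random walks on $\mathbb Z$ with $V_j(0)=u_j$ (expectation $\mathrm E_{\boldsymbol u}$), each with transition probability $p(t,y|x)=2^{-t}\binom{t}{(t+y-x)/2}$ if $|y-x|\le t$ and $t+y-x$ is even, and $0$ otherwise. $\mathbb W_n=\{\boldsymbol x:x_1<\dots<x_n\}$, $\tau_{\boldsymbol u}=\inf\{t\ge1:\boldsymbol V(t)\notin\mathbb W_N\}$. Noncolliding random walk: the random walk conditioned to stay in $\mathbb W_N$ forever, regarded as the process $\Xi(t,\cdot)=\sum_{j=1}^N\delta_{X_j(t)}(\cdot)$, with expectation $\mathbb E_\xi[F(\Xi(\cdot))]=\lim_{n\to\infty}\mathrm E_{\boldsymbol u}[F(\sum_j\delta_{V_j(\cdot)})\mid\tau_{\boldsymbol u}>n]$ for bounded $F$ depending on $\Xi$ up to a finite time. $\Phi_\xi^{u_k}(z)=\prod_{1\le j\le N,\,j\ne k}\frac{z-u_j}{u_k-u_j}$ and $\mathcal M_\xi^{u_k}(t,y)=\widetilde{\mathrm E}[\Phi_\xi^{u_k}(y+i\widetilde W(t))]$, where $\widetilde W(0)=0$ and for $t\in\mathbb N$, $\widetilde W(t)$ has the law of $W(C(t))$, with $W$ a standard Brownian motion from $0$ independent of $C(t)=\frac2{\pi^2}\sum_{\ell\in\mathbb N}\frac{\eta_\ell(t)}{(\ell-1/2)^2}$,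 $\eta_\ell(t)$ i.i.d. with density $\frac1{\Gamma(t)}x^{t-1}e^{-x}$ on $x>0$ (so $\mathrm E[e^{-\lambda C(t)}]=(\cosh\sqrt{2\lambda})^{-t}$). The Fredholm determinant is $$\mathop{\mathrm{Det}}\big[\delta_{st}\delta_x(y)+\mathbf K(s,x;t,y)\chi_t(y)\big]=\sum_{N_1,\dots,N_M\ge0}\ \sum_{\boldsymbol x^{(m)}\in\mathbb Z^{N_m}\cap\mathbb W_{N_m},\,1\le m\le M}\ \prod_{m=1}^M\prod_{j=1}^{N_m}\chi_{t_m}(x_j^{(m)})\det_{\substack{1\le j\le N_m,\,1\le k\le N_n\\1\le m,n\le M}}\big[\mathbf K(t_m,x_j^{(m)};t_n,x_k^{(n)})\big],$$ and the correlation functions $\rho_\xi$ are the coefficients in the expansion $\mathbb E_\xi[\exp\{\sum_m\int f_{t_m}d\Xi(t_m)\}]=\sum_{N_1,\dots,N_M\ge0}\sum_{\boldsymbol x^{(1)},\dots,\boldsymbol x^{(M)}}\prod_{m}\prod_j\chi_{t_m}(x_j^{(m)})\,\rho_\xi(t_1,\boldsymbol x^{(1)}_{N_1};\dots;t_M,\boldsymbol x^{(M)}_{N_M})$ over the same index sets. *)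

theory Defs
  imports
    "HOL-Probability.Probability"
    "Jordan_Normal_Form.Determinant"
begin

section \<open>The noncolliding random walk\<close>

definition trans_prob :: "nat \<Rightarrow> int \<Rightarrow> int \<Rightarrow> real" where
  "trans_prob t y x =
     (if \<bar>y - x\<bar> \<le> int t \<and> even (int t + y - x)
      then (1 / 2) ^ t * real (t choose nat ((int t + y - x) div 2)) else 0)"

definition srws :: "'a measure \<Rightarrow> nat \<Rightarrow> (nat \<Rightarrow> int) \<Rightarrow> (nat \<Rightarrow> nat \<Rightarrow> 'a \<Rightarrow> int) \<Rightarrow> bool" where
  "srws P N u V \<longleftrightarrow>
     prob_space P \<and>
     (\<forall>j\<in>{1..N}. \<forall>\<omega>\<in>space P. V j 0 \<omega> = u j) \<and>
     prob_space.indep_vars P (\<lambda>_. count_space UNIV)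
       (\<lambda>(j, t) \<omega>. V j (Suc t) \<omega> - V j t \<omega>) ({1..N} \<times> UNIV) \<and>
     (\<forall>j\<in>{1..N}. \<forall>t. distr P (count_space UNIV) (\<lambda>\<omega>. V j (Suc t) \<omega> - V j t \<omega>)
        = measure_pmf (pmf_of_set {- 1, 1}))"

text \<open>Vectors of length \<open>n\<close> are extensional functions on \<open>{1..n}\<close>, so that a sum over
  \<open>weyl n\<close> counts every vector once; \<open>weyl 0\<close> consists of the empty vector only.\<close>

definition weyl :: "nat \<Rightarrow> (nat \<Rightarrow> int) set" where
  "weyl n = {x \<in> {1..n} \<rightarrow>\<^sub>E UNIV. strict_mono_on {1..n} x}"

text \<open>The infimum of the empty set of extended naturals is \<open>\<infinity>\<close>.\<close>

definition exit_time :: "nat \<Rightarrow> (nat \<Rightarrow> nat \<Rightarrow> 'a \<Rightarrow> int) \<Rightarrow> 'a \<Rightarrow> enat" where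
  "exit_time N V \<omega> = Inf (enat ` {t. 1 \<le> t \<and> restrict (\<lambda>j. V j t \<omega>) {1..N} \<notin> weyl N})"

text \<open>A finite integer-valued point measure \<open>\<Sum>\<^sub>j \<delta>\<^bsub>x\<^sub>j\<^esub>\<close> is represented by the multiset of the
  \<open>x\<^sub>j\<close>; the integral of \<open>f\<close> against it is the sum of \<open>f\<close> over the multiset.\<close>

definition config :: "nat \<Rightarrow> (nat \<Rightarrow> nat \<Rightarrow> 'a \<Rightarrow> int) \<Rightarrow> 'a \<Rightarrow> nat \<Rightarrow> int multiset" where
  "config N V \<omega> t = image_mset (\<lambda>j. V j t \<omega>) (mset_set {1..N})"

definition cond_expect ::
  "'a measure \<Rightarrow> nat \<Rightarrow> (nat \<Rightarrow> nat \<Rightarrow> 'a \<Rightarrow> int) \<Rightarrow> ((nat \<Rightarrow> int multiset) \<Rightarrow> real) \<Rightarrow> nat \<Rightarrow> real" where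
  "cond_expect P N V F n =
     (\<integral>\<omega>. F (config N V \<omega>) \<partial>(uniform_measure P {\<omega> \<in> space P. enat n < exit_time N V \<omega>}))"

definition nc_expect ::
  "'a measure \<Rightarrow> nat \<Rightarrow> (nat \<Rightarrow> nat \<Rightarrow> 'a \<Rightarrow> int) \<Rightarrow> ((nat \<Rightarrow> int multiset) \<Rightarrow> real) \<Rightarrow> real" where
  "nc_expect P N V F = lim (cond_expect P N V F)"

text \<open>Bounded functionals of paths of \<open>N\<close>-point configurations that depend on the path up to a
  finite time.\<close>

definition local_functional :: "nat \<Rightarrow> ((nat \<Rightarrow> int multiset) \<Rightarrow> real) \<Rightarrow> bool" where
  "local_functional N F \<longleftrightarrow>
     bounded (F ` {X. \<forall>t. size (X t) = N}) \<and>
     (\<exists>T. \<forall>X Y. (\<forall>t\<le>T. X t = Y t) \<longrightarrow> F X = F Y)"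

definition exp_functional ::
  "nat \<Rightarrow> (nat \<Rightarrow> nat) \<Rightarrow> (nat \<Rightarrow> int \<Rightarrow> real) \<Rightarrow> (nat \<Rightarrow> int multiset) \<Rightarrow> real" where
  "exp_functional M t f X = exp (\<Sum>m=1..M. \<Sum>x\<in>#X (t m). f (t m) x)"


section \<open>Brownian motion at the random time\<close>

definition brownian_motion :: "'b measure \<Rightarrow> (real \<Rightarrow> 'b \<Rightarrow> real) \<Rightarrow> bool" where
  "brownian_motion Q W \<longleftrightarrow>
     prob_space Q \<and>
     (\<forall>s\<ge>0. W s \<in> borel_measurable Q) \<and>
     (\<forall>\<omega>\<in>space Q. W 0 \<omega> = 0 \<and> continuous_on {0..} (\<lambda>s. W s \<omega>)) \<and>
     (\<forall>s\<ge>0. \<forall>r>s. distributed Q lborel (\<lambda>\<omega>. W r \<omega> - W s \<omega>) (normal_density 0 (sqrt (r - s)))) \<and>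
     (\<forall>(n::nat) r. 0 \<le> r 0 \<and> (\<forall>i<n. r i < r (Suc i)) \<longrightarrow>
        prob_space.indep_vars Q (\<lambda>_. borel) (\<lambda>i \<omega>. W (r (Suc i)) \<omega> - W (r i) \<omega>) {..<n})"

definition gamma_density :: "nat \<Rightarrow> real \<Rightarrow> real" where
  "gamma_density t x = (if 0 < x then x ^ (t - 1) * exp (- x) / Gamma (real t) else 0)"

text \<open>The series is summed in \<open>[0, \<infinity>]\<close>; its sum is almost surely finite, and this reading makes
  the random time nonnegative and measurable without exception.\<close>

definition random_time :: "(nat \<Rightarrow> nat \<Rightarrow> 'b \<Rightarrow> real) \<Rightarrow> nat \<Rightarrow> 'b \<Rightarrow> real" where
  "random_time \<eta> t \<omega> =
     2 / pi\<^sup>2 * enn2real (\<Sum>l. ennreal (\<eta> (Suc l) t \<omega> / (real (Suc l) - 1 / 2)\<^sup>2))"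

definition time_changed_bm ::
  "'b measure \<Rightarrow> (real \<Rightarrow> 'b \<Rightarrow> real) \<Rightarrow> (nat \<Rightarrow> nat \<Rightarrow> 'b \<Rightarrow> real) \<Rightarrow> bool" where
  "time_changed_bm Q W \<eta> \<longleftrightarrow>
     brownian_motion Q W \<and>
     (\<forall>t\<ge>1. prob_space.indep_vars Q (\<lambda>_. borel) (\<lambda>l. \<eta> l t) {1..} \<and>
        (\<forall>l\<ge>1. distributed Q lborel (\<eta> l t) (gamma_density t)) \<and>
        prob_space.indep_set Q
          (sets (vimage_algebra (space Q) (\<lambda>\<omega>. \<lambda>s\<in>{0..}. W s \<omega>) (Pi\<^sub>M {0..} (\<lambda>_. borel))))
          (sets (vimage_algebra (space Q) (random_time \<eta> t) borel)))"

text \<open>The law of the process \<open>W\<close> evaluated at \<open>random_time \<eta> t\<close>. Only these one-time laws enter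
  the kernel, so no joint law over different \<open>t\<close> is fixed.\<close>

definition tilde_law ::
  "'b measure \<Rightarrow> (real \<Rightarrow> 'b \<Rightarrow> real) \<Rightarrow> (nat \<Rightarrow> nat \<Rightarrow> 'b \<Rightarrow> real) \<Rightarrow> nat \<Rightarrow> real measure" where
  "tilde_law Q W \<eta> t =
     (if t = 0 then return borel 0 else distr Q borel (\<lambda>\<omega>. W (random_time \<eta> t \<omega>) \<omega>))"


section \<open>The kernel\<close>

definition Phi :: "nat \<Rightarrow> (nat \<Rightarrow> int) \<Rightarrow> nat \<Rightarrow> complex \<Rightarrow> complex" where
  "Phi N u k z = (\<Prod>j\<in>{1..N} - {k}. (z - of_int (u j)) / (of_int (u k) - of_int (u j)))"

text \<open>Here and in \<open>nc_kernel\<close>, the measure \<open>L t\<close> is the law of the imaginary part at time \<open>t\<close>;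
  the kernel of the noncolliding walk has \<open>L = tilde_law Q W \<eta>\<close>.\<close>

definition calM :: "(nat \<Rightarrow> real measure) \<Rightarrow> nat \<Rightarrow> (nat \<Rightarrow> int) \<Rightarrow> nat \<Rightarrow> nat \<Rightarrow> int \<Rightarrow> complex" where
  "calM L N u k t y = (\<integral>w. Phi N u k (of_int y + \<i> * complex_of_real w) \<partial>(L t))"

definition nc_kernel ::
  "(nat \<Rightarrow> real measure) \<Rightarrow> nat \<Rightarrow> (nat \<Rightarrow> int) \<Rightarrow> nat \<times> int \<Rightarrow> nat \<times> int \<Rightarrow> complex" where
  "nc_kernel L N u = (\<lambda>(s, x) (t, y).
     if even (int s + x) \<and> even (int t + y)
     then (\<Sum>j=1..N. complex_of_real (trans_prob s x (u j)) * calM L N u j t y)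
          - (if s > t then complex_of_real (trans_prob (s - t) x y) else 0)
     else 0)"


section \<open>Fredholm determinants and correlation functions\<close>

text \<open>The rows and columns are indexed by the pairs \<open>(m, j)\<close> with \<open>1 \<le> m \<le> M\<close>,
  \<open>1 \<le> j \<le> n m\<close>, in lexicographic order.\<close>

definition block_det ::
  "nat \<Rightarrow> (nat \<Rightarrow> nat) \<Rightarrow> (nat \<times> int \<Rightarrow> nat \<times> int \<Rightarrow> complex) \<Rightarrow>
   (nat \<Rightarrow> nat) \<Rightarrow> (nat \<Rightarrow> nat \<Rightarrow> int) \<Rightarrow> complex" where
  "block_det M t K n x =
     (let pts = [(t m, x m j). m \<leftarrow> [1..<Suc M], j \<leftarrow> [1..<Suc (n m)]]
      in Determinant.det (Matrix.mat (length pts) (length pts) (\<lambda>(a, b). K (pts ! a) (pts ! b))))"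

text \<open>The common form of the two expansions. If every \<open>h (t m)\<close> has finite support, only finitely
  many terms are nonzero, so there is no convergence question.\<close>

definition multi_sum ::
  "nat \<Rightarrow> (nat \<Rightarrow> nat) \<Rightarrow> (nat \<Rightarrow> int \<Rightarrow> real) \<Rightarrow>
   ((nat \<Rightarrow> nat) \<Rightarrow> (nat \<Rightarrow> nat \<Rightarrow> int) \<Rightarrow> complex) \<Rightarrow> complex" where
  "multi_sum M t h c =
     (\<Sum>\<^sub>\<infinity>n\<in>({1..M} \<rightarrow>\<^sub>E UNIV). (\<Sum>\<^sub>\<infinity>x\<in>(\<Pi>\<^sub>E m\<in>{1..M}. weyl (n m)).
        (\<Prod>m=1..M. \<Prod>j=1..n m. complex_of_real (h (t m) (x m j))) * c n x))"

definition fredholm_det ::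
  "nat \<Rightarrow> (nat \<Rightarrow> nat) \<Rightarrow> (nat \<times> int \<Rightarrow> nat \<times> int \<Rightarrow> complex) \<Rightarrow> (nat \<Rightarrow> int \<Rightarrow> real) \<Rightarrow> complex" where
  "fredholm_det M t K h = multi_sum M t h (block_det M t K)"

definition test_functions :: "nat \<Rightarrow> (nat \<Rightarrow> nat) \<Rightarrow> (nat \<Rightarrow> int \<Rightarrow> real) set" where
  "test_functions M t = {f. \<forall>m\<in>{1..M}. finite {x. f (t m) x \<noteq> 0}}"

text \<open>\<open>\<rho> n x\<close> stands for the correlation function at the times \<open>t 1, \<dots>, t M\<close> and the points
  \<open>x m 1 < \<dots> < x m (n m)\<close>: \<open>\<rho>\<close> consists of the coefficients in the expansion of the exponential
  moments.\<close>

definition correlation_functions ::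
  "'a measure \<Rightarrow> nat \<Rightarrow> (nat \<Rightarrow> nat \<Rightarrow> 'a \<Rightarrow> int) \<Rightarrow> nat \<Rightarrow> (nat \<Rightarrow> nat) \<Rightarrow>
   ((nat \<Rightarrow> nat) \<Rightarrow> (nat \<Rightarrow> nat \<Rightarrow> int) \<Rightarrow> real) \<Rightarrow> bool" where
  "correlation_functions P N V M t \<rho> \<longleftrightarrow>
     (\<forall>f\<in>test_functions M t.
        complex_of_real (nc_expect P N V (exp_functional M t f)) =
        multi_sum M t (\<lambda>s y. exp (f s y) - 1) (\<lambda>n x. complex_of_real (\<rho> n x)))"

end

theory Submission
  imports Defs "HOL-Real_Asymp.Real_Asymp"
begin

text \<open>Write \<open>h\<close> for the Vandermonde determinant. Before time \<open>n\<close> walkers of equal parity can leave the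
  Weyl chamber only through a point where two of them meet, and there every alternating function
  vanishes. Hence the survival probability up to a further time \<open>n\<close> from \<open>x\<close> is the expectation of
  \<open>sgn h\<close> at time \<open>n\<close> for free walkers. Expanded in Krawtchouk polynomials, this expectation is
  asymptotically a multiple, independent of \<open>x\<close>, of \<open>h x\<close>: the orthogonality relations and a fourth
  moment bound show that the lowest antisymmetric coefficient dominates. So the conditioned walk is
  the \<open>h\<close>-transform of the free walk, restricted to the chamber.

  The law of \<open>W (C t)\<close> has characteristic function \<open>(1 / cosh x) ^ t\<close> and all moments. Therefore
  \<open>\<M>\<^sup>j(t, y)\<close> is a real polynomial in \<open>y\<close>, is a martingale along the walk, equals \<open>\<delta>\<^sub>i\<^sub>j\<close> at time
  \<open>0\<close> and \<open>y = u\<^sub>i\<close>, and \<open>det (\<M>\<^sup>j(t, y\<^sub>i)) = h y / h u\<close>. The exponential moment of the \<open>h\<close>-transform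
  becomes an expectation of a determinant with independent rows; pulling the columns back in time by
  one-dimensional averaging and eliminating with Sylvester's identity gives the Fredholm determinant.
  The correlation functions follow because an expansion of this form determines its coefficients.\<close>

section \<open>Determinants over finite index sets\<close>

text \<open>Put a = N(N-1)/2, the least sum of \<open>N\<close> distinct degrees. For a fixed
  lattice of starting points every coefficient of larger total degree is O(m^(-(a+1)/2)) by
  Cauchy-Schwarz, so for the lowest one a lower bound of order m^(-a/2) is enough. It is a
  normalised first absolute moment of a determinant; orthogonality gives the second moment, and the
  fourth moment turns this into a bound for the first.

  Determinants are taken over arbitrary finite index sets because the final expansion runs over
  finite sets of space-time points, which carry no preferred order; the Fredholm determinant and the
  exponential moment then become sums over the subsets of one finite set.

  The power of 1 / cosh x is forced: a step multiplies exp(x y) by cosh x on average, so exp(x y) /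
  (cosh x)^t is a martingale, and its Taylor coefficients in x are polynomial martingales. The
  imaginary Brownian motion run up to C(t) has just the moments that this series prescribes; that it
  has moments at all rests on a finite exponential moment of C(t).\<close>

definition sdet :: "'i set \<Rightarrow> ('i \<Rightarrow> 'i \<Rightarrow> 'a::comm_ring_1) \<Rightarrow> 'a" where
  "sdet I A = (\<Sum>p | p permutes I. of_int (sign p) * (\<Prod>i\<in>I. A i (p i)))"

lemma sdet_cong: "(\<And>i j. i \<in> I \<Longrightarrow> j \<in> I \<Longrightarrow> A i j = B i j) \<Longrightarrow> sdet I A = sdet I B"
  unfolding sdet_def by (intro sum.cong refl arg_cong2[where f="(*)"] prod.cong) (auto simp: permutes_in_image)

text \<open>Conjugation with \<open>f\<close> carries the permutations of \<open>I\<close> to those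
  of \<open>J\<close> and keeps the sign; the two \<open>map_permutation\<close> maps are inverse to
  each other.\<close>

lemma sdet_reindex:
  assumes f: "bij_betw f I J" and I: "finite I"
  shows "sdet J A = sdet I (\<lambda>i j. A (f i) (f j))"
proof -
  have inj: "inj_on f I" and J: "J = f ` I" using f by (auto simp: bij_betw_def)
  define g where "g = inv_into I f"
  have g: "bij_betw g J I" unfolding g_def by (rule bij_betw_inv_into[OF f])
  have gf: "\<And>x. x \<in> I \<Longrightarrow> g (f x) = x" "\<And>y. y \<in> J \<Longrightarrow> f (g y) = y"
    using f by (auto simp: g_def bij_betw_inv_into_left bij_betw_inv_into_right)
  have inj_g: "inj_on g J" and gJ: "g ` J = I" using g by (auto simp: bij_betw_def)
  show ?thesis unfolding sdet_def
  proof (rule sum.reindex_bij_witness[where i = "map_permutation I f" and j = "map_permutation J g"])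
    fix p assume p: "p \<in> {p. p permutes J}"
    show "map_permutation J g p \<in> {p. p permutes I}"
      using map_permutation_permutes[OF g] p by auto
    have "map_permutation I f (map_permutation J g p) = map_permutation J (f \<circ> g) p"
      by (rule map_permutation_compose[OF g inj])
    also have "\<dots> = map_permutation J id p"
      using p by (intro map_permutation_cong_strong)
         (auto simp: gf permutes_image inj_on_def)
    finally show "map_permutation I f (map_permutation J g p) = p" using p by simp
    have "sign (map_permutation J g p) = sign p"
      using p I f by (intro sign_map_permutation[OF inj_g]) (auto simp: J)
    moreover have "(\<Prod>j\<in>J. A j (p j)) = (\<Prod>i\<in>I. A (f i) (f (map_permutation J g p i)))"
      unfolding prod.reindex_bij_betw[OF f, symmetric]
    proof (intro prod.cong refl)
      fix i assume i: "i \<in> I"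
      then have fi: "f i \<in> J" by (simp add: J)
      have "map_permutation J g p i = map_permutation J g p (g (f i))" using i gf by simp
      also have "\<dots> = g (p (f i))" by (rule map_permutation_apply[OF inj_g fi])
      finally show "A (f i) (p (f i)) = A (f i) (f (map_permutation J g p i))"
        using fi p by (simp add: gf permutes_in_image)
    qed
    ultimately show "of_int (sign (map_permutation J g p)) * (\<Prod>i\<in>I. A (f i) (f (map_permutation J g p i)))
       = of_int (sign p) * (\<Prod>j\<in>J. A j (p j))" by simp
  next
    fix p assume p: "p \<in> {p. p permutes I}"
    show "map_permutation I f p \<in> {p. p permutes J}"
      using map_permutation_permutes[OF f] p by auto
    have "map_permutation J g (map_permutation I f p) = map_permutation I (g \<circ> f) p"
      by (rule map_permutation_compose[OF f inj_g])
    also have "\<dots> = map_permutation I id p"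
      using p by (intro map_permutation_cong_strong)
         (auto simp: gf permutes_image inj_on_def)
    finally show "map_permutation J g (map_permutation I f p) = p" using p by simp
  qed
qed

lemma det_mat_eq_sdet: "Determinant.det (Matrix.mat n n (\<lambda>(i, j). A i j)) = sdet {0..<n} A"
  unfolding sdet_def
  by (subst det_def') (auto intro!: sum.cong prod.cong arg_cong2[where f="(*)"] simp: permutes_in_image)

lemma det_mat_list_eq_sdet:
  assumes "distinct xs"
  shows "Determinant.det (Matrix.mat (length xs) (length xs) (\<lambda>(a, b). A (xs ! a) (xs ! b))) = sdet (set xs) A"
proof -
  have bij: "bij_betw ((!) xs) {0..<length xs} (set xs)"
    using assms by (intro bij_betw_nth) auto
  show ?thesis
    unfolding sdet_reindex[OF bij finite_atLeastLessThan] by (rule det_mat_eq_sdet)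
qed

lemma sdet_transpose:
  assumes "finite I" shows "sdet I (\<lambda>i j. A j i) = sdet I A"
proof -
  have "sdet I (\<lambda>i j. A j i) = (\<Sum>p | p permutes I. of_int (sign (Hilbert_Choice.inv p)) * (\<Prod>i\<in>I. A (Hilbert_Choice.inv p i) i))"
    unfolding sdet_def by (rule sum_permutations_inverse)
  also have "\<dots> = sdet I A"
    unfolding sdet_def
  proof (intro sum.cong refl arg_cong2[where f="(*)"])
    fix p assume "p \<in> {p. p permutes I}"
    then have p: "p permutes I" by simp
    show "of_int (sign (Hilbert_Choice.inv p)) = of_int (sign p)"
      using p assms by (simp add: sign_inverse permutes_imp_permutation)
    have "(\<Prod>i\<in>I. A (Hilbert_Choice.inv p i) i) = (\<Prod>i\<in>I. A (Hilbert_Choice.inv p (p i)) (p i))"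
      by (rule prod.permute[OF p, unfolded o_def])
    also have "\<dots> = (\<Prod>i\<in>I. A i (p i))" using p by (simp add: permutes_inverses)
    finally show "(\<Prod>i\<in>I. A (Hilbert_Choice.inv p i) i) = (\<Prod>i\<in>I. A i (p i))" .
  qed
  finally show ?thesis .
qed

lemma sdet_mult:
  assumes I: "finite I"
  shows "sdet I (\<lambda>i k. \<Sum>j\<in>I. A i j * B j k) = sdet I A * sdet I B"
proof -
  obtain f where f: "bij_betw f {0..<card I} I" using ex_bij_betw_nat_finite[OF I] by auto
  let ?n = "card I"
  define A' where "A' = Matrix.mat ?n ?n (\<lambda>(i, j). A (f i) (f j))"
  define B' where "B' = Matrix.mat ?n ?n (\<lambda>(i, j). B (f i) (f j))"
  have 1: "sdet I C = Determinant.det (Matrix.mat ?n ?n (\<lambda>(i, j). C (f i) (f j)))" for C :: "'a \<Rightarrow> 'a \<Rightarrow> 'b"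
    unfolding det_mat_eq_sdet by (rule sdet_reindex[OF f]) simp
  have "A' * B' = Matrix.mat ?n ?n (\<lambda>(i, j). \<Sum>l\<in>I. A (f i) l * B l (f j))"
    by (rule eq_matI) (auto simp: A'_def B'_def scalar_prod_def sum.reindex_bij_betw[OF f, symmetric])
  moreover have "Determinant.det (A' * B') = Determinant.det A' * Determinant.det B'"
    by (rule det_mult[of _ ?n]) (auto simp: A'_def B'_def)
  ultimately show ?thesis unfolding 1 A'_def B'_def by simp
qed

text \<open>Sylvester's identity. The block matrix with rows (1, -A) and (B, 1) factors as
  \<open>?L * ?R\<close> and as \<open>?L' * ?L\<close>; all three factors are block triangular and
  \<open>?L\<close> has determinant 1.\<close>

lemma det_one_plus_mult_commute:
  fixes A B :: "'a::idom Matrix.mat"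
  assumes A: "A \<in> carrier_mat n m" and B: "B \<in> carrier_mat m n"
  shows "Determinant.det (1\<^sub>m n + A * B) = Determinant.det (1\<^sub>m m + B * A)"
proof -
  let ?L = "four_block_mat (1\<^sub>m n) (0\<^sub>m n m) B (1\<^sub>m m)"
  let ?R = "four_block_mat (1\<^sub>m n) (- A) (0\<^sub>m m n) (1\<^sub>m m + B * A)"
  let ?L' = "four_block_mat (1\<^sub>m n + A * B) (- A) (0\<^sub>m m n) (1\<^sub>m m)"
  have c: "- A \<in> carrier_mat n m" "1\<^sub>m m + B * A \<in> carrier_mat m m" "1\<^sub>m n + A * B \<in> carrier_mat n n"
    using A B by auto
  have 1: "B * - A + (1\<^sub>m m + B * A) = 1\<^sub>m m" "1\<^sub>m n + A * B + - A * B = 1\<^sub>m n"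
    using A B by (auto intro!: eq_matI)
  have 2: "?L * ?R = four_block_mat (1\<^sub>m n) (- A) B (1\<^sub>m m)"
    using A B c 1
    by (subst mult_four_block_mat[OF one_carrier_mat zero_carrier_mat B one_carrier_mat one_carrier_mat c(1) zero_carrier_mat c(2)]) simp
  have 3: "?L' * ?L = four_block_mat (1\<^sub>m n) (- A) B (1\<^sub>m m)"
    using A B c 1
    by (subst mult_four_block_mat[OF c(3) c(1) zero_carrier_mat one_carrier_mat one_carrier_mat zero_carrier_mat B one_carrier_mat]) simp
  have "Determinant.det (?L * ?R) = Determinant.det ?L * Determinant.det ?R"
    using A B c by (intro det_mult[of _ "n + m"] four_block_carrier_mat) auto
  moreover have "Determinant.det (?L' * ?L) = Determinant.det ?L' * Determinant.det ?L"
    using A B c by (intro det_mult[of _ "n + m"] four_block_carrier_mat) auto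
  moreover have "Determinant.det ?L = 1"
    using det_four_block_mat_upper_right_zero[OF _ refl B, of "1\<^sub>m n" "1\<^sub>m m"] by simp
  moreover have "Determinant.det ?R = Determinant.det (1\<^sub>m m + B * A)"
    using det_four_block_mat_lower_left_zero[OF _ c(1) refl c(2), of "1\<^sub>m n"] by simp
  moreover have "Determinant.det ?L' = Determinant.det (1\<^sub>m n + A * B)"
    using det_four_block_mat_lower_left_zero[OF c(3) c(1) refl, of "1\<^sub>m m"] by simp
  ultimately show ?thesis using 2 3 by simp
qed

lemma sdet_one_plus_mult_commute:
  fixes A :: "'i \<Rightarrow> 'j \<Rightarrow> 'a::idom"
  assumes I: "finite I" and J: "finite J"
  shows "sdet I (\<lambda>i k. of_bool (i = k) + (\<Sum>j\<in>J. A i j * B j k)) = sdet J (\<lambda>j l. of_bool (j = l) + (\<Sum>i\<in>I. B j i * A i l))"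
proof -
  obtain f where f: "bij_betw f {0..<card I} I" using ex_bij_betw_nat_finite[OF I] by auto
  obtain g where g: "bij_betw g {0..<card J} J" using ex_bij_betw_nat_finite[OF J] by auto
  let ?n = "card I" and ?m = "card J"
  define A' where "A' = Matrix.mat ?n ?m (\<lambda>(i, j). A (f i) (g j))"
  define B' where "B' = Matrix.mat ?m ?n (\<lambda>(i, j). B (g i) (f j))"
  have 1: "sdet I C = Determinant.det (Matrix.mat ?n ?n (\<lambda>(i, j). C (f i) (f j)))" for C :: "'i \<Rightarrow> 'i \<Rightarrow> 'a"
    unfolding det_mat_eq_sdet by (rule sdet_reindex[OF f]) simp
  have 2: "sdet J C = Determinant.det (Matrix.mat ?m ?m (\<lambda>(i, j). C (g i) (g j)))" for C :: "'j \<Rightarrow> 'j \<Rightarrow> 'a"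
    unfolding det_mat_eq_sdet by (rule sdet_reindex[OF g]) simp
  have ff: "f i = f j \<longleftrightarrow> i = j" if "i < ?n" "j < ?n" for i j
    using f that by (auto simp: bij_betw_def inj_on_def)
  have gg: "g i = g j \<longleftrightarrow> i = j" if "i < ?m" "j < ?m" for i j
    using g that by (auto simp: bij_betw_def inj_on_def)
  have "1\<^sub>m ?n + A' * B' = Matrix.mat ?n ?n (\<lambda>(i, k). of_bool (f i = f k) + (\<Sum>j\<in>J. A (f i) j * B j (f k)))"
    by (rule eq_matI) (auto simp: A'_def B'_def scalar_prod_def sum.reindex_bij_betw[OF g, symmetric] ff)
  moreover have "1\<^sub>m ?m + B' * A' = Matrix.mat ?m ?m (\<lambda>(i, k). of_bool (g i = g k) + (\<Sum>j\<in>I. B (g i) j * A j (g k)))"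
    by (rule eq_matI) (auto simp: A'_def B'_def scalar_prod_def sum.reindex_bij_betw[OF f, symmetric] gg)
  moreover have "Determinant.det (1\<^sub>m ?n + A' * B') = Determinant.det (1\<^sub>m ?m + B' * A')"
    by (rule det_one_plus_mult_commute) (auto simp: A'_def B'_def)
  ultimately show ?thesis unfolding 1 2 by simp
qed

text \<open>A permutation whose product survives never lowers the rank \<open>r\<close> and raises
  it wherever it moves a point; since it preserves the sum of \<open>r\<close>, it moves nothing.
  Ties in \<open>r\<close> are allowed, which covers distinct points at a common time.\<close>

lemma sdet_triangular:
  fixes r :: "'i \<Rightarrow> nat" and A :: "'i \<Rightarrow> 'i \<Rightarrow> 'a::comm_ring_1"
  assumes I: "finite I" and A: "\<And>i j. i \<in> I \<Longrightarrow> j \<in> I \<Longrightarrow> i \<noteq> j \<Longrightarrow> A i j \<noteq> 0 \<Longrightarrow> r i < r j"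
  shows "sdet I A = (\<Prod>i\<in>I. A i i)"
proof -
  have 0: "(\<Prod>i\<in>I. A i (p i)) = 0" if p: "p permutes I" "p \<noteq> id" for p
  proof (rule ccontr)
    assume "(\<Prod>i\<in>I. A i (p i)) \<noteq> 0"
    then have nz: "A i (p i) \<noteq> 0" if "i \<in> I" for i
      using prod_zero[OF I, of "\<lambda>i. A i (p i)"] that by blast
    have less: "r i < r (p i)" if "i \<in> I" "p i \<noteq> i" for i
      by (rule A) (use nz that p in \<open>auto simp: permutes_in_image\<close>)
    have le: "r i \<le> r (p i)" if "i \<in> I" for i
      using less[OF that] by (cases "p i = i") auto
    have sum_eq: "(\<Sum>i\<in>I. r i) = (\<Sum>i\<in>I. r (p i))" using sum.permute[OF p(1), of r] by simp
    have eq: "r i = r (p i)" if "i \<in> I" for i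
      by (rule sum_mono_inv[OF sum_eq _ that I]) (rule le)
    have "p i = i" for i
    proof (cases "i \<in> I")
      case True
      then show ?thesis using less[OF True] eq[OF True] by auto
    qed (use p in \<open>auto simp: permutes_not_in\<close>)
    then show False using p(2) by auto
  qed
  have "sdet I A = (\<Sum>p\<in>{id}. of_int (sign p) * (\<Prod>i\<in>I. A i (p i)))"
    unfolding sdet_def by (rule sum.mono_neutral_right) (auto simp: 0 I finite_permutations permutes_id)
  then show ?thesis by simp
qed

text \<open>Column \<open>n\<close> vanishes off the diagonal, and a permutation that moves
  \<open>n\<close> must use one of these vanishing entries.\<close>

lemma sdet_insert:
  assumes I: "finite I" and n: "n \<notin> I" and A: "\<And>i. i \<in> I \<Longrightarrow> A i n = 0"
  shows "sdet (insert n I) A = A n n * sdet I A"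
proof -
  have 0: "(\<Prod>i\<in>insert n I. A i (p i)) = 0" if p: "p permutes insert n I" "\<not> p permutes I" for p
  proof -
    have "p n \<noteq> n" using permutes_superset[OF p(1), of I] p(2) by auto
    moreover obtain i where i: "p i = n" using p(1) by (metis permutes_surj surjD)
    moreover have "i \<in> insert n I" using permutes_in_image[OF p(1), of i] i by auto
    ultimately have "i \<in> I" by auto
    then have "i \<in> insert n I" "A i (p i) = 0" using A i by auto
    then show ?thesis using I by (intro prod_zero) auto
  qed
  have "sdet (insert n I) A = (\<Sum>p | p permutes I. of_int (sign p) * (\<Prod>i\<in>insert n I. A i (p i)))"
    unfolding sdet_def using I 
    by (intro sum.mono_neutral_right) (auto simp: 0 finite_permutations intro: permutes_subset)
  also have "\<dots> = A n n * sdet I A"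
    unfolding sdet_def sum_distrib_left using I n
    by (intro sum.cong refl) (auto simp: permutes_not_in mult_ac)
  finally show ?thesis .
qed

lemma sdet_zero_row:
  assumes "finite I" "i \<in> I" "\<And>j. j \<in> I \<Longrightarrow> A i j = 0" shows "sdet I A = 0"
  unfolding sdet_def
proof (intro sum.neutral ballI)
  fix p assume "p \<in> {p. p permutes I}"
  then have "(\<Prod>i\<in>I. A i (p i)) = 0" using assms by (intro prod_zero) (auto simp: permutes_in_image intro!: bexI[of _ i])
  then show "of_int (sign p) * (\<Prod>i\<in>I. A i (p i)) = 0" by simp
qed

lemma sdet_scale_columns:
  assumes "finite I"
  shows "sdet I (\<lambda>i j. A i j * c j) = (\<Prod>j\<in>I. c j) * sdet I A"
  unfolding sdet_def sum_distrib_left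
proof (intro sum.cong refl)
  fix p assume "p \<in> {p. p permutes I}"
  then have "(\<Prod>i\<in>I. c (p i)) = (\<Prod>j\<in>I. c j)" by (simp add: prod.permute[symmetric, unfolded o_def])
  then show "of_int (sign p) * (\<Prod>i\<in>I. A i (p i) * c (p i)) = prod c I * (of_int (sign p) * (\<Prod>i\<in>I. A i (p i)))"
    by (simp add: prod.distrib mult_ac)
qed

text \<open>In each row either the identity or \<open>A\<close> is chosen; \<open>S\<close> collects
  the rows where it is \<open>A\<close>. The identity rows force fixed points outside
  \<open>S\<close>, so only permutations of \<open>S\<close> remain. This is the Fredholm expansion
  on a finite set.\<close>

lemma sdet_one_plus_minors:
  assumes I: "finite I"
  shows "sdet I (\<lambda>i j. of_bool (i = j) + A i j) = (\<Sum>S\<in>Pow I. sdet S A)"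
proof -
  have "sdet I (\<lambda>i j. of_bool (i = j) + A i j)
     = (\<Sum>p | p permutes I. \<Sum>S\<in>Pow I. of_int (sign p) * ((\<Prod>i\<in>S. A i (p i)) * (\<Prod>i\<in>I - S. of_bool (i = p i))))"
    unfolding sdet_def
  proof (intro sum.cong refl)
    fix p assume "p \<in> {p. p permutes I}"
    have "(\<Prod>i\<in>I. of_bool (i = p i) + A i (p i)) = (\<Prod>i\<in>I. A i (p i) + of_bool (i = p i))"
      by (simp add: add.commute)
    also have "\<dots> = (\<Sum>S\<in>Pow I. (\<Prod>i\<in>S. A i (p i)) * (\<Prod>i\<in>I - S. of_bool (i = p i)))"
      by (rule prod_add[OF I])
    finally show "of_int (sign p) * (\<Prod>i\<in>I. of_bool (i = p i) + A i (p i))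
      = (\<Sum>S\<in>Pow I. of_int (sign p) * ((\<Prod>i\<in>S. A i (p i)) * (\<Prod>i\<in>I - S. of_bool (i = p i))))"
      by (simp add: sum_distrib_left)
  qed
  also have "\<dots> = (\<Sum>S\<in>Pow I. \<Sum>p | p permutes I. of_int (sign p) * ((\<Prod>i\<in>S. A i (p i)) * (\<Prod>i\<in>I - S. of_bool (i = p i))))"
    by (rule sum.swap)
  also have "\<dots> = (\<Sum>S\<in>Pow I. sdet S A)"
  proof (intro sum.cong refl)
    fix S assume S: "S \<in> Pow I"
    then have fin: "finite (I - S)" using I by auto
    have "(\<Sum>p | p permutes I. of_int (sign p) * ((\<Prod>i\<in>S. A i (p i)) * (\<Prod>i\<in>I - S. of_bool (i = p i))))
      = (\<Sum>p | p permutes S. of_int (sign p) * ((\<Prod>i\<in>S. A i (p i)) * (\<Prod>i\<in>I - S. of_bool (i = p i))))"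
    proof (rule sum.mono_neutral_right)
      show "finite {p. p permutes I}" using I by (rule finite_permutations)
      show "{p. p permutes S} \<subseteq> {p. p permutes I}" using S by (auto intro: permutes_subset)
      show "\<forall>p\<in>{p. p permutes I} - {p. p permutes S}.
         of_int (sign p) * ((\<Prod>i\<in>S. A i (p i)) * (\<Prod>i\<in>I - S. of_bool (i = p i))) = 0"
      proof
        fix p assume p: "p \<in> {p. p permutes I} - {p. p permutes S}"
        then have "\<exists>i\<in>I - S. p i \<noteq> i" by (auto intro: permutes_superset)
        then have "(\<Prod>i\<in>I - S. of_bool (i = p i)) = (0::'b)" using fin by (intro prod_zero) (auto dest: sym)
        then show "of_int (sign p) * ((\<Prod>i\<in>S. A i (p i)) * (\<Prod>i\<in>I - S. of_bool (i = p i))) = 0" by simp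
      qed
    qed
    also have "\<dots> = sdet S A" unfolding sdet_def
      by (intro sum.cong refl) (auto simp: permutes_not_in intro!: prod.neutral)
    finally show "(\<Sum>p | p permutes I. of_int (sign p) * ((\<Prod>i\<in>S. A i (p i)) * (\<Prod>i\<in>I - S. of_bool (i = p i)))) = sdet S A" .
  qed
  finally show ?thesis .
qed

lemma sdet_permute_rows:
  assumes I: "finite I" and q: "q permutes I"
  shows "sdet I (\<lambda>i j. A (q i) j) = of_int (sign q) * sdet I A"
proof -
  have "sdet I (\<lambda>i j. A (q i) j) = (\<Sum>p | p permutes I. of_int (sign (p \<circ> q)) * (\<Prod>i\<in>I. A (q i) ((p \<circ> q) i)))"
    unfolding sdet_def by (rule sum_permutations_compose_right[OF q])
  also have "\<dots> = of_int (sign q) * sdet I A"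
    unfolding sdet_def sum_distrib_left
  proof (intro sum.cong refl)
    fix p assume "p \<in> {p. p permutes I}"
    then have p: "p permutes I" by simp
    have "sign (p \<circ> q) = sign p * sign q"
      using p q I by (intro sign_compose) (auto simp: permutes_imp_permutation)
    moreover have "(\<Prod>i\<in>I. A i (p i)) = (\<Prod>i\<in>I. A (q i) (p (q i)))"
      by (rule prod.permute[OF q, unfolded o_def])
    ultimately show "of_int (sign (p \<circ> q)) * (\<Prod>i\<in>I. A (q i) ((p \<circ> q) i)) = of_int (sign q) * (of_int (sign p) * (\<Prod>i\<in>I. A i (p i)))"
      by (simp add: mult_ac)
  qed
  finally show ?thesis .
qed


section \<open>Vandermonde determinants\<close>

definition vandermonde :: "nat \<Rightarrow> (nat \<Rightarrow> 'a::idom) \<Rightarrow> 'a" where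
  "vandermonde N x = sdet {1..N} (\<lambda>i j. x i ^ (j - 1))"

text \<open>The matrix is the Vandermonde matrix times the matrix of coefficients, which the degree
  bound makes triangular.\<close>

lemma sdet_poly_columns:
  fixes x :: "nat \<Rightarrow> 'a::idom"
  assumes P: "\<And>j. j \<in> {1..N} \<Longrightarrow> degree (P j) \<le> j - 1"
  shows "sdet {1..N} (\<lambda>i j. poly (P j) (x i)) = vandermonde N x * (\<Prod>j\<in>{1..N}. coeff (P j) (j - 1))"
proof -
  have *: "poly (P j) (x i) = (\<Sum>l\<in>{1..N}. x i ^ (l - 1) * coeff (P j) (l - 1))" if j: "j \<in> {1..N}" for i j
  proof -
    have "poly (P j) (x i) = (\<Sum>l<N. coeff (P j) l * x i ^ l)"
      unfolding poly_altdef using P[OF j] j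
      by (intro sum.mono_neutral_left) (auto simp: coeff_eq_0)
    also have "\<dots> = (\<Sum>l\<in>{1..N}. x i ^ (l - 1) * coeff (P j) (l - 1))"
      by (rule sum.reindex_bij_witness[of _ "\<lambda>l. l - 1" Suc]) (auto simp: mult.commute)
    finally show ?thesis .
  qed
  have "sdet {1..N} (\<lambda>i j. poly (P j) (x i)) = sdet {1..N} (\<lambda>i j. \<Sum>l\<in>{1..N}. x i ^ (l - 1) * coeff (P j) (l - 1))"
    by (intro sdet_cong *)
  also have "\<dots> = vandermonde N x * sdet {1..N} (\<lambda>l j. coeff (P j) (l - 1))"
    unfolding vandermonde_def by (rule sdet_mult) simp
  also have "sdet {1..N} (\<lambda>l j. coeff (P j) (l - 1)) = (\<Prod>j\<in>{1..N}. coeff (P j) (j - 1))"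
  proof (rule sdet_triangular[where r = id])
    fix i j assume ij: "i \<in> {1..N}" "j \<in> {1..N}" "i \<noteq> j" "coeff (P j) (i - 1) \<noteq> 0"
    then have "i - 1 \<le> j - 1" using P[of j] le_degree[of "P j" "i - 1"] by auto
    then show "id i < id j" using ij by auto
  qed simp
  finally show ?thesis .
qed

text \<open>Replacing the last column by the values of the monic polynomial \<open>Q\<close> with
  roots \<open>x 1, ..., x N\<close> keeps the determinant and leaves at most one nonzero entry in
  that column.\<close>

lemma vandermonde_eq_prod:
  fixes x :: "nat \<Rightarrow> 'a::idom"
  shows "vandermonde N x = (\<Prod>j\<in>{1..N}. \<Prod>i\<in>{1..<j}. x j - x i)"
proof (induction N)
  case 0
  show ?case by (simp add: vandermonde_def sdet_def)
next
  case (Suc N)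
  define Q where "Q = (\<Prod>i\<in>{1..<Suc N}. [:- x i, 1:])"
  define P where "P j = (if j = Suc N then Q else monom 1 (j - 1))" for j
  have "degree Q = (\<Sum>i\<in>{1..<Suc N}. degree [:- x i, 1:])"
    unfolding Q_def by (rule degree_prod_eq_sum_degree) auto
  then have degQ: "degree Q = N" by simp
  have "lead_coeff Q = (\<Prod>i\<in>{1..<Suc N}. lead_coeff [:- x i, 1:])"
    unfolding Q_def by (rule lead_coeff_prod)
  then have lcQ: "lead_coeff Q = 1" by simp
  have "sdet {1..Suc N} (\<lambda>i j. poly (P j) (x i)) = vandermonde (Suc N) x * (\<Prod>j\<in>{1..Suc N}. coeff (P j) (j - 1))"
    by (rule sdet_poly_columns) (auto simp: P_def degQ intro: degree_monom_le order.trans[OF degree_monom_le])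
  also have "(\<Prod>j\<in>{1..Suc N}. coeff (P j) (j - 1)) = 1"
    using lcQ by (intro prod.neutral) (auto simp: P_def degQ)
  finally have "vandermonde (Suc N) x = sdet (insert (Suc N) {1..N}) (\<lambda>i j. poly (P j) (x i))"
    by (simp add: atLeastAtMostSuc_conv)
  also have "\<dots> = poly Q (x (Suc N)) * sdet {1..N} (\<lambda>i j. poly (P j) (x i))"
  proof (subst sdet_insert)
    fix i assume "i \<in> {1..N}"
    then show "poly (P (Suc N)) (x i) = 0"
      by (auto simp: P_def Q_def poly_prod simp del: prod.op_ivl_Suc intro!: prod_zero bexI[of _ i])
  qed (auto simp: P_def)
  also have "sdet {1..N} (\<lambda>i j. poly (P j) (x i)) = vandermonde N x"
    unfolding vandermonde_def by (rule sdet_cong) (auto simp: P_def poly_monom)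
  also have "poly Q (x (Suc N)) = (\<Prod>i\<in>{1..<Suc N}. x (Suc N) - x i)"
    by (simp add: Q_def poly_prod del: prod.op_ivl_Suc)
  finally show ?case unfolding Suc.IH by (simp add: mult.commute atLeastAtMostSuc_conv del: prod.op_ivl_Suc)
qed

lemma vandermonde_pos:
  fixes x :: "nat \<Rightarrow> 'a::linordered_idom"
  assumes "strict_mono_on {1..N} x" shows "vandermonde N x > 0"
  unfolding vandermonde_eq_prod using assms
  by (intro prod_pos) (auto simp: strict_mono_on_def)

lemma vandermonde_permute:
  assumes "q permutes {1..N}"
  shows "vandermonde N (x \<circ> q) = of_int (sign q) * vandermonde N x"
  using sdet_permute_rows[OF _ assms, of "\<lambda>i j. x i ^ (j - 1)"] by (simp add: vandermonde_def)

lemma vandermonde_affine: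
  "vandermonde N (\<lambda>i. c * x i + d) = (\<Prod>j\<in>{1..N}. c ^ (j - 1)) * vandermonde N x"
proof -
  have *: "c * x j + d - (c * x i + d) = c * (x j - x i)" for i j by (simp add: algebra_simps)
  show ?thesis unfolding vandermonde_eq_prod * prod.distrib by simp
qed

lemma of_int_vandermonde:
  "of_int (vandermonde N x) = vandermonde N (\<lambda>i. of_int (x i) :: 'a::{idom,ring_char_0})"
  unfolding vandermonde_eq_prod by simp

section \<open>Krawtchouk polynomials\<close>

text \<open>A^r p(B/A) with the denominators cleared: the homogeneous form of degree
  \<open>r\<close> belonging to \<open>p\<close>. The degree is a parameter because \<open>p\<close>
  may have smaller degree. Linear factors of \<open>p\<close> turn into linear combinations of
  \<open>A\<close> and \<open>B\<close>, so a good choice of \<open>A\<close> and \<open>B\<close>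
  makes a product collapse.\<close>

definition homog :: "nat \<Rightarrow> real poly \<Rightarrow> real poly \<Rightarrow> real poly \<Rightarrow> real poly" where
  "homog r p A B = (\<Sum>k\<le>r. Polynomial.smult (coeff p k) (B ^ k * A ^ (r - k)))"

lemma homog_mult_linear:
  assumes "degree p \<le> r"
  shows "homog (Suc r) ([:c, d:] * p) A B = (Polynomial.smult c A + Polynomial.smult d B) * homog r p A B"
proof -
  have "homog (Suc r) ([:c, d:] * p) A B = (\<Sum>k\<le>Suc r. Polynomial.smult (c * coeff p k) (B ^ k * A ^ (Suc r - k)))
     + (\<Sum>k\<le>Suc r. Polynomial.smult (d * (case k of 0 \<Rightarrow> 0 | Suc l \<Rightarrow> coeff p l)) (B ^ k * A ^ (Suc r - k)))"
    unfolding homog_def sum.distrib[symmetric]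
    by (intro sum.cong refl) (auto simp: coeff_pCons smult_add_left split: nat.split)
  also have "(\<Sum>k\<le>Suc r. Polynomial.smult (d * (case k of 0 \<Rightarrow> 0 | Suc l \<Rightarrow> coeff p l)) (B ^ k * A ^ (Suc r - k)))
     = Polynomial.smult d B * homog r p A B"
    unfolding sum.atMost_Suc_shift homog_def sum_distrib_left by (simp add: mult_ac)
  also have "(\<Sum>k\<le>Suc r. Polynomial.smult (c * coeff p k) (B ^ k * A ^ (Suc r - k))) = Polynomial.smult c A * homog r p A B"
    using assms by (auto simp: coeff_eq_0 homog_def sum_distrib_left Suc_diff_le mult_ac intro!: sum.cong)
  finally show ?thesis by (simp add: distrib_right)
qed

lemma homog_linear_powers:
  "homog (s + t) ([:c, d:] ^ s * [:c', d':] ^ t) A B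
   = (Polynomial.smult c A + Polynomial.smult d B) ^ s * (Polynomial.smult c' A + Polynomial.smult d' B) ^ t"
proof -
  have deg: "degree ([:c', d':] ^ t) \<le> t" for t
    using degree_power_le[of "[:c', d':]" t] by (auto intro: order.trans)
  have deg2: "degree ([:c, d:] ^ s * [:c', d':] ^ t) \<le> s + t" for s
  proof (induction s)
    case (Suc s)
    have "degree ([:c, d:] * ([:c, d:] ^ s * [:c', d':] ^ t)) \<le> degree [:c, d:] + degree ([:c, d:] ^ s * [:c', d':] ^ t)"
      by (rule degree_mult_le)
    also have "\<dots> \<le> 1 + (s + t)" using Suc by (intro add_mono) auto
    finally show ?case by (simp only: power_Suc mult.assoc)
  qed (use deg in auto)
  have t: "homog t ([:c', d':] ^ t) A B = (Polynomial.smult c' A + Polynomial.smult d' B) ^ t" for t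
  proof (induction t)
    case (Suc t)
    then show ?case using homog_mult_linear[OF deg[of t], of c' d' A B] by simp
  qed (simp add: homog_def)
  show ?thesis
  proof (induction s)
    case (Suc s)
    then show ?case using homog_mult_linear[OF deg2[of s], of c d A B] by (simp only: power_Suc mult.assoc add_Suc)
  qed (simp add: t)
qed

text \<open>Krawtchouk polynomials in the number \<open>b\<close> of upward steps among \<open>m\<close> (the walk is then at
  \<open>2 * b - m\<close>) and the dual family, by generating functions.\<close>

definition kraw :: "nat \<Rightarrow> nat \<Rightarrow> nat \<Rightarrow> real" where
  "kraw m b k = coeff ([:1, 1:] ^ b * [:1, -1:] ^ (m - b)) k"

definition kdual :: "nat \<Rightarrow> nat \<Rightarrow> nat \<Rightarrow> real" where
  "kdual m k b = coeff ([:-1, 1:] ^ k * [:1, 1:] ^ (m - k)) b"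

lemma coeff_linear_power: "coeff ([:c, d:] ^ m) b = (if b \<le> m then of_nat (m choose b) * c ^ (m - b) * d ^ b else (0::real))"
proof -
  have "[:c, d:] ^ m = (monom d 1 + [:c:]) ^ m" by (simp add: monom_altdef)
  also have "\<dots> = (\<Sum>k\<le>m. monom (of_nat (m choose k) * c ^ (m - k) * d ^ k) k)"
    unfolding binomial_ring
    by (intro sum.cong refl) (simp add: monom_power poly_const_pow of_nat_poly smult_monom mult_ac)
  finally show ?thesis by (auto simp: coeff_sum sum.delta if_distrib cong: if_cong)
qed

lemma power_linear_mult_const: 
  assumes "a \<le> r"
  shows "[:0, 2:] ^ a * [:2:] ^ (r - a) = Polynomial.smult (2 ^ r) (monom (1::real) a)"
proof -
  have *: "[:0, 2:] = monom (2::real) 1" by (simp add: monom_altdef)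
  have "[:0, 2:] ^ a * [:2:] ^ (r - a) = monom ((2::real) ^ a * 2 ^ (r - a)) a" 
    unfolding * monom_power poly_const_pow by (simp add: smult_monom mult.commute)
  also have "2 ^ a * 2 ^ (r - a) = (2::real) ^ r" using assms by (simp flip: power_add)
  finally show ?thesis by (simp add: smult_monom)
qed

text \<open>Substituting A = 1 + z and B = z - 1 turns (A + B)^a (A - B)^(r - a) into 2^r z^a.
  Multiplied by (1 + z)^n, this has the right side as coefficient of z^b, while the terms of
  \<open>homog\<close> give the products of \<open>kraw\<close> and \<open>kdual\<close>.\<close>

lemma binomial_kraw_kdual:
  assumes "a \<le> r"
  shows "(\<Sum>k\<le>r. kraw r a k * kdual (n + r) k b) = 2 ^ r * (if a \<le> b then real (n choose (b - a)) else 0)"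
proof -
  have "homog (a + (r - a)) ([:1, 1:] ^ a * [:1, -1:] ^ (r - a)) [:1, 1:] [:-1, 1:] = [:0, 2:] ^ a * [:2:] ^ (r - a)"
    unfolding homog_linear_powers by simp
  then have "homog r ([:1, 1:] ^ a * [:1, -1:] ^ (r - a)) [:1, 1:] [:-1, 1:] = Polynomial.smult (2 ^ r) (monom 1 a)"
    unfolding power_linear_mult_const[OF assms] using assms by simp
  then have "homog r ([:1, 1:] ^ a * [:1, -1:] ^ (r - a)) [:1, 1:] [:-1, 1:] * [:1, 1:] ^ n = Polynomial.smult (2 ^ r) (monom 1 a * [:1, 1:] ^ n)"
    by simp
  then have "coeff (homog r ([:1, 1:] ^ a * [:1, -1:] ^ (r - a)) [:1, 1:] [:-1, 1:] * [:1, 1:] ^ n) b = 2 ^ r * coeff (monom 1 a * [:1, 1:] ^ n) b"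
    by simp
  moreover have "coeff (homog r ([:1, 1:] ^ a * [:1, -1:] ^ (r - a)) [:1, 1:] [:-1, 1:] * [:1, 1:] ^ n) b
     = (\<Sum>k\<le>r. kraw r a k * kdual (n + r) k b)"
    unfolding homog_def sum_distrib_right coeff_sum kraw_def kdual_def
    by (intro sum.cong refl) (simp add: mult.assoc add.commute flip: power_add)
  ultimately show ?thesis by (auto simp: coeff_monom_mult coeff_linear_power)
qed

text \<open>Both sides are the coefficient of z^b w^k in (1 + z + w (z - 1))^m = ((1 - w) + (1 + w)
  z)^m.\<close>

lemma kraw_kdual_symmetry:
  assumes "k \<le> m" "b \<le> m"
  shows "real (m choose k) * kdual m k b = real (m choose b) * kraw m b k"
proof -
  have "poly (\<Sum>k\<le>m. monom (real (m choose k) * kdual m k b) k) w = poly (Polynomial.smult (real (m choose b)) ([:1, 1:] ^ b * [:1, -1:] ^ (m - b))) w" for w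
  proof -
    have "(Polynomial.smult w [:-1, 1:] + [:1, 1:]) ^ m = [:1 - w, 1 + w:] ^ m" by (simp add: add.commute)
    then have "coeff ((Polynomial.smult w [:-1, 1:] + [:1, 1:]) ^ m) b = coeff ([:1 - w, 1 + w:] ^ m) b" by simp
    also have "\<dots> = real (m choose b) * (1 - w) ^ (m - b) * (1 + w) ^ b" using assms by (simp add: coeff_linear_power)
    also have "coeff ((Polynomial.smult w [:-1, 1:] + [:1, 1:]) ^ m) b = (\<Sum>k\<le>m. real (m choose k) * kdual m k b * w ^ k)"
      unfolding binomial_ring coeff_sum
      by (intro sum.cong refl) (simp add: kdual_def smult_power of_nat_poly del: smult_pCons)
    finally show ?thesis by (simp add: poly_sum poly_monom add.commute mult_ac)
  qed
  then have "(\<Sum>k\<le>m. monom (real (m choose k) * kdual m k b) k) = Polynomial.smult (real (m choose b)) ([:1, 1:] ^ b * [:1, -1:] ^ (m - b))"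
    by (intro iffD1[OF poly_eq_poly_eq_iff] ext)
  then have "coeff (\<Sum>k\<le>m. monom (real (m choose k) * kdual m k b) k) k = real (m choose b) * kraw m b k"
    by (simp add: kraw_def)
  then show ?thesis using assms by (simp add: coeff_sum sum.delta if_distrib cong: if_cong)
qed

text \<open>With A = 1 - w and B = 1 + w the factors B - A and A + B become 2 w and 2, so only the
  power w^k survives.\<close>

lemma kdual_kraw_orthogonal:
  assumes "k \<le> m"
  shows "(\<Sum>b\<le>m. kdual m k b * kraw m b l) = (if k = l then 2 ^ m else 0)"
proof -
  have "homog (k + (m - k)) ([:-1, 1:] ^ k * [:1, 1:] ^ (m - k)) [:1, -1:] [:1, 1:] = [:0, 2:] ^ k * [:2:] ^ (m - k)"
    unfolding homog_linear_powers by simp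
  then have "homog m ([:-1, 1:] ^ k * [:1, 1:] ^ (m - k)) [:1, -1:] [:1, 1:] = Polynomial.smult (2 ^ m) (monom 1 k)"
    unfolding power_linear_mult_const[OF assms] using assms by simp
  then have "coeff (homog m ([:-1, 1:] ^ k * [:1, 1:] ^ (m - k)) [:1, -1:] [:1, 1:]) l = (if k = l then 2 ^ m else 0)"
    by simp
  then show ?thesis by (simp add: homog_def coeff_sum kraw_def kdual_def)
qed

text \<open>Cauchy-Schwarz with weights \<open>m choose b\<close>: by symmetry and orthogonality the
  squares of \<open>kdual m k\<close> divided by these weights sum to 2^m / (m choose k), and the
  weights themselves sum to 2^m.\<close>

lemma sum_abs_kdual_le:
  assumes "k \<le> m"
  shows "(\<Sum>b\<le>m. \<bar>kdual m k b\<bar>) \<le> 2 ^ m / sqrt (real (m choose k))"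
proof -
  have pos: "0 < real (m choose b)" if "b \<le> m" for b using that by simp
  have "(\<Sum>b\<le>m. \<bar>kdual m k b\<bar>)\<^sup>2 = (\<Sum>b\<le>m. (\<bar>kdual m k b\<bar> / sqrt (real (m choose b))) * sqrt (real (m choose b)))\<^sup>2"
    by (intro arg_cong[where f="\<lambda>x. x\<^sup>2"] sum.cong refl) auto
  also have "\<dots> \<le> (\<Sum>b\<le>m. (\<bar>kdual m k b\<bar> / sqrt (real (m choose b)))\<^sup>2) * (\<Sum>b\<le>m. (sqrt (real (m choose b)))\<^sup>2)"
    by (rule Cauchy_Schwarz_ineq_sum)
  also have "(\<Sum>b\<le>m. (\<bar>kdual m k b\<bar> / sqrt (real (m choose b)))\<^sup>2) = (\<Sum>b\<le>m. kdual m k b * kraw m b k) / real (m choose k)"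
    unfolding sum_divide_distrib
  proof (intro sum.cong refl)
    fix b assume b: "b \<in> {..m}"
    show "(\<bar>kdual m k b\<bar> / sqrt (real (m choose b)))\<^sup>2 = kdual m k b * kraw m b k / real (m choose k)"
      using kraw_kdual_symmetry[OF assms, of b] b pos[of b] pos[OF assms]
      by (simp add: power_divide field_simps power2_eq_square)
  qed
  also have "(\<Sum>b\<le>m. kdual m k b * kraw m b k) = 2 ^ m" by (simp add: kdual_kraw_orthogonal[OF assms])
  also have "(\<Sum>b\<le>m. (sqrt (real (m choose b)))\<^sup>2) = 2 ^ m"
    using choose_row_sum[of m] by (simp flip: of_nat_sum)
  also have "2 ^ m / real (m choose k) * 2 ^ m = (2 ^ m / sqrt (real (m choose k)))\<^sup>2"
    using pos[OF assms] by (simp add: power_divide power2_eq_square)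
  finally show ?thesis by (rule power2_le_imp_le) simp
qed

text \<open>Comes from writing 1 + z = (1 - z) + 2 z in the generating function and expanding in
  powers of 2 z; the product of the linear factors divided by \<open>fact i\<close> is b choose i as
  a polynomial in b.\<close>

definition kraw_poly :: "nat \<Rightarrow> nat \<Rightarrow> real poly" where
  "kraw_poly m k = (\<Sum>i\<le>k. Polynomial.smult (2 ^ i * real (m - i choose (k - i)) * (-1) ^ (k - i) / fact i)
     (\<Prod>j<i. [:- real j, 1:]))"

lemma degree_prod_linear: "degree (\<Prod>j<i. [:- real j, 1:]) = i" 
  and lead_coeff_prod_linear: "coeff (\<Prod>j<i. [:- real j, 1:]) i = 1"
proof -
  have "degree (\<Prod>j<i. [:- real j, 1:]) = (\<Sum>j<i. degree [:- real j, 1:])"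
    by (rule degree_prod_eq_sum_degree) auto
  then show deg: "degree (\<Prod>j<i. [:- real j, 1:]) = i" by simp
  have "lead_coeff (\<Prod>j<i. [:- real j, 1:]) = (\<Prod>j<i. lead_coeff [:- real j, 1:])"
    by (rule lead_coeff_prod)
  then show "coeff (\<Prod>j<i. [:- real j, 1:]) i = 1" by (simp add: deg)
qed

lemma degree_kraw_poly: "degree (kraw_poly m k) \<le> k"
  unfolding kraw_poly_def
  by (intro degree_sum_le finite_atMost order.trans[OF degree_smult_le]) (simp add: degree_prod_linear)

lemma coeff_kraw_poly: "coeff (kraw_poly m k) k = 2 ^ k / fact k"
proof -
  have "coeff (kraw_poly m k) k = (\<Sum>i\<in>{k}. 2 ^ i * real (m - i choose (k - i)) * (-1) ^ (k - i) / fact i *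
     coeff (\<Prod>j<i. [:- real j, 1:]) k)"
    unfolding kraw_poly_def coeff_sum coeff_smult
    by (intro sum.mono_neutral_right) (auto simp: coeff_eq_0 degree_prod_linear)
  then show ?thesis by (simp add: lead_coeff_prod_linear)
qed

lemma kraw_eq_poly:
  assumes "b \<le> m"
  shows "kraw m b k = poly (kraw_poly m k) (real b)"
proof -
  have choose: "real (b choose i) = (\<Prod>j<i. real b - real j) / fact i" for i
    by (simp add: binomial_gbinomial gbinomial_prod_rev atLeast0LessThan)
  have *: "[:1, 1:] = (monom 2 1 + [:1, -1:] :: real poly)" by (simp add: monom_altdef)
  have "[:1, 1:] ^ b * [:1, -1:] ^ (m - b) = (\<Sum>i\<le>b. Polynomial.smult (real (b choose i) * 2 ^ i) (monom 1 i * [:1, -1:] ^ (m - i)))"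
    unfolding * binomial_ring sum_distrib_right
  proof (intro sum.cong refl)
    fix i assume i: "i \<in> {..b}"
    then have pw: "[:1, -1:] ^ (b - i) * [:1, -1:] ^ (m - b) = ([:1, -1:] :: real poly) ^ (m - i)"
      using assms by (simp flip: power_add)
    have mm: "monom (2 ^ i) i = Polynomial.smult (2 ^ i) (monom (1::real) i)" by (simp add: smult_monom)
    show "of_nat (b choose i) * monom 2 1 ^ i * [:1, -1:] ^ (b - i) * [:1, -1:] ^ (m - b) =
       Polynomial.smult (real (b choose i) * 2 ^ i) (monom 1 i * [:1, -1:] ^ (m - i))"
      by (simp add: monom_power mm of_nat_poly mult.assoc pw mult.commute[of "2 ^ i"])
  qed
  then have "kraw m b k = (\<Sum>i\<le>b. real (b choose i) * 2 ^ i * coeff (monom 1 i * [:1, -1:] ^ (m - i)) k)"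
    by (simp add: kraw_def coeff_sum)
  also have "\<dots> = (\<Sum>i\<le>b. if i \<le> k then real (b choose i) * 2 ^ i * (real (m - i choose (k - i)) * (-1) ^ (k - i)) else 0)"
    by (intro sum.cong refl) (auto simp: coeff_monom_mult coeff_linear_power)
  also have "\<dots> = (\<Sum>i | i \<le> b \<and> i \<le> k. real (b choose i) * 2 ^ i * (real (m - i choose (k - i)) * (-1) ^ (k - i)))"
    by (subst sum.inter_filter[symmetric]) auto
  also have "\<dots> = (\<Sum>i\<le>k. real (b choose i) * 2 ^ i * (real (m - i choose (k - i)) * (-1) ^ (k - i)))"
    by (intro sum.mono_neutral_left) auto
  also have "\<dots> = poly (kraw_poly m k) (real b)"
    unfolding kraw_poly_def poly_sum by (intro sum.cong refl) (simp add: choose poly_prod)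
  finally show ?thesis .
qed

section \<open>The averaging operator of the walk\<close>

declare One_nat_def [simp del]

definition avg1 :: "(int \<Rightarrow> real) \<Rightarrow> int \<Rightarrow> real" where
  "avg1 f x = (f (x + 1) + f (x - 1)) / 2"

definition steps :: "nat \<Rightarrow> (nat \<Rightarrow> int) set" where
  "steps N = {1..N} \<rightarrow>\<^sub>E {-1, 1}"

definition avg :: "nat \<Rightarrow> ((nat \<Rightarrow> int) \<Rightarrow> real) \<Rightarrow> (nat \<Rightarrow> int) \<Rightarrow> real" where
  "avg N F x = (\<Sum>e\<in>steps N. F (\<lambda>i. x i + e i)) / 2 ^ N"

text \<open>Elements of \<open>steps N\<close> are \<open>undefined\<close> outside
  \<open>{1..N}\<close>, so adding a step spoils the coordinates there; only functions that ignore
  them behave well under \<open>avg\<close>.\<close>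

definition depends_on :: "nat \<Rightarrow> ((nat \<Rightarrow> int) \<Rightarrow> real) \<Rightarrow> bool" where
  "depends_on N F \<longleftrightarrow> (\<forall>x y. (\<forall>i\<in>{1..N}. x i = y i) \<longrightarrow> F x = F y)"

lemma depends_onD: "depends_on N F \<Longrightarrow> (\<And>i. i \<in> {1..N} \<Longrightarrow> x i = y i) \<Longrightarrow> F x = F y"
  unfolding depends_on_def by blast

lemma finite_steps [simp]: "finite (steps N)"
  unfolding steps_def by (intro finite_PiE) auto

lemma card_steps: "card (steps N) = 2 ^ N"
  unfolding steps_def by (subst card_PiE) (auto simp: numeral_2_eq_2)

lemma avg_prod:
  "avg N (\<lambda>x. \<Prod>i\<in>{1..N}. f i (x i)) x = (\<Prod>i\<in>{1..N}. avg1 (f i) (x i))"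
proof -
  have "(\<Prod>i\<in>{1..N}. \<Sum>e\<in>{-1, 1}. f i (x i + e)) = (\<Sum>e\<in>steps N. \<Prod>i\<in>{1..N}. f i (x i + e i))"
    unfolding steps_def by (rule prod_sum_PiE) auto
  moreover have "(\<Prod>i\<in>{1..N}. avg1 (f i) (x i)) = (\<Prod>i\<in>{1..N}. \<Sum>e\<in>{-1, 1}. f i (x i + e)) / 2 ^ N"
    by (simp add: avg1_def prod_dividef add.commute)
  ultimately show ?thesis by (simp add: avg_def)
qed

lemma avg_sum: "avg N (\<lambda>x. \<Sum>j\<in>J. c j * F j x) x = (\<Sum>j\<in>J. c j * avg N (F j) x)"
  unfolding avg_def sum_distrib_left sum_divide_distrib by (subst sum.swap) simp

lemma avg_funpow_sum: "(avg N ^^ n) (\<lambda>x. \<Sum>j\<in>J. c j * F j x) x = (\<Sum>j\<in>J. c j * (avg N ^^ n) (F j) x)"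
proof (induction n arbitrary: x)
  case (Suc n)
  have "(avg N ^^ n) (\<lambda>x. \<Sum>j\<in>J. c j * F j x) = (\<lambda>x. \<Sum>j\<in>J. c j * (avg N ^^ n) (F j) x)"
    using Suc by blast
  then show ?case by (simp add: avg_sum)
qed auto

lemma avg_funpow_prod:
  "(avg N ^^ n) (\<lambda>x. \<Prod>i\<in>{1..N}. f i (x i)) x = (\<Prod>i\<in>{1..N}. (avg1 ^^ n) (f i) (x i))"
proof (induction n arbitrary: x)
  case (Suc n)
  have "(avg N ^^ n) (\<lambda>x. \<Prod>i\<in>{1..N}. f i (x i)) = (\<lambda>x. \<Prod>i\<in>{1..N}. (avg1 ^^ n) (f i) (x i))"
    using Suc by blast
  then show ?case using avg_prod[of N "\<lambda>i. (avg1 ^^ n) (f i)" x] by simp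
qed auto

lemma avg_sdet:
  "avg N (\<lambda>x. sdet {1..N} (\<lambda>i j. f j (x i))) x = sdet {1..N} (\<lambda>i j. avg1 (f j) (x i))"
  unfolding sdet_def avg_sum using avg_prod[where f = "\<lambda>i. f (_ i)"] 
  by (intro sum.cong refl arg_cong2[where f="(*)"]) (rule avg_prod)

lemma depends_on_avg: "depends_on N F \<Longrightarrow> depends_on N (avg N F)"
  unfolding depends_on_def avg_def 
  by (intro allI impI arg_cong2[where f="(/)"] refl sum.cong) auto

text \<open>The sites that a walk started at 0 can occupy at time \<open>r\<close>. Starting points
  are placed in such a lattice as if they had come from 0, which gives each of them a number of
  upward steps, the variable of the Krawtchouk polynomials.\<close>

definition lattice :: "nat \<Rightarrow> int set" where
  "lattice r = {x. \<bar>x\<bar> \<le> int r \<and> even (x + int r)}"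

lemma lattice_step: "x \<in> lattice r \<Longrightarrow> e \<in> {-1, 1} \<Longrightarrow> x + e \<in> lattice (Suc r)"
  by (auto simp: lattice_def)

lemma latticeE:
  assumes "x \<in> lattice r" obtains a where "a \<le> r" "x = 2 * int a - int r"
proof
  have x: "\<bar>x\<bar> \<le> int r" "even (x + int r)" using assms by (auto simp: lattice_def)
  show "nat ((x + int r) div 2) \<le> r" using x by linarith
  show "x = 2 * int (nat ((x + int r) div 2)) - int r" using x by simp
qed

lemma avg_funpow_cong_lattice:
  assumes "\<And>y. (\<And>i. i \<in> {1..N} \<Longrightarrow> y i \<in> lattice (n + r)) \<Longrightarrow> F y = F' y"
    and "\<And>i. i \<in> {1..N} \<Longrightarrow> x i \<in> lattice r"
  shows "(avg N ^^ n) F x = (avg N ^^ n) F' x"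
  using assms(1)
proof (induction n arbitrary: F F')
  case 0
  then show ?case using assms(2) by simp
next
  case (Suc n)
  have "(avg N ^^ n) (avg N F) x = (avg N ^^ n) (avg N F') x"
  proof (rule Suc.IH)
    fix y assume y: "\<And>i. i \<in> {1..N} \<Longrightarrow> y i \<in> lattice (n + r)"
    show "avg N F y = avg N F' y"
      unfolding avg_def
    proof (intro arg_cong2[where f="(/)"] refl sum.cong)
      fix e assume e: "e \<in> steps N"
      show "F (\<lambda>i. y i + e i) = F' (\<lambda>i. y i + e i)"
      proof (rule Suc.prems)
        fix i assume i: "i \<in> {1..N}"
        then have "e i \<in> {-1, 1}" using e by (auto simp: steps_def)
        then show "y i + e i \<in> lattice (Suc n + r)" using lattice_step[OF y[OF i]] by simp
      qed
    qed
  qed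
  then show ?case by (simp add: funpow_swap1)
qed

lemma avg1_funpow:
  "(avg1 ^^ n) f x = (\<Sum>c\<le>n. real (n choose c) * f (x + 2 * int c - int n)) / 2 ^ n"
proof (induction n arbitrary: f)
  case (Suc n)
  let ?g = "\<lambda>c. f (x + 2 * int c - int (Suc n))"
  have "(avg1 ^^ Suc n) f x = (avg1 ^^ n) (avg1 f) x" by (simp add: funpow_swap1)
  also have "\<dots> = (\<Sum>c\<le>n. real (n choose c) * avg1 f (x + 2 * int c - int n)) / 2 ^ n" by (rule Suc.IH)
  also have "\<dots> = ((\<Sum>c\<le>n. real (n choose c) * ?g (Suc c)) + (\<Sum>c\<le>n. real (n choose c) * ?g c)) / 2 ^ Suc n"
    unfolding sum.distrib[symmetric] sum_divide_distrib
    by (intro sum.cong refl) (simp add: avg1_def field_simps)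
  also have "(\<Sum>c\<le>n. real (n choose c) * ?g (Suc c)) + (\<Sum>c\<le>n. real (n choose c) * ?g c) = (\<Sum>c\<le>Suc n. real (Suc n choose c) * ?g c)"
  proof -
    have "(\<Sum>c\<le>n. real (n choose c) * ?g c) = (\<Sum>c\<le>Suc n. real (n choose c) * ?g c)" by simp
    also have "\<dots> = ?g 0 + (\<Sum>c\<le>n. real (n choose Suc c) * ?g (Suc c))"
      by (subst sum.atMost_Suc_shift) simp
    finally have "(\<Sum>c\<le>n. real (n choose c) * ?g (Suc c)) + (\<Sum>c\<le>n. real (n choose c) * ?g c)
       = ?g 0 + (\<Sum>c\<le>n. real (Suc n choose Suc c) * ?g (Suc c))"
      by (simp add: sum.distrib[symmetric] distrib_right)
    also have "\<dots> = (\<Sum>c\<le>Suc n. real (Suc n choose c) * ?g c)"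
      unfolding sum.atMost_Suc_shift by simp
    finally show ?thesis .
  qed
  finally show ?case .
qed simp

text \<open>The transition in \<open>n\<close> steps needs \<open>b - a\<close> upward ones, so the
  left side is a binomial coefficient over 2^n; its expansion separates the starting point
  \<open>a\<close> from the end point \<open>b\<close>.\<close>

lemma avg1_funpow_delta:
  assumes "a \<le> r"
  shows "(avg1 ^^ n) (\<lambda>y. of_bool (y = 2 * int b - int (n + r))) (2 * int a - int r)
    = (\<Sum>k\<le>r. kraw r a k * kdual (n + r) k b) / 2 ^ (n + r)"
proof -
  have "(\<Sum>c\<le>n. real (n choose c) * of_bool (2 * int a - int r + 2 * int c - int n = 2 * int b - int (n + r)))
    = (\<Sum>c\<le>n. if c + a = b then real (n choose c) else 0)"
    by (intro sum.cong refl) auto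
  also have "\<dots> = (\<Sum>c\<in>(if a \<le> b \<and> b - a \<le> n then {b - a} else {}). real (n choose c))"
    by (intro sum.mono_neutral_cong_right) (auto split: if_splits)
  also have "\<dots> = (if a \<le> b then real (n choose (b - a)) else 0)" by auto
  finally show ?thesis unfolding avg1_funpow binomial_kraw_kdual[OF assms] by (simp add: power_add)
qed

text \<open>On the final lattice \<open>F\<close> is a sum of point masses, which are products over
  the walkers. The degrees \<open>k i\<close> are at most the fixed \<open>r\<close>, so the
  dependence on \<open>n\<close> sits in finitely many coefficients and that on the starting points
  in \<open>kraw r\<close>.\<close>

lemma avg_funpow_expansion:
  assumes F: "depends_on N F" and a: "\<And>i. i \<in> {1..N} \<Longrightarrow> a i \<le> r"
  shows "(avg N ^^ n) F (\<lambda>i. 2 * int (a i) - int r) =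
    (\<Sum>k\<in>({1..N} \<rightarrow>\<^sub>E {..r}). (\<Prod>i\<in>{1..N}. kraw r (a i) (k i)) *
       (\<Sum>b\<in>({1..N} \<rightarrow>\<^sub>E {..n + r}). F (\<lambda>i. 2 * int (b i) - int (n + r)) * (\<Prod>i\<in>{1..N}. kdual (n + r) (k i) (b i) / 2 ^ (n + r))))"
proof -
  define m where "m = n + r"
  let ?B = "{1..N} \<rightarrow>\<^sub>E {..m}"
  let ?p = "\<lambda>b i. 2 * int (b i) - int m :: int"
  have finB: "finite ?B" by (intro finite_PiE) auto
  have "(avg N ^^ n) F (\<lambda>i. 2 * int (a i) - int r) 
    = (avg N ^^ n) (\<lambda>y. \<Sum>b\<in>?B. F (?p b) * (\<Prod>i\<in>{1..N}. of_bool (y i = ?p b i))) (\<lambda>i. 2 * int (a i) - int r)"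
  proof (rule avg_funpow_cong_lattice)
    fix y assume y: "\<And>i. i \<in> {1..N} \<Longrightarrow> y i \<in> lattice (n + r)"
    have "\<forall>i\<in>{1..N}. \<exists>c\<le>m. y i = 2 * int c - int m"
      using latticeE[OF y] unfolding m_def by metis
    then obtain b where b: "\<And>i. i \<in> {1..N} \<Longrightarrow> b i \<le> m \<and> y i = 2 * int (b i) - int m" by metis
    let ?b = "restrict b {1..N}"
    have "(\<Sum>b\<in>?B. F (?p b) * (\<Prod>i\<in>{1..N}. of_bool (y i = ?p b i))) 
       = (\<Sum>b\<in>{?b}. F (?p b) * (\<Prod>i\<in>{1..N}. of_bool (y i = ?p b i)))"
    proof (rule sum.mono_neutral_right[OF finB])
      show "{?b} \<subseteq> ?B" using b by auto
      show "\<forall>c\<in>?B - {?b}. F (?p c) * (\<Prod>i\<in>{1..N}. of_bool (y i = ?p c i)) = 0"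
      proof
        fix c assume c: "c \<in> ?B - {?b}"
        have "\<exists>i\<in>{1..N}. c i \<noteq> b i"
        proof (rule ccontr)
          assume "\<not> ?thesis"
          then have "c = ?b" using c by (intro extensionalityI[of _ "{1..N}"]) (auto simp: PiE_def)
          then show False using c by auto
        qed
        then show "F (?p c) * (\<Prod>i\<in>{1..N}. of_bool (y i = ?p c i)) = 0" using b by auto
      qed
    qed
    also have "\<dots> = F (?p ?b)" using b by simp
    also have "\<dots> = F y" using b by (intro depends_onD[OF F]) auto
    finally show "F y = (\<Sum>b\<in>?B. F (?p b) * (\<Prod>i\<in>{1..N}. of_bool (y i = ?p b i)))" ..
  next
    fix i assume "i \<in> {1..N}"
    then show "2 * int (a i) - int r \<in> lattice r" using a[of i] by (auto simp: lattice_def)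
  qed
  also have "\<dots> = (\<Sum>b\<in>?B. F (?p b) * (\<Prod>i\<in>{1..N}. (avg1 ^^ n) (\<lambda>y. of_bool (y = ?p b i)) (2 * int (a i) - int r)))"
    unfolding avg_funpow_sum
    by (intro sum.cong refl arg_cong2[where f="(*)"] avg_funpow_prod[where f = "\<lambda>i y. of_bool (y = ?p _ i)"])
  also have "\<dots> = (\<Sum>b\<in>?B. F (?p b) * (\<Prod>i\<in>{1..N}. \<Sum>k\<le>r. kraw r (a i) k * (kdual m k (b i) / 2 ^ m)))"
  proof (intro sum.cong prod.cong refl arg_cong2[where f="(*)"])
    fix b i assume "i \<in> {1..N}"
    then show "(avg1 ^^ n) (\<lambda>y. of_bool (y = ?p b i)) (2 * int (a i) - int r) = (\<Sum>k\<le>r. kraw r (a i) k * (kdual m k (b i) / 2 ^ m))"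
      unfolding m_def by (subst avg1_funpow_delta[OF a]) (simp_all add: sum_divide_distrib)
  qed
  also have "\<dots> = (\<Sum>b\<in>?B. \<Sum>k\<in>({1..N} \<rightarrow>\<^sub>E {..r}). (\<Prod>i\<in>{1..N}. kraw r (a i) (k i)) * (F (?p b) * (\<Prod>i\<in>{1..N}. kdual m (k i) (b i) / 2 ^ m)))"
  proof (intro sum.cong refl)
    fix b
    have "(\<Prod>i\<in>{1..N}. \<Sum>k\<le>r. kraw r (a i) k * (kdual m k (b i) / 2 ^ m))
      = (\<Sum>k\<in>({1..N} \<rightarrow>\<^sub>E {..r}). \<Prod>i\<in>{1..N}. kraw r (a i) (k i) * (kdual m (k i) (b i) / 2 ^ m))"
      by (rule prod_sum_PiE) auto
    then show "F (?p b) * (\<Prod>i\<in>{1..N}. \<Sum>k\<le>r. kraw r (a i) k * (kdual m k (b i) / 2 ^ m))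
      = (\<Sum>k\<in>({1..N} \<rightarrow>\<^sub>E {..r}). (\<Prod>i\<in>{1..N}. kraw r (a i) (k i)) * (F (?p b) * (\<Prod>i\<in>{1..N}. kdual m (k i) (b i) / 2 ^ m)))"
      by (simp only: sum_distrib_left prod.distrib mult_ac)
  qed
  also have "\<dots> = (\<Sum>k\<in>({1..N} \<rightarrow>\<^sub>E {..r}). (\<Prod>i\<in>{1..N}. kraw r (a i) (k i)) * (\<Sum>b\<in>?B. F (?p b) * (\<Prod>i\<in>{1..N}. kdual m (k i) (b i) / 2 ^ m)))"
    unfolding sum_distrib_left by (rule sum.swap)
  finally show ?thesis unfolding m_def .
qed

section \<open>Asymptotics of the survival probability\<close>

text \<open>The alternating function that equals 1 on the Weyl chamber; it stands in for the
  indicator of the chamber at the final time.\<close>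

definition vsgn :: "nat \<Rightarrow> (nat \<Rightarrow> int) \<Rightarrow> real" where
  "vsgn N x = of_int (sgn (vandermonde N x))"

text \<open>Coefficients of \<open>avg ^^ n\<close> applied to \<open>vsgn\<close> with respect to products of Krawtchouk polynomials
  in the starting points, where \<open>m\<close> is \<open>n\<close> plus the size of the lattice of starting points.\<close>

definition vsgn_coeff :: "nat \<Rightarrow> nat \<Rightarrow> (nat \<Rightarrow> nat) \<Rightarrow> real" where
  "vsgn_coeff N m k = (\<Sum>b\<in>({1..N} \<rightarrow>\<^sub>E {..m}). vsgn N (\<lambda>i. 2 * int (b i) - int m) * (\<Prod>i\<in>{1..N}. kdual m (k i) (b i) / 2 ^ m))"

lemma abs_vsgn_le: "\<bar>vsgn N x\<bar> \<le> 1"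
  by (auto simp: vsgn_def sgn_if)

lemma vandermonde_cong: "(\<And>i. i \<in> {1..N} \<Longrightarrow> x i = y i) \<Longrightarrow> vandermonde N x = vandermonde N y"
  unfolding vandermonde_def by (rule sdet_cong) auto

lemma depends_on_vsgn: "depends_on N (vsgn N)"
  unfolding depends_on_def vsgn_def using vandermonde_cong[of N] by metis

lemma vsgn_permute:
  assumes "q permutes {1..N}" shows "vsgn N (\<lambda>i. x (q i)) = of_int (sign q) * vsgn N x"
  using vandermonde_permute[OF assms, of x] by (simp add: vsgn_def o_def sgn_mult sgn_if sign_def)

lemma vsgn_lattice: "vsgn N (\<lambda>i. 2 * int (b i) - int m) = sgn (vandermonde N (\<lambda>i. real (b i)))"
proof -
  have "vandermonde N (\<lambda>i. 2 * int (b i) + (- int m)) = (\<Prod>j\<in>{1..N}. 2 ^ (j - 1)) * vandermonde N (\<lambda>i. int (b i))"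
    by (rule vandermonde_affine)
  moreover have "sgn (\<Prod>j\<in>{1..N}. 2 ^ (j - 1) :: int) = 1" by (intro sgn_pos prod_pos) auto
  ultimately have "vsgn N (\<lambda>i. 2 * int (b i) - int m) = of_int (sgn (vandermonde N (\<lambda>i. int (b i))))"
    by (simp add: vsgn_def sgn_mult)
  moreover have "vandermonde N (\<lambda>i. real (b i)) = of_int (vandermonde N (\<lambda>i. int (b i)))"
    by (simp add: of_int_vandermonde)
  ultimately show ?thesis by (simp only:) (simp add: sgn_if)
qed

lemma vsgn_coeff_permute:
  assumes q: "q permutes {1..N}"
  shows "vsgn_coeff N m (\<lambda>i. k (q i)) = of_int (sign q) * vsgn_coeff N m k"
proof -
  let ?B = "{1..N} \<rightarrow>\<^sub>E {..m}"
  have bij: "bij_betw (\<lambda>b i. b (q i)) ?B ?B"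
  proof (rule bij_betwI[where g = "\<lambda>b i. b (Hilbert_Choice.inv q i)"])
    have *: "(\<lambda>b i. b (p i)) \<in> ?B \<rightarrow> ?B" if p: "p permutes {1..N}" for p
      using permutes_in_image[OF p] permutes_not_in[OF p] by (fastforce simp: PiE_def Pi_def extensional_def)
    show "(\<lambda>b i. b (q i)) \<in> ?B \<rightarrow> ?B" "(\<lambda>b i. b (Hilbert_Choice.inv q i)) \<in> ?B \<rightarrow> ?B"
      using * q permutes_inv by blast+
  qed (auto simp: permutes_inverses[OF q])
  have "vsgn_coeff N m (\<lambda>i. k (q i)) = (\<Sum>b\<in>?B. vsgn N (\<lambda>i. 2 * int (b (q i)) - int m) * (\<Prod>i\<in>{1..N}. kdual m (k (q i)) (b (q i)) / 2 ^ m))"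
    unfolding vsgn_coeff_def by (rule sum.reindex_bij_betw[OF bij, symmetric])
  also have "\<dots> = (\<Sum>b\<in>?B. of_int (sign q) * (vsgn N (\<lambda>i. 2 * int (b i) - int m) * (\<Prod>i\<in>{1..N}. kdual m (k i) (b i) / 2 ^ m)))"
  proof (intro sum.cong refl)
    fix b
    have "(\<Prod>i\<in>{1..N}. kdual m (k i) (b i) / 2 ^ m) = (\<Prod>i\<in>{1..N}. kdual m (k (q i)) (b (q i)) / 2 ^ m)"
      by (rule prod.permute[OF q, unfolded o_def])
    then show "vsgn N (\<lambda>i. 2 * int (b (q i)) - int m) * (\<Prod>i\<in>{1..N}. kdual m (k (q i)) (b (q i)) / 2 ^ m)
      = of_int (sign q) * (vsgn N (\<lambda>i. 2 * int (b i) - int m) * (\<Prod>i\<in>{1..N}. kdual m (k i) (b i) / 2 ^ m))"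
      using vsgn_permute[OF q, of "\<lambda>i. 2 * int (b i) - int m"] by simp
  qed
  finally show ?thesis by (simp add: sum_distrib_left vsgn_coeff_def)
qed

text \<open>Swapping two equal degrees leaves \<open>k\<close> unchanged but reverses the
  sign.\<close>

lemma vsgn_coeff_eq_0:
  assumes "\<not> inj_on k {1..N}" shows "vsgn_coeff N m k = 0"
proof -
  obtain i j where ij: "i \<in> {1..N}" "j \<in> {1..N}" "i \<noteq> j" "k i = k j"
    using assms by (auto simp: inj_on_def)
  let ?q = "Transposition.transpose i j"
  have "vsgn_coeff N m (\<lambda>l. k (?q l)) = of_int (sign ?q) * vsgn_coeff N m k"
    by (rule vsgn_coeff_permute) (use ij in \<open>auto intro: permutes_swap_id\<close>)
  moreover have "(\<lambda>l. k (?q l)) = k" using ij by (auto simp: Transposition.transpose_def)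
  ultimately show ?thesis using ij by (simp add: sign_swap_id)
qed

lemma abs_vsgn_coeff_le:
  assumes k: "\<And>i. i \<in> {1..N} \<Longrightarrow> k i \<le> m"
  shows "\<bar>vsgn_coeff N m k\<bar> \<le> (\<Prod>i\<in>{1..N}. 1 / sqrt (real (m choose (k i))))"
proof -
  let ?B = "{1..N} \<rightarrow>\<^sub>E {..m}"
  have "\<bar>vsgn_coeff N m k\<bar> \<le> (\<Sum>b\<in>?B. \<bar>vsgn N (\<lambda>i. 2 * int (b i) - int m)\<bar> * (\<Prod>i\<in>{1..N}. \<bar>kdual m (k i) (b i)\<bar> / 2 ^ m))"
    unfolding vsgn_coeff_def by (rule order.trans[OF sum_abs]) (simp add: abs_mult abs_prod)
  also have "\<dots> \<le> (\<Sum>b\<in>?B. 1 * (\<Prod>i\<in>{1..N}. \<bar>kdual m (k i) (b i)\<bar> / 2 ^ m))"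
    by (intro sum_mono mult_right_mono abs_vsgn_le prod_nonneg) auto
  also have "\<dots> = (\<Prod>i\<in>{1..N}. \<Sum>b\<le>m. \<bar>kdual m (k i) b\<bar> / 2 ^ m)"
    by (subst prod_sum_PiE) auto
  also have "\<dots> \<le> (\<Prod>i\<in>{1..N}. 1 / sqrt (real (m choose (k i))))"
  proof (intro prod_mono conjI sum_nonneg)
    fix i assume "i \<in> {1..N}"
    then have "(\<Sum>b\<le>m. \<bar>kdual m (k i) b\<bar>) / 2 ^ m \<le> (2 ^ m / sqrt (real (m choose (k i)))) / 2 ^ m"
      by (intro divide_right_mono sum_abs_kdual_le k) auto
    then show "(\<Sum>b\<le>m. \<bar>kdual m (k i) b\<bar> / 2 ^ m) \<le> 1 / sqrt (real (m choose (k i)))"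
      by (simp add: sum_divide_distrib)
  qed auto
  finally show ?thesis .
qed

text \<open>As many values lie at or above \<open>N\<close> as are missing below \<open>N\<close>,
  and each of the former exceeds each of the latter. The gain of 1 makes the bound for all other
  coefficients smaller by a factor of order m^(-1/2).\<close>

lemma inj_on_sum_ge:
  fixes k :: "nat \<Rightarrow> nat"
  assumes inj: "inj_on k {1..N}" and ne: "k ` {1..N} \<noteq> {..<N}"
  shows "(\<Sum>i\<in>{1..N}. k i) \<ge> Suc (\<Sum>i<N. i)"
proof -
  let ?K = "k ` {1..N}"
  have card: "card (?K - {..<N}) = card ({..<N} - ?K)"
  proof -
    have "card ?K = card {..<N}" using card_image[OF inj] by simp
    then show ?thesis by (metis card_Diff_subset_Int card_le_sym_Diff finite_Int finite_imageI finite_atLeastAtMost finite_lessThan inf_commute)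
  qed
  have ne': "{..<N} - ?K \<noteq> {}"
  proof
    assume "{..<N} - ?K = {}"
    then have "{..<N} \<subseteq> ?K" by auto
    moreover have "card ?K = card {..<N}" using card_image[OF inj] by simp
    ultimately show False using ne by (metis card_subset_eq finite_imageI finite_atLeastAtMost)
  qed
  have "(\<Sum>i\<in>{..<N} - ?K. i) < (\<Sum>i\<in>{..<N} - ?K. N)" using ne' by (intro sum_strict_mono) auto
  also have "\<dots> = (\<Sum>i\<in>?K - {..<N}. N)" by (simp add: card)
  also have "\<dots> \<le> (\<Sum>i\<in>?K - {..<N}. i)" by (intro sum_mono) auto
  finally have "(\<Sum>i\<in>{..<N} - ?K. i) < (\<Sum>i\<in>?K - {..<N}. i)" .
  moreover have "(\<Sum>i<N. i) = (\<Sum>i\<in>{..<N} - ?K. i) + (\<Sum>i\<in>{..<N} \<inter> ?K. i)"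
    by (metis finite_lessThan sum.Int_Diff add.commute)
  moreover have "(\<Sum>i\<in>?K. i) = (\<Sum>i\<in>?K - {..<N}. i) + (\<Sum>i\<in>?K \<inter> {..<N}. i)"
    by (metis finite_imageI finite_atLeastAtMost sum.Int_Diff add.commute)
  ultimately have "(\<Sum>i<N. i) < (\<Sum>i\<in>?K. i)" by (simp add: Int_commute)
  also have "\<dots> = (\<Sum>i\<in>{1..N}. k i)" by (simp add: sum.reindex[OF inj])
  finally show ?thesis by simp
qed

text \<open>Uses (m choose k) >= (m/k)^k >= (m/r)^k for 0 < k <= r. For fixed \<open>r\<close> the
  bound is of order m^(-s/2).\<close>

lemma abs_vsgn_coeff_le_power:
  assumes k: "\<And>i. i \<in> {1..N} \<Longrightarrow> k i \<le> r" and s: "s \<le> (\<Sum>i\<in>{1..N}. k i)" and r: "1 \<le> r" "r \<le> m"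
  shows "\<bar>vsgn_coeff N m k\<bar> \<le> (sqrt r / sqrt m) ^ s"
proof -
  have "\<bar>vsgn_coeff N m k\<bar> \<le> (\<Prod>i\<in>{1..N}. 1 / sqrt (real (m choose (k i))))"
    by (rule abs_vsgn_coeff_le) (use k r in force)
  also have "\<dots> \<le> (\<Prod>i\<in>{1..N}. (sqrt r / sqrt m) ^ k i)"
  proof (intro prod_mono conjI)
    fix i assume i: "i \<in> {1..N}"
    have km: "k i \<le> m" using k[OF i] r by simp
    have "(real m / real r) ^ k i \<le> (real m / real (k i)) ^ k i"
      using k[OF i] by (cases "k i = 0") (auto intro!: power_mono divide_left_mono)
    also have "\<dots> \<le> real (m choose (k i))" by (rule binomial_ge_n_over_k_pow_k[OF km])
    finally have "sqrt ((real m / real r) ^ k i) \<le> sqrt (real (m choose (k i)))" by simp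
    then have "1 / sqrt (real (m choose (k i))) \<le> 1 / sqrt ((real m / real r) ^ k i)"
      using r by (intro divide_left_mono mult_pos_pos) (auto simp: km)
    also have "\<dots> = (sqrt r / sqrt m) ^ k i"
      using r by (simp add: real_sqrt_power real_sqrt_divide power_divide)
    finally show "1 / sqrt (real (m choose (k i))) \<le> (sqrt r / sqrt m) ^ k i" .
  qed auto
  also have "\<dots> = (sqrt r / sqrt m) ^ (\<Sum>i\<in>{1..N}. k i)" by (simp add: power_sum)
  also have "\<dots> \<le> (sqrt r / sqrt m) ^ s"
    using r s by (intro power_decreasing) auto
  finally show ?thesis .
qed

section \<open>Moments of the Krawtchouk determinant under free walkers\<close>

definition kraw_det :: "nat \<Rightarrow> nat \<Rightarrow> (nat \<Rightarrow> nat) \<Rightarrow> real" where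
  "kraw_det N m b = sdet {1..N} (\<lambda>i j. kraw m (b i) (j - 1))"

lemma kraw_det_eq:
  assumes "\<And>i. i \<in> {1..N} \<Longrightarrow> b i \<le> m"
  shows "kraw_det N m b = vandermonde N (\<lambda>i. real (b i)) * (\<Prod>j\<in>{1..N}. 2 ^ (j - 1) / fact (j - 1))"
proof -
  have "kraw_det N m b = sdet {1..N} (\<lambda>i j. poly (kraw_poly m (j - 1)) (real (b i)))"
    unfolding kraw_det_def by (intro sdet_cong) (simp add: kraw_eq_poly assms)
  also have "\<dots> = vandermonde N (\<lambda>i. real (b i)) * (\<Prod>j\<in>{1..N}. coeff (kraw_poly m (j - 1)) (j - 1))"
    by (rule sdet_poly_columns) (rule degree_kraw_poly)
  finally show ?thesis by (simp add: coeff_kraw_poly)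
qed

text \<open>The law of the numbers of upward steps of \<open>N\<close> independent walkers after
  \<open>m\<close> steps, which is the orthogonality weight of the Krawtchouk polynomials.\<close>

definition bweight :: "nat \<Rightarrow> nat \<Rightarrow> (nat \<Rightarrow> nat) \<Rightarrow> real" where
  "bweight N m b = (\<Prod>i\<in>{1..N}. real (m choose (b i)) / 2 ^ m)"

lemma bweight_nonneg: "bweight N m b \<ge> 0" unfolding bweight_def by (intro prod_nonneg) auto

lemma sum_bweight_prod:
  "(\<Sum>b\<in>({1..N} \<rightarrow>\<^sub>E {..m}). bweight N m b * (\<Prod>i\<in>{1..N}. f i (b i))) = (\<Prod>i\<in>{1..N}. \<Sum>b\<le>m. real (m choose b) / 2 ^ m * f i b)"
  unfolding bweight_def prod.distrib[symmetric] by (rule prod_sum_PiE[symmetric]) auto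

lemma kraw_orthogonal:
  assumes "k \<le> m"
  shows "(\<Sum>b\<le>m. real (m choose b) / 2 ^ m * (kraw m b k * kraw m b l)) = (if k = l then real (m choose k) else 0)"
proof -
  have "(\<Sum>b\<le>m. real (m choose b) / 2 ^ m * (kraw m b k * kraw m b l)) = real (m choose k) / 2 ^ m * (\<Sum>b\<le>m. kdual m k b * kraw m b l)"
    unfolding sum_distrib_left
  proof (intro sum.cong refl)
    fix b assume "b \<in> {..m}"
    then show "real (m choose b) / 2 ^ m * (kraw m b k * kraw m b l) = real (m choose k) / 2 ^ m * (kdual m k b * kraw m b l)"
      using kraw_kdual_symmetry[OF assms, of b] by (simp add: field_simps)
  qed
  then show ?thesis by (simp add: kdual_kraw_orthogonal[OF assms])
qed

text \<open>In the double sum over permutations \<open>p\<close> and \<open>q\<close>, orthogonality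
  kills every pair that differs at some walker, and each diagonal pair contributes the same
  product.\<close>

lemma sum_kraw_det_squared:
  assumes "N \<le> Suc m"
  shows "(\<Sum>b\<in>({1..N} \<rightarrow>\<^sub>E {..m}). bweight N m b * (kraw_det N m b)\<^sup>2) = fact N * (\<Prod>j\<in>{1..N}. real (m choose (j - 1)))"
proof -
  let ?S = "{p. p permutes {1..N}}" and ?B = "{1..N} \<rightarrow>\<^sub>E {..m}"
  have "(\<Sum>b\<in>?B. bweight N m b * (kraw_det N m b)\<^sup>2)
    = (\<Sum>b\<in>?B. \<Sum>p\<in>?S. \<Sum>q\<in>?S. of_int (sign p) * of_int (sign q) * (bweight N m b * (\<Prod>i\<in>{1..N}. kraw m (b i) (p i - 1) * kraw m (b i) (q i - 1))))"
  proof (intro sum.cong refl)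
    fix b
    have "(kraw_det N m b)\<^sup>2 = (\<Sum>p\<in>?S. \<Sum>q\<in>?S. (of_int (sign p) * (\<Prod>i\<in>{1..N}. kraw m (b i) (p i - 1))) * (of_int (sign q) * (\<Prod>i\<in>{1..N}. kraw m (b i) (q i - 1))))"
      unfolding kraw_det_def sdet_def power2_eq_square by (rule sum_product)
    then show "bweight N m b * (kraw_det N m b)\<^sup>2 = (\<Sum>p\<in>?S. \<Sum>q\<in>?S. of_int (sign p) * of_int (sign q) * (bweight N m b * (\<Prod>i\<in>{1..N}. kraw m (b i) (p i - 1) * kraw m (b i) (q i - 1))))"
      by (simp add: sum_distrib_left prod.distrib mult_ac)
  qed
  also have "\<dots> = (\<Sum>p\<in>?S. \<Sum>b\<in>?B. \<Sum>q\<in>?S. of_int (sign p) * of_int (sign q) * (bweight N m b * (\<Prod>i\<in>{1..N}. kraw m (b i) (p i - 1) * kraw m (b i) (q i - 1))))"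
    by (rule sum.swap)
  also have "\<dots> = (\<Sum>p\<in>?S. \<Sum>q\<in>?S. of_int (sign p) * of_int (sign q) * (\<Sum>b\<in>?B. bweight N m b * (\<Prod>i\<in>{1..N}. kraw m (b i) (p i - 1) * kraw m (b i) (q i - 1))))"
    unfolding sum_distrib_left by (rule sum.cong[OF refl], rule sum.swap)
  also have "\<dots> = (\<Sum>p\<in>?S. \<Sum>q\<in>{p}. (\<Prod>j\<in>{1..N}. real (m choose (j - 1))))"
  proof (rule sum.cong[OF refl])
    fix p assume p: "p \<in> ?S"
    then have p1: "p i \<in> {1..N}" if "i \<in> {1..N}" for i using p that by (simp only: mem_Collect_eq permutes_in_image)
    have *: "(\<Sum>b\<in>?B. bweight N m b * (\<Prod>i\<in>{1..N}. kraw m (b i) (p i - 1) * kraw m (b i) (q i - 1)))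
       = (\<Prod>i\<in>{1..N}. if p i - 1 = q i - 1 then real (m choose (p i - 1)) else 0)" for q
      unfolding sum_bweight_prod[where f = "\<lambda>i b. kraw m b (p i - 1) * kraw m b (q i - 1)"]
    proof (intro prod.cong refl kraw_orthogonal)
      fix i assume "i \<in> {1..N}"
      then show "p i - 1 \<le> m" using p1[of i] assms by auto
    qed
    have ne: "(\<Prod>i\<in>{1..N}. if p i - 1 = q i - 1 then real (m choose (p i - 1)) else 0) = 0" if q: "q \<in> ?S" "q \<noteq> p" for q
    proof -
      have "\<exists>i\<in>{1..N}. p i \<noteq> q i"
      proof (rule ccontr)
        assume "\<not> ?thesis"
        then have "q i = p i" for i using p q by (cases "i \<in> {1..N}") (auto simp: permutes_not_in)
        then show False using q by auto
      qed
      then obtain i where i: "i \<in> {1..N}" "p i \<noteq> q i" by blast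
      moreover have "q i \<in> {1..N}" using q i by (simp only: mem_Collect_eq permutes_in_image)
      ultimately have "p i - 1 \<noteq> q i - 1" using p1[OF i(1)] by auto
      then show ?thesis using i by (intro prod_zero) auto
    qed
    have "(\<Sum>q\<in>?S. of_int (sign p) * of_int (sign q) * (\<Prod>i\<in>{1..N}. if p i - 1 = q i - 1 then real (m choose (p i - 1)) else 0))
      = (\<Sum>q\<in>{p}. of_int (sign p) * of_int (sign q) * (\<Prod>i\<in>{1..N}. if p i - 1 = q i - 1 then real (m choose (p i - 1)) else 0))"
      using p by (intro sum.mono_neutral_right) (auto simp: ne finite_permutations)
    also have "\<dots> = (\<Prod>i\<in>{1..N}. real (m choose (p i - 1)))" by (simp flip: of_int_mult)
    also have "\<dots> = (\<Prod>j\<in>{1..N}. real (m choose (j - 1)))"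
      using p prod.permute[of p "{1..N}" "\<lambda>j. real (m choose (j - 1))"] by (simp add: o_def)
    finally show "(\<Sum>q\<in>?S. of_int (sign p) * of_int (sign q) * (\<Sum>b\<in>?B. bweight N m b * (\<Prod>i\<in>{1..N}. kraw m (b i) (p i - 1) * kraw m (b i) (q i - 1))))
      = (\<Sum>q\<in>{p}. (\<Prod>j\<in>{1..N}. real (m choose (j - 1))))" unfolding * by simp
  qed
  also have "\<dots> = fact N * (\<Prod>j\<in>{1..N}. real (m choose (j - 1)))"
    by (simp add: card_permutations[of "{1..N}" N])
  finally show ?thesis .
qed

lemma power_le_fact_mult_exp:
  fixes x :: real assumes "x \<ge> 0" shows "x ^ n \<le> fact n * exp x"
proof -
  have "(\<Sum>k\<in>{n}. x ^ k /\<^sub>R fact k) \<le> exp x"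
    unfolding exp_def using assms by (intro sum_le_suminf summable_exp_generic) auto
  then show ?thesis by (simp add: field_simps)
qed

text \<open>The linear terms of the bounds 1 + x + x^2 for exp x and 1 - x + x^2 for exp(-x)
  cancel.\<close>

lemma exp_plus_exp_minus_le:
  fixes x :: real assumes "0 \<le> x" "x \<le> 1"
  shows "(exp x + exp (- x)) / 2 \<le> 1 + x\<^sup>2"
proof -
  have "exp (- x) \<le> 1 / (1 + x)"
    using assms exp_ge_add_one_self[of x] by (simp add: exp_minus field_simps)
  also have "\<dots> \<le> 1 - x + x\<^sup>2"
    using assms by (simp add: field_simps power2_eq_square)
  finally show ?thesis using exp_bound[OF assms] by simp
qed

lemma sum_binomial_exp:
  "(\<Sum>b\<le>m. real (m choose b) / 2 ^ m * exp (x * (2 * real b - real m))) = ((exp x + exp (- x)) / 2) ^ m"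
proof -
  have "(exp x + exp (- x)) ^ m = (\<Sum>b\<le>m. real (m choose b) * exp x ^ b * exp (- x) ^ (m - b))"
    by (rule binomial_ring)
  also have "\<dots> = (\<Sum>b\<le>m. real (m choose b) * exp (x * (2 * real b - real m)))"
  proof (intro sum.cong refl)
    fix b assume "b \<in> {..m}"
    then have "exp x ^ b * exp (- x) ^ (m - b) = exp (x * (2 * real b - real m))"
      by (simp add: exp_of_nat_mult[symmetric] exp_add[symmetric] of_nat_diff algebra_simps)
    then show "real (m choose b) * exp x ^ b * exp (- x) ^ (m - b) = real (m choose b) * exp (x * (2 * real b - real m))"
      by (simp add: mult.assoc)
  qed
  finally show ?thesis by (simp add: power_divide sum_divide_distrib)
qed

text \<open>\<open>2 * real b - real m\<close> is the position after \<open>m\<close> steps, of size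
  sqrt m. Its exponential moments at t = 1 / sqrt m and at -t are at most (1 + t^2)^m <= exp 1, and
  a power is at most a factorial times an exponential. The constant only has to be independent of
  \<open>m\<close>.\<close>

lemma binomial_moment_le:
  assumes m: "m \<ge> 1"
  shows "(\<Sum>b\<le>m. real (m choose b) / 2 ^ m * (2 * real b - real m) ^ (2 * d)) \<le> 4 * exp 1 * fact (2 * d) * real m ^ d"
proof -
  define t where "t = 1 / sqrt (real m)"
  have t: "0 \<le> t" "t \<le> 1" "t\<^sup>2 = 1 / real m" using m by (auto simp: t_def power_divide)
  have mgf: "(\<Sum>b\<le>m. real (m choose b) / 2 ^ m * exp (t * (2 * real b - real m))) \<le> exp 1"
    "(\<Sum>b\<le>m. real (m choose b) / 2 ^ m * exp (- t * (2 * real b - real m))) \<le> exp 1"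
  proof -
    have "((exp t + exp (- t)) / 2) ^ m \<le> (1 + t\<^sup>2) ^ m"
      by (intro power_mono exp_plus_exp_minus_le t) (auto intro: add_nonneg_nonneg)
    also have "\<dots> \<le> exp (t\<^sup>2) ^ m" by (intro power_mono exp_ge_add_one_self) auto
    also have "\<dots> = exp 1" using m by (simp add: t exp_of_nat_mult[symmetric])
    finally have *: "((exp t + exp (- t)) / 2) ^ m \<le> exp 1" .
    show "(\<Sum>b\<le>m. real (m choose b) / 2 ^ m * exp (t * (2 * real b - real m))) \<le> exp 1"
      unfolding sum_binomial_exp by (rule *)
    show "(\<Sum>b\<le>m. real (m choose b) / 2 ^ m * exp (- t * (2 * real b - real m))) \<le> exp 1"
      unfolding sum_binomial_exp using * by (simp add: add.commute)
  qed
  have "(\<Sum>b\<le>m. real (m choose b) / 2 ^ m * (2 * real b - real m) ^ (2 * d))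
    \<le> (\<Sum>b\<le>m. real (m choose b) / 2 ^ m * ((fact (2 * d) * real m ^ d) * (exp (t * (2 * real b - real m)) + exp (- t * (2 * real b - real m)))))"
  proof (intro sum_mono mult_left_mono)
    fix b
    let ?s = "2 * real b - real m"
    have "(t * \<bar>?s\<bar>) ^ (2 * d) \<le> fact (2 * d) * exp (t * \<bar>?s\<bar>)"
      by (intro power_le_fact_mult_exp mult_nonneg_nonneg t) auto
    also have "exp (t * \<bar>?s\<bar>) \<le> exp (t * ?s) + exp (- t * ?s)"
    proof (cases "?s \<ge> 0")
      case False
      then have "t * \<bar>?s\<bar> = - t * ?s" by (simp add: algebra_simps)
      then show ?thesis by (simp only:) simp
    qed simp
    finally have "(t * \<bar>?s\<bar>) ^ (2 * d) \<le> fact (2 * d) * (exp (t * ?s) + exp (- t * ?s))" by simp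
    moreover have "(t * \<bar>?s\<bar>) ^ (2 * d) = ?s ^ (2 * d) / real m ^ d"
      using m by (simp add: power_mult power_mult_distrib t power_divide)
    ultimately have "?s ^ (2 * d) \<le> fact (2 * d) * (exp (t * ?s) + exp (- t * ?s)) * real m ^ d"
      using m by (simp add: divide_le_eq)
    then show "?s ^ (2 * d) \<le> fact (2 * d) * real m ^ d * (exp (t * ?s) + exp (- t * ?s))"
      by (simp add: mult_ac)
  qed auto
  also have "\<dots> = fact (2 * d) * real m ^ d * ((\<Sum>b\<le>m. real (m choose b) / 2 ^ m * exp (t * (2 * real b - real m)))
     + (\<Sum>b\<le>m. real (m choose b) / 2 ^ m * exp (- t * (2 * real b - real m))))"
    unfolding sum.distrib[symmetric] sum_distrib_left by (intro sum.cong refl) (simp add: algebra_simps)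
  also have "\<dots> \<le> fact (2 * d) * real m ^ d * (exp 1 + exp 1)"
    by (intro mult_left_mono add_mono mgf) auto
  also have "\<dots> \<le> 4 * exp 1 * fact (2 * d) * real m ^ d" by (simp add: mult_ac)
  finally show ?thesis .
qed

text \<open>Cauchy-Schwarz applied twice, first to \<open>f\<close> and then to its squares.\<close>

lemma sum_power4_le:
  fixes f :: "'a \<Rightarrow> real"
  assumes "finite S"
  shows "(\<Sum>p\<in>S. f p) ^ 4 \<le> real (card S) ^ 3 * (\<Sum>p\<in>S. f p ^ 4)"
proof -
  have cs: "(\<Sum>p\<in>S. g p)\<^sup>2 \<le> real (card S) * (\<Sum>p\<in>S. (g p)\<^sup>2)" for g :: "'a \<Rightarrow> real"
    using Cauchy_Schwarz_ineq_sum[of g "\<lambda>_. 1" S] by (simp add: mult.commute)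
  have "(\<Sum>p\<in>S. f p) ^ 4 = ((\<Sum>p\<in>S. f p)\<^sup>2)\<^sup>2" by (simp only: power4_eq_xxxx power2_eq_square mult.assoc)
  also have "\<dots> \<le> (real (card S) * (\<Sum>p\<in>S. (f p)\<^sup>2))\<^sup>2" by (intro power_mono cs) auto
  also have "\<dots> = (real (card S))\<^sup>2 * (\<Sum>p\<in>S. (f p)\<^sup>2)\<^sup>2" by (simp add: power_mult_distrib)
  also have "\<dots> \<le> (real (card S))\<^sup>2 * (real (card S) * (\<Sum>p\<in>S. ((f p)\<^sup>2)\<^sup>2))" by (intro mult_left_mono cs) auto
  also have "\<dots> = real (card S) ^ 3 * (\<Sum>p\<in>S. f p ^ 4)"
    by (simp only: power4_eq_xxxx power2_eq_square power3_eq_cube mult.assoc)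
  finally show ?thesis .
qed

text \<open>The determinant is a multiple of the Vandermonde determinant of the centred positions
  \<open>2 * b - m\<close>, a signed sum of \<open>fact N\<close> monomials. The fourth power of a
  sum is at most the cube of the number of terms times the sum of the fourth powers, and
  independence reduces these to one-walker moments of size m^(2 (p i - 1)).\<close>

lemma sum_kraw_det_fourth:
  "\<exists>C>0. \<forall>m\<ge>1. (\<Sum>b\<in>({1..N} \<rightarrow>\<^sub>E {..m}). bweight N m b * kraw_det N m b ^ 4) \<le> C * real m ^ (2 * (\<Sum>j\<in>{1..N}. j - 1))"
proof -
  let ?S = "{p. p permutes {1..N}}" and ?B = "\<lambda>m. {1..N} \<rightarrow>\<^sub>E {..m}"
  let ?a = "\<Sum>j\<in>{1..N}. j - 1"
  define c :: "nat \<Rightarrow> real" where "c d = 4 * exp 1 * fact (2 * d)" for d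
  have c: "c d > 0" for d unfolding c_def by (intro mult_pos_pos) (simp_all only: fact_gt_zero exp_gt_zero zero_less_numeral)
  define C1 where "C1 = (\<Prod>j\<in>{1..N}. c (2 * (j - 1)))"
  \<comment> \<open>The factors 2^(j - 1) of \<open>kraw_det_eq\<close> are absorbed by passing from
    \<open>b\<close> to \<open>2 * b - m\<close>.\<close>
  define \<kappa> where "\<kappa> = (\<Prod>j\<in>{1..N}. 1 / fact (j - 1) :: real)"
  define C where "C = \<kappa> ^ 4 * (fact N ^ 3 * (fact N * C1))"
  have "C1 > 0" unfolding C1_def by (intro prod_pos ballI c)
  have "\<kappa> > 0" unfolding \<kappa>_def by (intro prod_pos) auto
  have "C > 0" unfolding C_def using \<open>C1 > 0\<close> \<open>\<kappa> > 0\<close> by simp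
  moreover have "(\<Sum>b\<in>?B m. bweight N m b * kraw_det N m b ^ 4) \<le> C * real m ^ (2 * ?a)" if m: "m \<ge> 1" for m
  proof -
    have bound: "kraw_det N m b ^ 4 \<le> \<kappa> ^ 4 * (fact N ^ 3 * (\<Sum>p\<in>?S. \<Prod>i\<in>{1..N}. (2 * real (b i) - real m) ^ (2 * (2 * (p i - 1)))))"
      if b: "b \<in> ?B m" for b
    proof -
      let ?s = "\<lambda>i. 2 * real (b i) - real m"
      have "vandermonde N (\<lambda>i. 2 * real (b i) + (- real m)) = (\<Prod>j\<in>{1..N}. 2 ^ (j - 1)) * vandermonde N (\<lambda>i. real (b i))"
        by (rule vandermonde_affine)
      moreover have "kraw_det N m b = vandermonde N (\<lambda>i. real (b i)) * (\<Prod>j\<in>{1..N}. 2 ^ (j - 1) / fact (j - 1))"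
        using b by (intro kraw_det_eq) auto
      ultimately have "kraw_det N m b = \<kappa> * vandermonde N ?s"
        by (simp add: \<kappa>_def prod_dividef)
      then have 1: "kraw_det N m b ^ 4 = \<kappa> ^ 4 * vandermonde N ?s ^ 4" by (simp add: power_mult_distrib)
      have 2: "vandermonde N ?s ^ 4 \<le> real (card ?S) ^ 3 * (\<Sum>p\<in>?S. (of_int (sign p) * (\<Prod>i\<in>{1..N}. ?s i ^ (p i - 1))) ^ 4)"
        unfolding vandermonde_def sdet_def by (intro sum_power4_le finite_permutations) auto
      have 3: "(\<Sum>p\<in>?S. (of_int (sign p) * (\<Prod>i\<in>{1..N}. ?s i ^ (p i - 1))) ^ 4) = (\<Sum>p\<in>?S. \<Prod>i\<in>{1..N}. ?s i ^ (2 * (2 * (p i - 1))))"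
      proof (intro sum.cong refl)
        fix p :: "nat \<Rightarrow> nat"
        have "(of_int (sign p) :: real) ^ 4 = 1" by (simp add: sign_def)
        then show "(of_int (sign p) * (\<Prod>i\<in>{1..N}. ?s i ^ (p i - 1))) ^ 4 = (\<Prod>i\<in>{1..N}. ?s i ^ (2 * (2 * (p i - 1))))"
          unfolding power_mult_distrib prod_power_distrib power_mult[symmetric] by (simp add: mult.commute)
      qed
      have 4: "real (card ?S) = fact N" by (simp add: card_permutations[of "{1..N}" N])
      show ?thesis unfolding 1 using 2 unfolding 3 4 by (rule mult_left_mono) simp
    qed
    have "(\<Sum>b\<in>?B m. bweight N m b * kraw_det N m b ^ 4)
       \<le> (\<Sum>b\<in>?B m. bweight N m b * (\<kappa> ^ 4 * (fact N ^ 3 * (\<Sum>p\<in>?S. \<Prod>i\<in>{1..N}. (2 * real (b i) - real m) ^ (2 * (2 * (p i - 1)))))))"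
      by (intro sum_mono mult_left_mono bound bweight_nonneg)
    also have "\<dots> = (\<Sum>b\<in>?B m. \<Sum>p\<in>?S. \<kappa> ^ 4 * fact N ^ 3 * (bweight N m b * (\<Prod>i\<in>{1..N}. (2 * real (b i) - real m) ^ (2 * (2 * (p i - 1))))))"
      by (simp add: sum_distrib_left mult_ac)
    also have "\<dots> = (\<Sum>p\<in>?S. \<Sum>b\<in>?B m. \<kappa> ^ 4 * fact N ^ 3 * (bweight N m b * (\<Prod>i\<in>{1..N}. (2 * real (b i) - real m) ^ (2 * (2 * (p i - 1))))))"
      by (rule sum.swap)
    also have "\<dots> = \<kappa> ^ 4 * fact N ^ 3 * (\<Sum>p\<in>?S. \<Sum>b\<in>?B m. bweight N m b * (\<Prod>i\<in>{1..N}. (2 * real (b i) - real m) ^ (2 * (2 * (p i - 1)))))"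
      by (simp add: sum_distrib_left)
    also have "\<dots> \<le> \<kappa> ^ 4 * fact N ^ 3 * (\<Sum>p\<in>?S. C1 * real m ^ (2 * ?a))"
    proof (intro mult_left_mono sum_mono)
      fix p assume p: "p \<in> ?S"
      have "(\<Sum>b\<in>?B m. bweight N m b * (\<Prod>i\<in>{1..N}. (2 * real (b i) - real m) ^ (2 * (2 * (p i - 1)))))
        = (\<Prod>i\<in>{1..N}. \<Sum>b\<le>m. real (m choose b) / 2 ^ m * (2 * real b - real m) ^ (2 * (2 * (p i - 1))))"
        by (rule sum_bweight_prod)
      also have "\<dots> \<le> (\<Prod>i\<in>{1..N}. c (2 * (p i - 1)) * real m ^ (2 * (p i - 1)))"
      proof (intro prod_mono conjI binomial_moment_le[OF m, folded c_def] sum_nonneg)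
        fix i b
        have "(2 * real b - real m) ^ (2 * (2 * (p i - 1))) \<ge> 0" by (simp add: power_mult)
        then show "0 \<le> real (m choose b) / 2 ^ m * (2 * real b - real m) ^ (2 * (2 * (p i - 1)))" by simp
      qed
      also have "\<dots> = (\<Prod>j\<in>{1..N}. c (2 * (j - 1)) * real m ^ (2 * (j - 1)))"
        using p prod.permute[of p "{1..N}" "\<lambda>j. c (2 * (j - 1)) * real m ^ (2 * (j - 1))"] by (simp add: o_def)
      also have "\<dots> = C1 * real m ^ (2 * ?a)"
        by (simp only: C1_def prod.distrib sum_distrib_left power_sum)
      finally show "(\<Sum>b\<in>?B m. bweight N m b * (\<Prod>i\<in>{1..N}. (2 * real (b i) - real m) ^ (2 * (2 * (p i - 1))))) \<le> C1 * real m ^ (2 * ?a)" .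
    qed (use \<open>\<kappa> > 0\<close> in auto)
    also have "\<dots> = C * real m ^ (2 * ?a)"
      by (simp add: C_def card_permutations[of "{1..N}" N] mult_ac)
    finally show ?thesis .
  qed
  ultimately show ?thesis by blast
qed

text \<open>Antisymmetrising over the \<open>fact N\<close> orderings of the degrees turns the
  products of \<open>kdual\<close>, by the symmetry relation, into \<open>bweight\<close> times
  \<open>kraw_det\<close> over the product of binomials; and \<open>vsgn\<close> times the
  determinant is its absolute value, because the two have the same sign.\<close>

lemma vsgn_coeff_eq:
  assumes "N \<le> Suc m"
  shows "fact N * (\<Prod>j\<in>{1..N}. real (m choose (j - 1))) * vsgn_coeff N m (\<lambda>i. i - 1)
    = (\<Sum>b\<in>({1..N} \<rightarrow>\<^sub>E {..m}). bweight N m b * \<bar>kraw_det N m b\<bar>)"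
proof -
  let ?S = "{p. p permutes {1..N}}" and ?B = "{1..N} \<rightarrow>\<^sub>E {..m}"
  let ?c = "\<Prod>j\<in>{1..N}. real (m choose (j - 1))"
  have c: "?c > 0" using assms by (intro prod_pos) auto
  have "fact N * vsgn_coeff N m (\<lambda>i. i - 1) = (\<Sum>q\<in>?S. vsgn_coeff N m (\<lambda>i. i - 1))"
    by (simp add: card_permutations[of "{1..N}" N])
  also have "\<dots> = (\<Sum>q\<in>?S. of_int (sign q) * vsgn_coeff N m (\<lambda>i. q i - 1))"
  proof (intro sum.cong refl)
    fix q assume q: "q \<in> ?S"
    then have "vsgn_coeff N m (\<lambda>i. q i - 1) = of_int (sign q) * vsgn_coeff N m (\<lambda>i. i - 1)"
      using vsgn_coeff_permute[of q N m "\<lambda>i. i - 1"] by simp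
    then show "vsgn_coeff N m (\<lambda>i. i - 1) = of_int (sign q) * vsgn_coeff N m (\<lambda>i. q i - 1)"
      by (simp add: sign_def)
  qed
  also have "\<dots> = (\<Sum>q\<in>?S. \<Sum>b\<in>?B. of_int (sign q) * (vsgn N (\<lambda>i. 2 * int (b i) - int m) * (\<Prod>i\<in>{1..N}. kdual m (q i - 1) (b i) / 2 ^ m)))"
    by (simp add: vsgn_coeff_def sum_distrib_left)
  also have "\<dots> = (\<Sum>b\<in>?B. \<Sum>q\<in>?S. of_int (sign q) * (vsgn N (\<lambda>i. 2 * int (b i) - int m) * (\<Prod>i\<in>{1..N}. kdual m (q i - 1) (b i) / 2 ^ m)))"
    by (rule sum.swap)
  also have "\<dots> = (\<Sum>b\<in>?B. bweight N m b * \<bar>kraw_det N m b\<bar> / ?c)"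
  proof (intro sum.cong refl)
    fix b assume b: "b \<in> ?B"
    have *: "(\<Prod>i\<in>{1..N}. kdual m (q i - 1) (b i) / 2 ^ m) = bweight N m b * (\<Prod>i\<in>{1..N}. kraw m (b i) (q i - 1)) / ?c" if q: "q \<in> ?S" for q
    proof -
      have "(\<Prod>i\<in>{1..N}. kdual m (q i - 1) (b i) / 2 ^ m) = (\<Prod>i\<in>{1..N}. real (m choose (b i)) / 2 ^ m * kraw m (b i) (q i - 1) / real (m choose (q i - 1)))"
      proof (intro prod.cong refl)
        fix i assume i: "i \<in> {1..N}"
        then have "q i \<in> {1..N}" using q by (simp only: mem_Collect_eq permutes_in_image)
        then have "q i - 1 \<le> m" using assms by auto
        moreover have "b i \<le> m" using b i by auto
        ultimately show "kdual m (q i - 1) (b i) / 2 ^ m = real (m choose (b i)) / 2 ^ m * kraw m (b i) (q i - 1) / real (m choose (q i - 1))"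
          using kraw_kdual_symmetry[of "q i - 1" m "b i"] by (simp add: field_simps)
      qed
      also have "\<dots> = bweight N m b * (\<Prod>i\<in>{1..N}. kraw m (b i) (q i - 1)) / (\<Prod>i\<in>{1..N}. real (m choose (q i - 1)))"
        unfolding bweight_def prod.distrib[symmetric] prod_dividef[symmetric] by simp
      also have "(\<Prod>i\<in>{1..N}. real (m choose (q i - 1))) = ?c"
        using q prod.permute[of q "{1..N}" "\<lambda>j. real (m choose (j - 1))"] by (simp add: o_def)
      finally show ?thesis .
    qed
    have "(\<Sum>q\<in>?S. of_int (sign q) * (vsgn N (\<lambda>i. 2 * int (b i) - int m) * (\<Prod>i\<in>{1..N}. kdual m (q i - 1) (b i) / 2 ^ m)))
      = (\<Sum>q\<in>?S. vsgn N (\<lambda>i. 2 * int (b i) - int m) * bweight N m b / ?c * (of_int (sign q) * (\<Prod>i\<in>{1..N}. kraw m (b i) (q i - 1))))"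
      by (intro sum.cong refl) (simp add: *)
    also have "\<dots> = bweight N m b * (vsgn N (\<lambda>i. 2 * int (b i) - int m) * kraw_det N m b) / ?c"
      unfolding kraw_det_def sdet_def sum_distrib_left[symmetric] by simp
    also have "vsgn N (\<lambda>i. 2 * int (b i) - int m) * kraw_det N m b = \<bar>kraw_det N m b\<bar>"
    proof -
      have D: "kraw_det N m b = vandermonde N (\<lambda>i. real (b i)) * (\<Prod>j\<in>{1..N}. 2 ^ (j - 1) / fact (j - 1))"
        using b by (intro kraw_det_eq) auto
      have nn: "0 \<le> (\<Prod>j\<in>{1..N}. 2 ^ (j - 1) / fact (j - 1) :: real)" by (intro prod_nonneg) auto
      show ?thesis unfolding vsgn_lattice D abs_mult abs_of_nonneg[OF nn] unfolding abs_sgn by (simp only: mult_ac)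
    qed
    finally show "(\<Sum>q\<in>?S. of_int (sign q) * (vsgn N (\<lambda>i. 2 * int (b i) - int m) * (\<Prod>i\<in>{1..N}. kdual m (q i - 1) (b i) / 2 ^ m)))
      = bweight N m b * \<bar>kraw_det N m b\<bar> / ?c" .
  qed
  finally have *: "fact N * vsgn_coeff N m (\<lambda>i. i - 1) = (\<Sum>b\<in>?B. bweight N m b * \<bar>kraw_det N m b\<bar>) / ?c"
    by (simp only: sum_divide_distrib)
  have "?c \<noteq> 0" using c by (rule less_imp_neq[symmetric])
  then have "fact N * vsgn_coeff N m (\<lambda>i. i - 1) * ?c = (\<Sum>b\<in>?B. bweight N m b * \<bar>kraw_det N m b\<bar>)"
    using * by (rule iffD1[OF nonzero_eq_divide_eq])
  then show ?thesis by (simp only: mult_ac)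
qed


text \<open>The first moment is bounded below through x^2 <= l |x| + x^4 / l^2: as the fourth moment
  is at most of the order of the squared second moment, \<open>l\<close> can be chosen so that the
  quartic term takes only half of the second moment.\<close>

lemma vsgn_coeff_lower_bound:
  assumes "1 \<le> N"
  shows "\<exists>c>0. \<forall>m\<ge>N. vsgn_coeff N m (\<lambda>i. i - 1) \<ge> c / sqrt (real m) ^ (\<Sum>j\<in>{1..N}. j - 1)"
proof -
  let ?a = "\<Sum>j\<in>{1..N}. j - 1"
  obtain C where C: "C > 0" and C4: "\<And>m. m \<ge> 1 \<Longrightarrow> (\<Sum>b\<in>({1..N} \<rightarrow>\<^sub>E {..m}). bweight N m b * kraw_det N m b ^ 4) \<le> C * real m ^ (2 * ?a)"
    using sum_kraw_det_fourth[of N] by blast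
  \<comment> \<open>From (m choose k) >= (m/k)^k for the degrees k < N: the second moment is at
    least \<open>c1\<close> m^a, where a is the exponent \<open>?a\<close>.\<close>
  define c1 where "c1 = fact N / real N ^ ?a"
  have c1: "c1 > 0" using assms by (simp add: c1_def)
  \<comment> \<open>With l = L s and s^2 = m^a the quartic term is at most C s^4 / l^2 = c1 s^2 /
    2.\<close>
  define L where "L = sqrt (2 * C / c1)"
  have L: "L > 0" "L\<^sup>2 = 2 * C / c1" using C c1 by (auto simp: L_def)
  define c where "c = c1 / (2 * L * fact N)"
  have "c > 0" using c1 L by (simp add: c_def)
  moreover have "vsgn_coeff N m (\<lambda>i. i - 1) \<ge> c / sqrt (real m) ^ ?a" if m: "m \<ge> N" for m
  proof -
    let ?B = "{1..N} \<rightarrow>\<^sub>E {..m}" and ?P = "\<Prod>j\<in>{1..N}. real (m choose (j - 1))"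
    let ?A = "\<Sum>b\<in>?B. bweight N m b * \<bar>kraw_det N m b\<bar>"
    have m1: "m \<ge> 1" using m assms by simp
    have Ppos: "?P > 0" using m by (intro prod_pos) auto
    have Ple: "?P \<le> real m ^ ?a"
    proof -
      have "?P \<le> (\<Prod>j\<in>{1..N}. real m ^ (j - 1))"
      proof (intro prod_mono conjI)
        fix j assume "j \<in> {1..N}"
        then have "m choose (j - 1) \<le> m ^ (j - 1)" using m by (intro binomial_le_pow) auto
        then show "real (m choose (j - 1)) \<le> real m ^ (j - 1)" by (simp flip: of_nat_power)
      qed auto
      then show ?thesis by (simp only: power_sum)
    qed
    have Pge: "fact N * ?P \<ge> c1 * real m ^ ?a"
    proof -
      have "(\<Prod>j\<in>{1..N}. (real m / real N) ^ (j - 1)) \<le> ?P"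
      proof (intro prod_mono conjI)
        fix j assume j: "j \<in> {1..N}"
        have "(real m / real N) ^ (j - 1) \<le> (real m / real (j - 1)) ^ (j - 1)"
          using j by (cases "j - 1 = 0") (auto intro!: power_mono divide_left_mono)
        also have "\<dots> \<le> real (m choose (j - 1))" using j m by (intro binomial_ge_n_over_k_pow_k) auto
        finally show "(real m / real N) ^ (j - 1) \<le> real (m choose (j - 1))" .
      qed auto
      then have "(real m / real N) ^ ?a \<le> ?P" by (simp only: power_sum)
      then have "fact N * (real m / real N) ^ ?a \<le> fact N * ?P" by (intro mult_left_mono) auto
      then show ?thesis by (simp add: c1_def power_divide)
    qed
    define s where "s = sqrt (real m) ^ ?a"
    have s: "s > 0" "s\<^sup>2 = real m ^ ?a" using m1 by (auto simp: s_def simp flip: power_mult) 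
       (simp add: mult.commute power_mult)
    have s4: "(s\<^sup>2)\<^sup>2 = real m ^ (2 * ?a)" unfolding s by (simp add: mult.commute flip: power_mult)
    define l where "l = L * s"
    have l: "l > 0" using L s by (simp add: l_def)
    have pointwise: "x\<^sup>2 \<le> l * \<bar>x\<bar> + x ^ 4 / l\<^sup>2" for x :: real
    proof (cases "\<bar>x\<bar> \<le> l")
      case True
      then have "\<bar>x\<bar> * \<bar>x\<bar> \<le> l * \<bar>x\<bar>" by (intro mult_right_mono) auto
      moreover have "x ^ 4 / l\<^sup>2 \<ge> 0" by simp
      moreover have "x\<^sup>2 = \<bar>x\<bar> * \<bar>x\<bar>" by (simp add: power2_eq_square)
      ultimately show ?thesis by linarith
    next
      case False
      then have "l\<^sup>2 \<le> x\<^sup>2" using l by (simp add: abs_le_square_iff[symmetric])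
      then have "l\<^sup>2 * x\<^sup>2 \<le> x\<^sup>2 * x\<^sup>2" by (intro mult_right_mono) auto
      then have "x\<^sup>2 \<le> x ^ 4 / l\<^sup>2" using l by (simp add: pos_le_divide_eq power4_eq_xxxx power2_eq_square mult_ac)
      moreover have "l * \<bar>x\<bar> \<ge> 0" using l by simp
      ultimately show ?thesis by linarith
    qed
    have "c1 * s\<^sup>2 \<le> (\<Sum>b\<in>?B. bweight N m b * (kraw_det N m b)\<^sup>2)"
      using Pge sum_kraw_det_squared[of N m] m by (simp add: s)
    also have "\<dots> \<le> (\<Sum>b\<in>?B. bweight N m b * (l * \<bar>kraw_det N m b\<bar> + kraw_det N m b ^ 4 / l\<^sup>2))"
      by (intro sum_mono mult_left_mono pointwise bweight_nonneg)
    also have "\<dots> = l * ?A + (\<Sum>b\<in>?B. bweight N m b * kraw_det N m b ^ 4) / l\<^sup>2"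
      unfolding sum_distrib_left sum_divide_distrib sum.distrib[symmetric]
      by (intro sum.cong refl) (simp add: distrib_left mult_ac)
    also have "\<dots> \<le> l * ?A + C * (s\<^sup>2)\<^sup>2 / l\<^sup>2"
      using C4[OF m1] unfolding s4 by (intro add_left_mono divide_right_mono) auto
    also have "C * (s\<^sup>2)\<^sup>2 / l\<^sup>2 = c1 / 2 * s\<^sup>2"
      using s C c1 unfolding l_def power_mult_distrib L by (simp add: power2_eq_square)
    finally have "c1 / 2 * s\<^sup>2 \<le> l * ?A" by simp
    then have "c1 / 2 * s \<le> L * ?A" using s by (simp add: l_def power2_eq_square mult_ac)
    then have A: "c1 / (2 * L) * s \<le> ?A" using L by (simp add: field_simps)
    \<comment> \<open>The first moment is at least of order s and the normalisation at most of order
      s^2, which leaves 1 / s.\<close>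
    have "c / s = c1 / (2 * L) * s / (fact N * s\<^sup>2)" using s(1) by (simp add: c_def power2_eq_square)
    also have "\<dots> \<le> ?A / (fact N * s\<^sup>2)" using A s by (intro divide_right_mono) auto
    also have "\<dots> \<le> ?A / (fact N * ?P)"
    proof (rule frac_le)
      show "0 \<le> ?A" by (intro sum_nonneg mult_nonneg_nonneg bweight_nonneg abs_ge_zero)
      show "0 < fact N * ?P" by (rule mult_pos_pos[OF fact_gt_zero Ppos])
      show "fact N * ?P \<le> fact N * s\<^sup>2" unfolding s by (rule mult_left_mono[OF Ple]) simp
    qed simp
    also have "\<dots> = vsgn_coeff N m (\<lambda>i. i - 1)"
    proof -
      have e: "fact N * ?P * vsgn_coeff N m (\<lambda>i. i - 1) = ?A" using m by (intro vsgn_coeff_eq) simp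
      have "fact N * ?P > 0" by (rule mult_pos_pos[OF fact_gt_zero Ppos])
      then show ?thesis unfolding e[symmetric] by (intro nonzero_mult_div_cancel_left less_imp_neq[symmetric])
    qed
    finally show ?thesis unfolding s_def .
  qed
  ultimately show ?thesis by blast
qed

text \<open>Here \<open>m\<close> counts the steps from the common virtual origin, so
  \<open>m - r\<close> steps remain from \<open>x\<close>. The index vectors that are permutations
  of 0, ..., N - 1 add up to \<open>kraw_det\<close> at the starting points times the lowest
  coefficient; the rest is smaller by a factor of order m^(-1/2).\<close>

lemma avg_funpow_vsgn_tendsto:
  assumes N: "1 \<le> N" and r: "N \<le> r" and x: "\<And>i. i \<in> {1..N} \<Longrightarrow> x i \<in> lattice r"
  shows "(\<lambda>m. (avg N ^^ (m - r)) (vsgn N) x / vsgn_coeff N m (\<lambda>i. i - 1))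
    \<longlonglongrightarrow> vandermonde N (\<lambda>i. of_int (x i)) * (\<Prod>j\<in>{1..N}. 1 / fact (j - 1))"
proof -
  let ?a = "\<Sum>j\<in>{1..N}. j - 1" and ?K = "{1..N} \<rightarrow>\<^sub>E {..r}" and ?S = "{q. q permutes {1..N}}"
  let ?E = "\<lambda>m. vsgn_coeff N m (\<lambda>i. i - 1)"
  obtain c where c: "c > 0" "\<And>m. m \<ge> N \<Longrightarrow> ?E m \<ge> c / sqrt (real m) ^ ?a"
    using vsgn_coeff_lower_bound[OF N] by blast
  have "\<forall>i\<in>{1..N}. \<exists>a\<le>r. x i = 2 * int a - int r" using latticeE[OF x] by metis
  then obtain a where a: "\<And>i. i \<in> {1..N} \<Longrightarrow> a i \<le> r \<and> x i = 2 * int (a i) - int r" by metis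
  \<comment> \<open>Degrees start at 0, permutations of \<open>{1..N}\<close> at 1;
    \<open>g q\<close> is the index vector belonging to the permutation \<open>q\<close>.\<close>
  define g where "g q = restrict (\<lambda>i. q i - 1) {1..N}" for q :: "nat \<Rightarrow> nat"
  define w where "w k = (\<Prod>i\<in>{1..N}. kraw r (a i) (k i))" for k
  have finK: "finite ?K" by (intro finite_PiE) auto
  have range: "q i \<in> {1..N}" if "q \<in> ?S" "i \<in> {1..N}" for q i
    using that by (simp only: mem_Collect_eq permutes_in_image)
  have gK: "g ` ?S \<subseteq> ?K"
    using range r by (fastforce simp: g_def)
  have inj_g: "inj_on g ?S"
  proof (rule inj_onI)
    fix p q assume pq: "p \<in> ?S" "q \<in> ?S" "g p = g q"
    have "p i = q i" for i
    proof (cases "i \<in> {1..N}")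
      case True
      have "p i - 1 = q i - 1" using fun_cong[OF pq(3), of i] True by (simp add: g_def)
      then show ?thesis using range[OF pq(1) True] range[OF pq(2) True] by auto
    qed (use pq in \<open>auto simp: permutes_not_in\<close>)
    then show "p = q" by (rule ext)
  qed
  have rest: "\<bar>vsgn_coeff N m k\<bar> \<le> (sqrt r / sqrt m) ^ Suc ?a" if k: "k \<in> ?K - g ` ?S" and m: "m \<ge> r" for m k
  proof (cases "inj_on k {1..N}")
    case True
    have "k ` {1..N} \<noteq> {..<N}"
    proof
      assume im: "k ` {1..N} = {..<N}"
      define q where "q i = (if i \<in> {1..N} then k i + 1 else i)" for i
      have "q permutes {1..N}"
      proof (rule bij_imp_permutes)
        have "(\<lambda>i. k i + 1) ` {1..N} = Suc ` (k ` {1..N})" by auto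
        also have "\<dots> = {1..N}" unfolding im by (simp add: lessThan_atLeast0 image_Suc_atLeastLessThan One_nat_def atLeastLessThanSuc_atLeastAtMost)
        finally have im1: "(\<lambda>i. k i + 1) ` {1..N} = {1..N}" .
        have "inj_on (\<lambda>i. k i + 1) {1..N}" by (rule inj_onI) (auto dest: inj_onD[OF True])
        with im1 have "bij_betw (\<lambda>i. k i + 1) {1..N} {1..N}" unfolding bij_betw_def by blast
        then show "bij_betw q {1..N} {1..N}" by (rule bij_betw_cong[THEN iffD1, rotated]) (auto simp: q_def)
      qed (auto simp: q_def)
      moreover have "k = g q" using k by (auto simp: g_def q_def PiE_def extensional_def fun_eq_iff)
      ultimately show False using k by auto
    qed
    then have "Suc (\<Sum>i<N. i) \<le> (\<Sum>i\<in>{1..N}. k i)" by (rule inj_on_sum_ge[OF True])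
    moreover have "(\<Sum>i<N. i) = ?a"
      by (rule sum.reindex_bij_witness[of _ "\<lambda>j. j - 1" Suc]) auto
    ultimately show ?thesis using k r N m by (intro abs_vsgn_coeff_le_power) auto
  next
    case False
    then show ?thesis by (simp add: vsgn_coeff_eq_0)
  qed
  define W where "W = (\<Sum>k\<in>?K - g ` ?S. \<bar>w k\<bar>)"
  define V where "V = vandermonde N (\<lambda>i. of_int (x i) :: real) * (\<Prod>j\<in>{1..N}. 1 / fact (j - 1))"
  have main: "\<bar>(avg N ^^ (m - r)) (vsgn N) x - V * ?E m\<bar> \<le> W * (sqrt r / sqrt m) ^ Suc ?a" if m: "m \<ge> r" for m
  proof -
    have "(avg N ^^ n) F x = (avg N ^^ n) F (\<lambda>i. 2 * int (a i) - int r)" if "depends_on N F" for n F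
    proof (rule depends_onD[of N])
      show "depends_on N ((avg N ^^ n) F)" by (induction n) (simp_all add: that depends_on_avg)
    qed (use a in auto)
    then have "(avg N ^^ (m - r)) (vsgn N) x = (avg N ^^ (m - r)) (vsgn N) (\<lambda>i. 2 * int (a i) - int r)"
      by (simp add: depends_on_vsgn)
    also have "\<dots> = (\<Sum>k\<in>?K. w k * vsgn_coeff N m k)"
      using avg_funpow_expansion[OF depends_on_vsgn, of N a r "m - r"] a m by (simp add: w_def vsgn_coeff_def)
    also have "\<dots> = (\<Sum>k\<in>?K - g ` ?S. w k * vsgn_coeff N m k) + (\<Sum>k\<in>g ` ?S. w k * vsgn_coeff N m k)"
      by (rule sum.subset_diff[OF gK finK])
    also have "(\<Sum>k\<in>g ` ?S. w k * vsgn_coeff N m k) = V * ?E m"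
    proof -
      have "(\<Sum>k\<in>g ` ?S. w k * vsgn_coeff N m k) = (\<Sum>q\<in>?S. w (g q) * vsgn_coeff N m (g q))"
        by (simp add: sum.reindex[OF inj_g])
      also have "\<dots> = (\<Sum>q\<in>?S. of_int (sign q) * (\<Prod>i\<in>{1..N}. kraw r (a i) (q i - 1)) * ?E m)"
      proof (intro sum.cong refl)
        fix q assume q: "q \<in> ?S"
        have "vsgn_coeff N m (g q) = vsgn_coeff N m (\<lambda>i. q i - 1)"
          by (simp add: vsgn_coeff_def g_def)
        also have "\<dots> = of_int (sign q) * ?E m"
          using vsgn_coeff_permute[of q N m "\<lambda>i. i - 1"] q by simp
        finally show "w (g q) * vsgn_coeff N m (g q) = of_int (sign q) * (\<Prod>i\<in>{1..N}. kraw r (a i) (q i - 1)) * ?E m"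
          by (simp add: w_def g_def)
      qed
      also have "\<dots> = kraw_det N r a * ?E m"
        by (simp add: kraw_det_def sdet_def sum_distrib_right)
      \<comment> \<open>The powers of 2 in \<open>kraw_det_eq\<close> are those of the affine change
        from \<open>a i\<close> to \<open>x i = 2 * a i - r\<close>, which makes the limit
        independent of \<open>r\<close>.\<close>
      also have "kraw_det N r a = V"
      proof -
        have "V = vandermonde N (\<lambda>i. 2 * real (a i) + (- real r)) * (\<Prod>j\<in>{1..N}. 1 / fact (j - 1))"
          unfolding V_def using a by (intro arg_cong2[where f="(*)"] vandermonde_cong refl) auto
        also have "\<dots> = (\<Prod>j\<in>{1..N}. 2 ^ (j - 1)) * vandermonde N (\<lambda>i. real (a i)) * (\<Prod>j\<in>{1..N}. 1 / fact (j - 1))"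
          unfolding vandermonde_affine ..
        also have "\<dots> = vandermonde N (\<lambda>i. real (a i)) * (\<Prod>j\<in>{1..N}. 2 ^ (j - 1) / fact (j - 1))"
          by (simp add: prod_dividef)
        also have "\<dots> = kraw_det N r a" using a by (intro kraw_det_eq[symmetric]) auto
        finally show ?thesis ..
      qed
      finally show ?thesis .
    qed
    finally have eq: "(avg N ^^ (m - r)) (vsgn N) x - V * ?E m = (\<Sum>k\<in>?K - g ` ?S. w k * vsgn_coeff N m k)" by simp
    have "\<bar>(avg N ^^ (m - r)) (vsgn N) x - V * ?E m\<bar> \<le> (\<Sum>k\<in>?K - g ` ?S. \<bar>w k\<bar> * (sqrt r / sqrt m) ^ Suc ?a)"
      unfolding eq by (rule order.trans[OF sum_abs], rule sum_mono, unfold abs_mult, rule mult_left_mono[OF rest[OF _ m]]) auto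
    then show ?thesis by (simp only: W_def sum_distrib_right)
  qed
  have W: "W \<ge> 0" unfolding W_def by (intro sum_nonneg) auto
  define B where "B = W * sqrt r ^ Suc ?a / c"
  have bound: "\<bar>(avg N ^^ (m - r)) (vsgn N) x / ?E m - V\<bar> \<le> B * (1 / sqrt (real m))" if m: "m \<ge> r" for m
  proof -
    have sm: "sqrt (real m) > 0" using m r N by simp
    have "0 < c / sqrt (real m) ^ ?a" using c sm by simp
    moreover have Ege: "c / sqrt (real m) ^ ?a \<le> ?E m" using c m r by simp
    ultimately have E: "?E m > 0" by linarith
    have "(avg N ^^ (m - r)) (vsgn N) x / ?E m - V = ((avg N ^^ (m - r)) (vsgn N) x - V * ?E m) / ?E m"
      using E by (simp add: diff_divide_distrib)
    then have "\<bar>(avg N ^^ (m - r)) (vsgn N) x / ?E m - V\<bar> = \<bar>(avg N ^^ (m - r)) (vsgn N) x - V * ?E m\<bar> / ?E m"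
      using E by (simp only: abs_divide abs_of_pos)
    also have "\<dots> \<le> W * (sqrt r / sqrt m) ^ Suc ?a / (c / sqrt (real m) ^ ?a)"
      using W c sm by (intro frac_le main m Ege mult_nonneg_nonneg) auto
    also have "\<dots> = B * (1 / sqrt (real m))"
      using sm by (simp add: B_def power_divide)
    finally show ?thesis .
  qed
  have "(\<lambda>m. (avg N ^^ (m - r)) (vsgn N) x / ?E m - V) \<longlonglongrightarrow> 0"
  proof (rule Lim_null_comparison)
    show "\<forall>\<^sub>F m in sequentially. norm ((avg N ^^ (m - r)) (vsgn N) x / ?E m - V) \<le> B * (1 / sqrt (real m))"
      using eventually_ge_at_top[of r] by eventually_elim (use bound in simp)
    have "(\<lambda>m. 1 / sqrt (real m)) \<longlonglongrightarrow> 0" by real_asymp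
    then show "(\<lambda>m. B * (1 / sqrt (real m))) \<longlonglongrightarrow> 0" by (rule tendsto_mult_right_zero)
  qed
  then show ?thesis unfolding V_def[symmetric] by (simp add: LIM_zero_iff)
qed

lemma eventually_vsgn_coeff_pos:
  assumes N: "1 \<le> N"
  shows "\<forall>\<^sub>F m in sequentially. vsgn_coeff N m (\<lambda>i. i - 1) > 0"
proof -
  obtain c where c: "c > 0" "\<And>m. m \<ge> N \<Longrightarrow> vsgn_coeff N m (\<lambda>i. i - 1) \<ge> c / sqrt (real m) ^ (\<Sum>j\<in>{1..N}. j - 1)"
    using vsgn_coeff_lower_bound[OF N] by blast
  show ?thesis using eventually_ge_at_top[of N]
  proof eventually_elim
    case (elim m)
    have "0 < c / sqrt (real m) ^ (\<Sum>j\<in>{1..N}. j - 1)" using c elim N by simp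
    also have "\<dots> \<le> vsgn_coeff N m (\<lambda>i. i - 1)" using c elim by simp
    finally show ?case .
  qed
qed

section \<open>Noncolliding walks as an \<open>h\<close>-transform\<close>

definition walk :: "(nat \<Rightarrow> int) \<Rightarrow> (nat \<Rightarrow> nat \<Rightarrow> int) \<Rightarrow> nat \<Rightarrow> nat \<Rightarrow> int" where
  "walk u e t i = u i + (\<Sum>s<t. e s i)"

definition step_seqs :: "nat \<Rightarrow> nat \<Rightarrow> (nat \<Rightarrow> nat \<Rightarrow> int) set" where
  "step_seqs N n = {..<n} \<rightarrow>\<^sub>E steps N"

text \<open>The expectation over free walkers during \<open>n\<close> steps, as a finite uniform
  average; \<open>expectation_positions\<close> identifies it with the expectation under
  \<open>P\<close>.\<close>

definition wexp :: "nat \<Rightarrow> (nat \<Rightarrow> int) \<Rightarrow> nat \<Rightarrow> ((nat \<Rightarrow> nat \<Rightarrow> int) \<Rightarrow> real) \<Rightarrow> real" where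
  "wexp N u n F = (\<Sum>e\<in>step_seqs N n. F (walk u e)) / 2 ^ (N * n)"

definition noncolliding :: "nat \<Rightarrow> nat \<Rightarrow> (nat \<Rightarrow> nat \<Rightarrow> int) \<Rightarrow> bool" where
  "noncolliding N n w \<longleftrightarrow> (\<forall>t\<in>{1..n}. strict_mono_on {1..N} (w t))"

lemma finite_step_seqs [simp]: "finite (step_seqs N n)"
  unfolding step_seqs_def by (intro finite_PiE) auto

lemma card_step_seqs: "card (step_seqs N n) = 2 ^ (N * n)"
  unfolding step_seqs_def by (subst card_PiE) (auto simp: card_steps power_mult)

lemma walk_0 [simp]: "walk u e 0 = u"
  by (simp add: walk_def fun_eq_iff)

lemma wexp_cong:
  "(\<And>e. e \<in> step_seqs N n \<Longrightarrow> F (walk u e) = G (walk u e)) \<Longrightarrow> wexp N u n F = wexp N u n G"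
  unfolding wexp_def by (intro arg_cong2[where f="(/)"] sum.cong) auto

lemma wexp_0: "wexp N u 0 F = F (\<lambda>t. u)" if "\<And>w w'. w 0 = w' 0 \<Longrightarrow> F w = F w'"
  using that[of "walk u (\<lambda>_. undefined)" "\<lambda>t. u"] by (auto simp: wexp_def step_seqs_def walk_def fun_eq_iff)

lemma sum_step_seqs_Suc:
  "(\<Sum>e\<in>step_seqs N (Suc n). f e) = (\<Sum>e\<in>step_seqs N n. \<Sum>y\<in>steps N. f (e(n := y)))"
proof -
  have "step_seqs N (Suc n) = (\<lambda>(y, e). e(n := y)) ` (steps N \<times> step_seqs N n)"
    unfolding step_seqs_def lessThan_Suc by (rule PiE_insert_eq)
  moreover have "inj_on (\<lambda>(y, e). e(n := y)) (steps N \<times> step_seqs N n)"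
    unfolding step_seqs_def by (rule inj_combinator) simp
  ultimately have "(\<Sum>e\<in>step_seqs N (Suc n). f e) = (\<Sum>(y, e)\<in>steps N \<times> step_seqs N n. f (e(n := y)))"
    by (simp add: sum.reindex case_prod_unfold)
  also have "\<dots> = (\<Sum>y\<in>steps N. \<Sum>e\<in>step_seqs N n. f (e(n := y)))"
    by (rule sum.cartesian_product[symmetric])
  also have "\<dots> = (\<Sum>e\<in>step_seqs N n. \<Sum>y\<in>steps N. f (e(n := y)))"
    by (rule sum.swap)
  finally show ?thesis .
qed

lemma walk_fun_upd: "t \<le> n \<Longrightarrow> walk u (e(n := y)) t = walk u e t"
  unfolding walk_def by (intro ext arg_cong2[where f="(+)"] refl sum.cong) auto

text \<open>Markov property at time \<open>n\<close>: the last step is averaged out.\<close>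

lemma wexp_Suc:
  assumes "\<And>w w'. (\<And>t. t \<le> n \<Longrightarrow> w t = w' t) \<Longrightarrow> F w = F w'"
  shows "wexp N u (Suc n) (\<lambda>w. F w * f (w (Suc n))) = wexp N u n (\<lambda>w. F w * avg N f (w n))"
proof -
  have "(\<Sum>e\<in>step_seqs N (Suc n). F (walk u e) * f (walk u e (Suc n)))
    = (\<Sum>e\<in>step_seqs N n. \<Sum>y\<in>steps N. F (walk u e) * f (\<lambda>i. walk u e n i + y i))"
    unfolding sum_step_seqs_Suc
  proof (intro sum.cong refl arg_cong2[where f="(*)"] arg_cong[where f=f])
    fix e y
    show "F (walk u (e(n := y))) = F (walk u e)"
      by (intro assms walk_fun_upd)
    show "walk u (e(n := y)) (Suc n) = (\<lambda>i. walk u e n i + y i)"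
      using walk_fun_upd[of n n u e y] by (auto simp: walk_def fun_eq_iff)
  qed
  then show ?thesis
    by (simp add: wexp_def avg_def sum_distrib_left sum_divide_distrib power_add)
qed

lemma walk_parity:
  assumes "e \<in> step_seqs N n" "i \<in> {1..N}" "t \<le> n"
  shows "even (walk u e t i - u i - int t)" "\<bar>walk u e t i - u i\<bar> \<le> int t"
proof -
  have "even (walk u e t i - u i - int t) \<and> \<bar>walk u e t i - u i\<bar> \<le> int t"
    using assms(3)
  proof (induction t)
    case (Suc t)
    then have "e t i \<in> {-1, 1}" using assms by (auto simp: step_seqs_def steps_def PiE_def Pi_def)
    then show ?case using Suc by (auto simp: walk_def)
  qed (simp add: walk_def)
  then show "even (walk u e t i - u i - int t)" "\<bar>walk u e t i - u i\<bar> \<le> int t" by auto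
qed

definition alternating :: "nat \<Rightarrow> ((nat \<Rightarrow> int) \<Rightarrow> real) \<Rightarrow> bool" where
  "alternating N f \<longleftrightarrow> depends_on N f \<and> (\<forall>q x. q permutes {1..N} \<longrightarrow> f (\<lambda>i. x (q i)) = of_int (sign q) * f x)"

lemma alternating_eq_0:
  assumes f: "alternating N f" and x: "\<not> inj_on x {1..N}"
  shows "f x = 0"
proof -
  obtain i j where ij: "i \<in> {1..N}" "j \<in> {1..N}" "i \<noteq> j" "x i = x j"
    using x by (auto simp: inj_on_def)
  let ?q = "Transposition.transpose i j"
  have "?q permutes {1..N}" by (rule permutes_swap_id[OF ij(1,2)])
  then have "f (\<lambda>l. x (?q l)) = of_int (sign ?q) * f x"
    using f unfolding alternating_def by blast
  moreover have "(\<lambda>l. x (?q l)) = x" using ij by (auto simp: Transposition.transpose_def)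
  ultimately show ?thesis using ij by (simp add: sign_swap_id)
qed

lemma bij_betw_PiE_permute:
  assumes q: "q permutes I"
  shows "bij_betw (\<lambda>b i. b (q i)) (I \<rightarrow>\<^sub>E A) (I \<rightarrow>\<^sub>E A)"
proof (rule bij_betwI[where g = "\<lambda>b i. b (Hilbert_Choice.inv q i)"])
  have *: "(\<lambda>b i. b (p i)) \<in> (I \<rightarrow>\<^sub>E A) \<rightarrow> (I \<rightarrow>\<^sub>E A)" if p: "p permutes I" for p
    using permutes_in_image[OF p] permutes_not_in[OF p] by (fastforce simp: PiE_def Pi_def extensional_def)
  show "(\<lambda>b i. b (q i)) \<in> (I \<rightarrow>\<^sub>E A) \<rightarrow> (I \<rightarrow>\<^sub>E A)" by (rule *[OF q])
  show "(\<lambda>b i. b (Hilbert_Choice.inv q i)) \<in> (I \<rightarrow>\<^sub>E A) \<rightarrow> (I \<rightarrow>\<^sub>E A)" by (rule *[OF permutes_inv[OF q]])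
qed (auto simp: permutes_inverses[OF q])

lemma alternating_avg:
  assumes f: "alternating N f" shows "alternating N (avg N f)"
  unfolding alternating_def
proof (intro conjI allI impI)
  show "depends_on N (avg N f)" using f by (simp add: alternating_def depends_on_avg)
  fix q x assume q: "q permutes {1..N}"
  have "(\<Sum>e\<in>steps N. f (\<lambda>i. x (q i) + e i)) = (\<Sum>e\<in>steps N. f (\<lambda>i. x (q i) + e (q i)))"
    unfolding steps_def by (rule sum.reindex_bij_betw[OF bij_betw_PiE_permute[OF q], symmetric])
  also have "\<dots> = (\<Sum>e\<in>steps N. of_int (sign q) * f (\<lambda>i. x i + e i))"
    using f q by (intro sum.cong refl) (auto simp: alternating_def)
  finally show "avg N f (\<lambda>i. x (q i)) = of_int (sign q) * avg N f x"
    by (simp add: avg_def sum_distrib_left)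
qed

lemma alternating_vsgn: "alternating N (vsgn N)"
  by (auto simp: alternating_def depends_on_vsgn vsgn_permute)

lemma alternating_sdet: "alternating N (\<lambda>x. sdet {1..N} (\<lambda>i j. g j (x i)))"
  unfolding alternating_def depends_on_def
proof (intro conjI allI impI)
  fix x y :: "nat \<Rightarrow> int" assume "\<forall>i\<in>{1..N}. x i = y i"
  then show "sdet {1..N} (\<lambda>i j. g j (x i)) = sdet {1..N} (\<lambda>i j. g j (y i))" by (intro sdet_cong) auto
next
  fix q x assume "q permutes {1..N}"
  then show "sdet {1..N} (\<lambda>i j. g j (x (q i))) = of_int (sign q) * sdet {1..N} (\<lambda>i j. g j (x i))"
    using sdet_permute_rows[of "{1..N}" q "\<lambda>i j. g j (x i)"] by simp
qed

text \<open>Walkers of equal parity cannot pass each other without meeting, and an alternating function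
  vanishes where they meet; so it need not be killed at the walls of the chamber.\<close>

lemma avg_alternating_killed:
  assumes f: "alternating N f" and x: "strict_mono_on {1..N} x"
    and par: "\<And>i j. i \<in> {1..N} \<Longrightarrow> j \<in> {1..N} \<Longrightarrow> even (x i - x j)"
  shows "avg N (\<lambda>y. of_bool (strict_mono_on {1..N} y) * f y) x = avg N f x"
  unfolding avg_def
proof (intro arg_cong2[where f="(/)"] sum.cong refl)
  fix e assume e: "e \<in> steps N"
  let ?y = "\<lambda>i. x i + e i"
  show "of_bool (strict_mono_on {1..N} ?y) * f ?y = f ?y"
  proof (cases "inj_on ?y {1..N}")
    case True
    have "strict_mono_on {1..N} ?y"
    proof (rule strict_mono_onI)
      fix i j :: nat assume ij: "i \<in> {1..N}" "j \<in> {1..N}" "i < j"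
      have "x i < x j" using x ij by (auto simp: strict_mono_on_def)
      moreover have "even (x j - x i)" by (rule par[OF ij(2,1)])
      ultimately have "x i + 2 \<le> x j" by presburger
      moreover have "e i \<in> {-1, 1}" "e j \<in> {-1, 1}" using e ij by (auto simp: steps_def)
      ultimately have "?y i \<le> ?y j" by auto
      moreover have "?y i \<noteq> ?y j" using inj_onD[OF True, of i j] ij by auto
      ultimately show "?y i < ?y j" by simp
    qed
    then show ?thesis by simp
  qed (simp add: alternating_eq_0[OF f])
qed

lemma noncolliding_Suc:
  "noncolliding N (Suc n) w \<longleftrightarrow> noncolliding N n w \<and> strict_mono_on {1..N} (w (Suc n))"
  unfolding noncolliding_def by (auto simp: le_Suc_eq)

lemma noncolliding_cong: "(\<And>t. t \<le> n \<Longrightarrow> w t = w' t) \<Longrightarrow> noncolliding N n w \<longleftrightarrow> noncolliding N n w'"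
  unfolding noncolliding_def by auto

context
  fixes N :: nat and u :: "nat \<Rightarrow> int"
  assumes u: "strict_mono_on {1..N} u" and u_even: "\<forall>j\<in>{1..N}. even (u j)"
begin

lemma noncolliding_strict_mono:
  assumes "noncolliding N n (walk u e)" shows "strict_mono_on {1..N} (walk u e n)"
  using assms u by (cases "n = 0") (auto simp: noncolliding_def)

text \<open>All walkers start at even sites and so share a parity at every time; in front of an
  alternating function the last collision constraint may therefore be dropped before
  averaging.\<close>

lemma wexp_noncolliding_Suc:
  assumes F: "\<And>w w'. (\<And>t. t \<le> n \<Longrightarrow> w t = w' t) \<Longrightarrow> F w = F w'" and f: "alternating N f"
  shows "wexp N u (Suc n) (\<lambda>w. F w * of_bool (noncolliding N (Suc n) w) * f (w (Suc n)))
    = wexp N u n (\<lambda>w. F w * of_bool (noncolliding N n w) * avg N f (w n))"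
proof -
  have "wexp N u (Suc n) (\<lambda>w. F w * of_bool (noncolliding N (Suc n) w) * f (w (Suc n)))
     = wexp N u (Suc n) (\<lambda>w. (F w * of_bool (noncolliding N n w)) * (of_bool (strict_mono_on {1..N} (w (Suc n))) * f (w (Suc n))))"
    by (rule wexp_cong) (simp add: noncolliding_Suc of_bool_conj)
  also have "\<dots> = wexp N u n (\<lambda>w. (F w * of_bool (noncolliding N n w)) * avg N (\<lambda>y. of_bool (strict_mono_on {1..N} y) * f y) (w n))"
  proof (rule wexp_Suc)
    fix w w' :: "nat \<Rightarrow> nat \<Rightarrow> int" assume "\<And>t. t \<le> n \<Longrightarrow> w t = w' t"
    then show "F w * of_bool (noncolliding N n w) = F w' * of_bool (noncolliding N n w')"
      using F[of w w'] noncolliding_cong[of n w w' N] by simp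
  qed
  also have "\<dots> = wexp N u n (\<lambda>w. F w * of_bool (noncolliding N n w) * avg N f (w n))"
  proof (rule wexp_cong)
    fix e assume e: "e \<in> step_seqs N n"
    show "F (walk u e) * of_bool (noncolliding N n (walk u e)) * avg N (\<lambda>y. of_bool (strict_mono_on {1..N} y) * f y) (walk u e n)
      = F (walk u e) * of_bool (noncolliding N n (walk u e)) * avg N f (walk u e n)"
    proof (cases "noncolliding N n (walk u e)")
      case True
      have "avg N (\<lambda>y. of_bool (strict_mono_on {1..N} y) * f y) (walk u e n) = avg N f (walk u e n)"
      proof (rule avg_alternating_killed[OF f noncolliding_strict_mono[OF True]])
        fix i j assume ij: "i \<in> {1..N}" "j \<in> {1..N}"
        then show "even (walk u e n i - walk u e n j)"
          using walk_parity(1)[OF e ij(1), of n u] walk_parity(1)[OF e ij(2), of n u] u_even by simp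
      qed
      then show ?thesis by simp
    qed simp
  qed
  finally show ?thesis .
qed

lemma wexp_noncolliding_add:
  assumes F: "\<And>w w'. (\<And>t. t \<le> T \<Longrightarrow> w t = w' t) \<Longrightarrow> F w = F w'" and f: "alternating N f"
  shows "wexp N u (T + k) (\<lambda>w. F w * of_bool (noncolliding N (T + k) w) * f (w (T + k)))
    = wexp N u T (\<lambda>w. F w * of_bool (noncolliding N T w) * (avg N ^^ k) f (w T))"
  using f
proof (induction k arbitrary: f)
  case (Suc k)
  have "wexp N u (Suc (T + k)) (\<lambda>w. F w * of_bool (noncolliding N (Suc (T + k)) w) * f (w (Suc (T + k))))
    = wexp N u (T + k) (\<lambda>w. F w * of_bool (noncolliding N (T + k) w) * avg N f (w (T + k)))"
    by (rule wexp_noncolliding_Suc[OF F Suc.prems]) simp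
  also have "\<dots> = wexp N u T (\<lambda>w. F w * of_bool (noncolliding N T w) * (avg N ^^ k) (avg N f) (w T))"
    by (rule Suc.IH[OF alternating_avg[OF Suc.prems]])
  finally show ?case by (simp add: funpow_swap1)
qed simp

lemma wexp_noncolliding_vsgn:
  "wexp N u n (\<lambda>w. F w * of_bool (noncolliding N n w)) = wexp N u n (\<lambda>w. F w * of_bool (noncolliding N n w) * vsgn N (w n))"
proof (rule wexp_cong)
  fix e
  show "F (walk u e) * of_bool (noncolliding N n (walk u e)) = F (walk u e) * of_bool (noncolliding N n (walk u e)) * vsgn N (walk u e n)"
    using vandermonde_pos[OF noncolliding_strict_mono[of n e]] by (cases "noncolliding N n (walk u e)") (simp_all add: vsgn_def)
qed

text \<open>Numerator and denominator are divided by the same coefficient \<open>?E (n + r)\<close>,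
  whose unknown asymptotics cancel. Its positivity for large \<open>n\<close> and the positive limit
  of the denominator also show that the conditioning event eventually has positive
  probability.\<close>

lemma wexp_conditioned_tendsto:
  assumes N: "1 \<le> N" and F: "\<And>w w'. (\<And>t. t \<le> T \<Longrightarrow> w t = w' t) \<Longrightarrow> F w = F w'"
  shows "(\<lambda>n. wexp N u n (\<lambda>w. F w * of_bool (noncolliding N n w)) / wexp N u n (\<lambda>w. of_bool (noncolliding N n w)))
    \<longlonglongrightarrow> wexp N u T (\<lambda>w. F w * of_bool (noncolliding N T w) * vandermonde N (\<lambda>i. of_int (w T i))) / vandermonde N (\<lambda>i. of_int (u i))"
    and "\<forall>\<^sub>F n in sequentially. wexp N u n (\<lambda>w. of_bool (noncolliding N n w)) > 0"
proof -
  let ?E = "\<lambda>m. vsgn_coeff N m (\<lambda>i. i - 1)"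
  define \<kappa> where "\<kappa> = (\<Prod>j\<in>{1..N}. 1 / fact (j - 1) :: real)"
  have \<kappa>: "\<kappa> > 0" unfolding \<kappa>_def by (intro prod_pos) auto
  define h where "h x = vandermonde N (\<lambda>i. of_int (x i) :: real)" for x :: "nat \<Rightarrow> int"
  have hu: "h u > 0" unfolding h_def using u by (intro vandermonde_pos) (auto simp: strict_mono_on_def)
  \<comment> \<open>Even, so that the even points \<open>u i\<close> have the parity of
    \<open>lattice r\<close>; at least \<open>N\<close>, as the ratio limit requires; and large
    enough to cover all \<open>u i\<close>.\<close>
  define r where "r = 2 * (N + nat (\<Sum>j\<in>{1..N}. \<bar>u j\<bar>))"
  have r: "N \<le> r" "even r" unfolding r_def by auto
  have ur: "u i \<in> lattice r" if i: "i \<in> {1..N}" for i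
  proof -
    have "\<bar>u i\<bar> \<le> (\<Sum>j\<in>{1..N}. \<bar>u j\<bar>)" by (rule member_le_sum) (use i in auto)
    also have "\<dots> \<le> int r" unfolding r_def by (simp add: sum_nonneg)
    finally show ?thesis using u_even i r by (auto simp: lattice_def)
  qed
  \<comment> \<open>After \<open>s\<close> steps the walkers are in \<open>lattice (r + s)\<close>
    and, for n >= s, \<open>n - s\<close> steps remain, so the count from the virtual origin is
    \<open>n + r\<close> whatever \<open>s\<close> is.\<close>
  have lim: "(\<lambda>n. (avg N ^^ (n - s)) (vsgn N) x / ?E (n + r)) \<longlonglongrightarrow> h x * \<kappa>"
    if x: "\<And>i. i \<in> {1..N} \<Longrightarrow> x i \<in> lattice (r + s)" for s x
  proof -
    have "(\<lambda>m. (avg N ^^ (m - (r + s))) (vsgn N) x / ?E m) \<longlonglongrightarrow> h x * \<kappa>"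
      unfolding h_def \<kappa>_def using r by (intro avg_funpow_vsgn_tendsto N x) auto
    then have "(\<lambda>n. (avg N ^^ (n + r - (r + s))) (vsgn N) x / ?E (n + r)) \<longlonglongrightarrow> h x * \<kappa>"
      by (rule LIMSEQ_ignore_initial_segment)
    then show ?thesis by simp
  qed
  have den: "wexp N u n (\<lambda>w. of_bool (noncolliding N n w)) = (avg N ^^ n) (vsgn N) u" for n
  proof -
    have "wexp N u n (\<lambda>w. of_bool (noncolliding N n w)) = wexp N u (0 + n) (\<lambda>w. 1 * of_bool (noncolliding N (0 + n) w) * vsgn N (w (0 + n)))"
      using wexp_noncolliding_vsgn[of n "\<lambda>_. 1"] by simp
    also have "\<dots> = wexp N u 0 (\<lambda>w. 1 * of_bool (noncolliding N 0 w) * (avg N ^^ n) (vsgn N) (w 0))"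
      by (rule wexp_noncolliding_add) (auto simp: alternating_vsgn)
    also have "\<dots> = (avg N ^^ n) (vsgn N) u"
      by (subst wexp_0) (auto simp: noncolliding_def)
    finally show ?thesis .
  qed
  have limden: "(\<lambda>n. (avg N ^^ n) (vsgn N) u / ?E (n + r)) \<longlonglongrightarrow> h u * \<kappa>"
    using lim[of u 0] ur by simp
  have num: "wexp N u n (\<lambda>w. F w * of_bool (noncolliding N n w)) = wexp N u T (\<lambda>w. F w * of_bool (noncolliding N T w) * (avg N ^^ (n - T)) (vsgn N) (w T))"
    if n: "n \<ge> T" for n
  proof -
    have "wexp N u (T + (n - T)) (\<lambda>w. F w * of_bool (noncolliding N (T + (n - T)) w) * vsgn N (w (T + (n - T)))) 
      = wexp N u T (\<lambda>w. F w * of_bool (noncolliding N T w) * (avg N ^^ (n - T)) (vsgn N) (w T))"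
      by (rule wexp_noncolliding_add[OF F alternating_vsgn])
    then show ?thesis using n wexp_noncolliding_vsgn[of n F] by simp
  qed
  have limnum: "(\<lambda>n. wexp N u n (\<lambda>w. F w * of_bool (noncolliding N n w)) / ?E (n + r))
    \<longlonglongrightarrow> wexp N u T (\<lambda>w. F w * of_bool (noncolliding N T w) * h (w T)) * \<kappa>"
  proof -
    have "(\<lambda>n. \<Sum>e\<in>step_seqs N T. F (walk u e) * of_bool (noncolliding N T (walk u e)) / 2 ^ (N * T) * ((avg N ^^ (n - T)) (vsgn N) (walk u e T) / ?E (n + r)))
      \<longlonglongrightarrow> (\<Sum>e\<in>step_seqs N T. F (walk u e) * of_bool (noncolliding N T (walk u e)) / 2 ^ (N * T) * (h (walk u e T) * \<kappa>))"
    proof (intro tendsto_sum tendsto_mult_left lim)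
      fix e i assume e: "e \<in> step_seqs N T" and i: "i \<in> {1..N}"
      show "walk u e T i \<in> lattice (r + T)"
        using ur[OF i] walk_parity[OF e i, of T u] by (auto simp: lattice_def)
    qed
    also have "(\<Sum>e\<in>step_seqs N T. F (walk u e) * of_bool (noncolliding N T (walk u e)) / 2 ^ (N * T) * (h (walk u e T) * \<kappa>))
       = wexp N u T (\<lambda>w. F w * of_bool (noncolliding N T w) * h (w T)) * \<kappa>"
      by (simp add: wexp_def sum_divide_distrib sum_distrib_left mult_ac)
    finally show ?thesis
    proof (rule Lim_transform_eventually)
      show "\<forall>\<^sub>F n in sequentially. (\<Sum>e\<in>step_seqs N T. F (walk u e) * of_bool (noncolliding N T (walk u e)) / 2 ^ (N * T) * ((avg N ^^ (n - T)) (vsgn N) (walk u e T) / ?E (n + r)))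
        = wexp N u n (\<lambda>w. F w * of_bool (noncolliding N n w)) / ?E (n + r)"
        using eventually_ge_at_top[of T]
      proof eventually_elim
        case (elim n)
        show ?case unfolding num[OF elim] by (simp add: wexp_def sum_divide_distrib mult_ac)
      qed
    qed
  qed
  have pos: "\<forall>\<^sub>F n in sequentially. ?E (n + r) > 0"
    using eventually_vsgn_coeff_pos[OF N] by (rule eventually_compose_filterlim) (rule filterlim_add_const_nat_at_top)
  have "(\<lambda>n. (wexp N u n (\<lambda>w. F w * of_bool (noncolliding N n w)) / ?E (n + r)) / ((avg N ^^ n) (vsgn N) u / ?E (n + r)))
    \<longlonglongrightarrow> (wexp N u T (\<lambda>w. F w * of_bool (noncolliding N T w) * h (w T)) * \<kappa>) / (h u * \<kappa>)"
    using \<kappa> hu by (intro tendsto_divide limnum limden) auto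
  also have "(wexp N u T (\<lambda>w. F w * of_bool (noncolliding N T w) * h (w T)) * \<kappa>) / (h u * \<kappa>) = wexp N u T (\<lambda>w. F w * of_bool (noncolliding N T w) * h (w T)) / h u"
    using \<kappa> by simp
  finally have "(\<lambda>n. wexp N u n (\<lambda>w. F w * of_bool (noncolliding N n w)) / (avg N ^^ n) (vsgn N) u)
    \<longlonglongrightarrow> wexp N u T (\<lambda>w. F w * of_bool (noncolliding N T w) * h (w T)) / h u"
    by (rule Lim_transform_eventually) (use pos in \<open>eventually_elim; simp\<close>)
  then show "(\<lambda>n. wexp N u n (\<lambda>w. F w * of_bool (noncolliding N n w)) / wexp N u n (\<lambda>w. of_bool (noncolliding N n w)))
    \<longlonglongrightarrow> wexp N u T (\<lambda>w. F w * of_bool (noncolliding N T w) * vandermonde N (\<lambda>i. of_int (w T i))) / vandermonde N (\<lambda>i. of_int (u i))"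
    unfolding den h_def .
  have "\<forall>\<^sub>F n in sequentially. 0 < (avg N ^^ n) (vsgn N) u / ?E (n + r)"
    by (rule order_tendstoD(1)[OF limden]) (use \<kappa> hu in simp)
  then show "\<forall>\<^sub>F n in sequentially. wexp N u n (\<lambda>w. of_bool (noncolliding N n w)) > 0"
    unfolding den using pos by eventually_elim (simp add: zero_less_divide_iff)
qed

end

section \<open>From walkers on a probability space to finite averages\<close>

lemma step_seqs_D:
  assumes "e \<in> step_seqs N n"
  shows "t < n \<Longrightarrow> i \<in> {1..N} \<Longrightarrow> e t i \<in> {-1, 1}"
    and "t < n \<Longrightarrow> i \<notin> {1..N} \<Longrightarrow> e t i = undefined"
    and "\<not> t < n \<Longrightarrow> e t = undefined"
proof -
  have e: "e t \<in> {1..N} \<rightarrow>\<^sub>E {-1, 1}" if "t < n"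
    using PiE_mem[OF assms[unfolded step_seqs_def], of t] that unfolding steps_def by simp
  show "e t i \<in> {-1, 1}" if "t < n" "i \<in> {1..N}" by (rule PiE_mem[OF e]) fact+
  show "e t i = undefined" if "t < n" "i \<notin> {1..N}" by (rule PiE_arb[OF e]) fact+
  show "\<not> t < n \<Longrightarrow> e t = undefined" using assms unfolding step_seqs_def by (intro PiE_arb) auto
qed

lemma integral_uniform_measure:
  fixes f :: "'a \<Rightarrow> real"
  assumes M: "finite_measure M" and A: "A \<in> sets M" "measure M A > 0" and f: "f \<in> borel_measurable M"
  shows "(\<integral>x. f x \<partial>uniform_measure M A) = (\<integral>x. f x * indicator A x \<partial>M) / measure M A"
proof -
  have "indicator A x / emeasure M A = ennreal (indicator A x / measure M A)" for x
    using divide_ennreal[of 1 "measure M A", OF zero_le_one A(2)] unfolding finite_measure.emeasure_eq_measure[OF M]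
    by (simp add: indicator_def)
  then have *: "uniform_measure M A = density M (\<lambda>x. ennreal (indicator A x / measure M A))"
    unfolding uniform_measure_def by simp
  have g: "(\<lambda>x. indicator A x / measure M A) \<in> borel_measurable M" using A by simp
  have "(\<integral>x. f x \<partial>uniform_measure M A) = (\<integral>x. (indicator A x / measure M A) *\<^sub>R f x \<partial>M)"
    unfolding * by (rule integral_density[OF f g]) simp
  also have "\<dots> = (\<integral>x. f x * indicator A x / measure M A \<partial>M)"
    by (simp add: mult.commute)
  finally show ?thesis by simp
qed

locale walkers =
  fixes P :: "'a measure" and N :: nat and u :: "nat \<Rightarrow> int" and V :: "nat \<Rightarrow> nat \<Rightarrow> 'a \<Rightarrow> int"
  assumes srws: "srws P N u V" and N: "1 \<le> N"
begin

sublocale prob_space P using srws by (simp add: srws_def)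

definition incr :: "nat \<times> nat \<Rightarrow> 'a \<Rightarrow> int" where
  "incr = (\<lambda>(j, t) \<omega>. V j (Suc t) \<omega> - V j t \<omega>)"

lemma indep_incr: "indep_vars (\<lambda>_. count_space UNIV) incr ({1..N} \<times> UNIV)"
  using srws by (simp add: srws_def incr_def)

lemma incr_measurable: "j \<in> {1..N} \<Longrightarrow> incr (j, t) \<in> measurable P (count_space UNIV)"
  using indep_incr by (auto simp: indep_vars_def)

lemma prob_incr:
  assumes "j \<in> {1..N}" "y \<in> {-1, 1}"
  shows "prob (incr (j, t) -` {y} \<inter> space P) = 1 / 2"
proof -
  have d: "distr P (count_space UNIV) (incr (j, t)) = measure_pmf (pmf_of_set {-1, 1})"
    using srws assms by (simp add: srws_def incr_def)
  have "prob (incr (j, t) -` {y} \<inter> space P) = measure (distr P (count_space UNIV) (incr (j, t))) {y}"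
    by (rule measure_distr[symmetric]) (use incr_measurable assms in auto)
  also have "\<dots> = 1 / 2" unfolding d using assms by (auto simp: measure_pmf_single pmf_of_set)
  finally show ?thesis .
qed

lemma V_0: "j \<in> {1..N} \<Longrightarrow> \<omega> \<in> space P \<Longrightarrow> V j 0 \<omega> = u j"
  using srws by (simp add: srws_def)

lemma V_eq_sum: "j \<in> {1..N} \<Longrightarrow> \<omega> \<in> space P \<Longrightarrow> V j t \<omega> = u j + (\<Sum>s<t. incr (j, s) \<omega>)"
  by (induction t) (simp_all add: V_0, simp add: incr_def)

lemma V_measurable:
  assumes j: "j \<in> {1..N}" shows "V j t \<in> measurable P (count_space UNIV)"
proof (induction t)
  case 0
  have "V j 0 \<in> measurable P (count_space UNIV) \<longleftrightarrow> (\<lambda>_. u j) \<in> measurable P (count_space UNIV)"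
    by (rule measurable_cong) (rule V_0[OF j])
  then show ?case by simp
next
  case (Suc t)
  have [measurable]: "incr (j, t) \<in> measurable P (count_space UNIV)" by (rule incr_measurable[OF j])
  note [measurable] = Suc
  have "(\<lambda>\<omega>. V j t \<omega> + incr (j, t) \<omega>) \<in> measurable P (count_space UNIV)" by measurable
  then show ?case by (simp add: incr_def)
qed

definition path_event :: "nat \<Rightarrow> (nat \<Rightarrow> nat \<Rightarrow> int) \<Rightarrow> 'a set" where
  "path_event n e = {\<omega> \<in> space P. \<forall>t<n. \<forall>i\<in>{1..N}. incr (i, t) \<omega> = e t i}"

lemma path_event_eq: "n > 0 \<Longrightarrow> path_event n e = (\<Inter>j\<in>{1..N} \<times> {..<n}. incr j -` {e (snd j) (fst j)} \<inter> space P)"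
  using N by (auto simp: path_event_def)

lemma prob_path_event:
  assumes e: "e \<in> step_seqs N n"
  shows "path_event n e \<in> events" "prob (path_event n e) = 1 / 2 ^ (N * n)"
proof -
  have "path_event n e \<in> events \<and> prob (path_event n e) = 1 / 2 ^ (N * n)"
  proof (cases "n = 0")
    case True
    then show ?thesis by (simp add: path_event_def prob_space)
  next
    case False
    have ne: "{1..N} \<times> {..<n} \<noteq> {}" using N False by auto
    have "prob (path_event n e) = (\<Prod>j\<in>{1..N} \<times> {..<n}. prob (incr j -` {e (snd j) (fst j)} \<inter> space P))"
      using False unfolding path_event_eq[OF False[unfolded neq0_conv]]
      by (intro indep_varsD[OF indep_incr ne]) auto
    also have "\<dots> = (\<Prod>j\<in>{1..N} \<times> {..<n}. 1 / 2)"
    proof (intro prod.cong refl)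
      fix j assume j: "j \<in> {1..N} \<times> {..<n}"
      then have "e (snd j) (fst j) \<in> {-1, 1}" by (intro step_seqs_D(1)[OF e]) auto
      moreover have "fst j \<in> {1..N}" using j by auto
      ultimately show "prob (incr j -` {e (snd j) (fst j)} \<inter> space P) = 1 / 2"
        using prob_incr[of "fst j" "e (snd j) (fst j)" "snd j"] by simp
    qed
    also have "\<dots> = 1 / 2 ^ (N * n)" by (simp add: power_one_over)
    finally have "prob (path_event n e) = 1 / 2 ^ (N * n)" .
    moreover have "path_event n e \<in> events"
      unfolding path_event_eq[OF False[unfolded neq0_conv]]
    proof (intro sets.finite_INT ne)
      fix j assume j: "j \<in> {1..N} \<times> {..<n}"
      then have "incr (fst j, snd j) \<in> measurable P (count_space UNIV)" by (intro incr_measurable) auto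
      then show "incr j -` {e (snd j) (fst j)} \<inter> space P \<in> events" by (auto intro: measurable_sets)
    qed simp
    ultimately show ?thesis by simp
  qed
  then show "path_event n e \<in> events" "prob (path_event n e) = 1 / 2 ^ (N * n)" by auto
qed

lemma path_event_disjoint:
  assumes "e \<in> step_seqs N n" "e' \<in> step_seqs N n" "\<omega> \<in> path_event n e" "\<omega> \<in> path_event n e'"
  shows "e = e'"
proof
  fix t
  show "e t = e' t"
  proof (cases "t < n")
    case True
    show ?thesis
    proof
      fix i
      show "e t i = e' t i"
      proof (cases "i \<in> {1..N}")
        case i: True
        then show ?thesis using assms(3,4) True by (simp add: path_event_def)
      next
        case False
        show ?thesis
          by (rule trans[OF step_seqs_D(2)[OF assms(1) True False] step_seqs_D(2)[OF assms(2) True False, symmetric]])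
      qed
    qed
  next
    case False
    show ?thesis
      by (rule trans[OF step_seqs_D(3)[OF assms(1) False] step_seqs_D(3)[OF assms(2) False, symmetric]])
  qed
qed

text \<open>There are 2^(N n) disjoint path events, each of probability 2^(-N n).\<close>

lemma AE_path_event: "AE \<omega> in P. \<exists>e\<in>step_seqs N n. \<omega> \<in> path_event n e"
proof -
  have "prob (\<Union>e\<in>step_seqs N n. path_event n e) = (\<Sum>e\<in>step_seqs N n. prob (path_event n e))"
    using prob_path_event path_event_disjoint
    by (intro finite_measure_finite_Union) (auto simp: disjoint_family_on_def)
  also have "\<dots> = 1" by (simp add: prob_path_event card_step_seqs)
  finally have "AE \<omega> in P. \<omega> \<in> (\<Union>e\<in>step_seqs N n. path_event n e)"
    using prob_path_event by (intro prob_eq_1[THEN iffD1] sets.finite_UN) auto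
  then show ?thesis by eventually_elim auto
qed

definition local_to :: "nat \<Rightarrow> ((nat \<Rightarrow> nat \<Rightarrow> int) \<Rightarrow> real) \<Rightarrow> bool" where
  "local_to n F \<longleftrightarrow> (\<forall>w w'. (\<forall>t\<le>n. \<forall>i\<in>{1..N}. w t i = w' t i) \<longrightarrow> F w = F w')"

abbreviation positions :: "'a \<Rightarrow> nat \<Rightarrow> nat \<Rightarrow> int" where
  "positions \<omega> \<equiv> (\<lambda>t i. V i t \<omega>)"

text \<open>Increments are 1 or -1 only almost surely, so the finitely many path events may miss
  part of \<open>space P\<close>. Instead the preimage is a countable union of events that fix
  finitely many integer coordinates.\<close>

lemma local_to_measurable:
  assumes F: "local_to n F" shows "(\<lambda>\<omega>. F (positions \<omega>)) \<in> borel_measurable P"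
proof (rule measurableI)
  fix B :: "real set" assume "B \<in> sets borel"
  define Y where "Y = ({1..N} \<times> {..n}) \<rightarrow>\<^sub>E (UNIV :: int set)"
  define A where "A = {y \<in> Y. F (\<lambda>t i. y (i, t)) \<in> B}"
  have Y: "countable Y" unfolding Y_def by (intro countable_PiE) auto
  have "(\<lambda>\<omega>. F (positions \<omega>)) -` B \<inter> space P = (\<Union>y\<in>A. {\<omega> \<in> space P. \<forall>d\<in>{1..N} \<times> {..n}. V (fst d) (snd d) \<omega> = y d})"
  proof safe
    fix \<omega> assume \<omega>: "\<omega> \<in> space P" "F (positions \<omega>) \<in> B"
    let ?y = "\<lambda>d\<in>{1..N} \<times> {..n}. V (fst d) (snd d) \<omega>"
    have "F (positions \<omega>) = F (\<lambda>t i. ?y (i, t))"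
      using F[unfolded local_to_def, rule_format, of "positions \<omega>" "\<lambda>t i. ?y (i, t)"] by simp
    then have "?y \<in> A" using \<omega> by (auto simp: A_def Y_def)
    then show "\<omega> \<in> (\<Union>y\<in>A. {\<omega> \<in> space P. \<forall>d\<in>{1..N} \<times> {..n}. V (fst d) (snd d) \<omega> = y d})"
      using \<omega> by (intro UN_I[of ?y]) auto
  next
    fix \<omega> y assume y: "y \<in> A" and eq: "\<forall>d\<in>{1..N} \<times> {..n}. V (fst d) (snd d) \<omega> = y d"
    have "F (positions \<omega>) = F (\<lambda>t i. y (i, t))"
      by (rule F[unfolded local_to_def, rule_format]) (use eq in auto)
    then show "\<omega> \<in> (\<lambda>\<omega>. F (positions \<omega>)) -` B" using y by (simp add: A_def)
  qed
  also have "\<dots> \<in> events"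
  proof (rule sets.countable_UN')
    show "countable A" by (rule countable_subset[OF _ Y]) (auto simp: A_def)
    show "(\<lambda>y. {\<omega> \<in> space P. \<forall>d\<in>{1..N} \<times> {..n}. V (fst d) (snd d) \<omega> = y d}) ` A \<subseteq> events"
    proof safe
      fix y
      have "{\<omega> \<in> space P. \<forall>d\<in>{1..N} \<times> {..n}. V (fst d) (snd d) \<omega> = y d}
        = (\<Inter>d\<in>{1..N} \<times> {..n}. V (fst d) (snd d) -` {y d} \<inter> space P)"
        using N by auto
      also have "\<dots> \<in> events"
      proof (intro sets.finite_INT)
        fix d assume "d \<in> {1..N} \<times> {..n}"
        then have "V (fst d) (snd d) \<in> measurable P (count_space UNIV)" by (intro V_measurable) auto
        then show "V (fst d) (snd d) -` {y d} \<inter> space P \<in> events" by (auto intro: measurable_sets)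
      qed (use N in auto)
      finally show "{\<omega> \<in> space P. \<forall>d\<in>{1..N} \<times> {..n}. V (fst d) (snd d) \<omega> = y d} \<in> events" .
    qed
  qed
  finally show "(\<lambda>\<omega>. F (positions \<omega>)) -` B \<inter> space P \<in> events" .
qed simp

text \<open>The path events are disjoint, equally likely and cover almost every outcome, and on each
  of them the positions up to time \<open>n\<close> are those of the corresponding
  \<open>walk\<close>.\<close>

lemma expectation_positions:
  assumes F: "local_to n F"
  shows "expectation (\<lambda>\<omega>. F (positions \<omega>)) = wexp N u n F"
proof -
  have "expectation (\<lambda>\<omega>. F (positions \<omega>)) = expectation (\<lambda>\<omega>. \<Sum>e\<in>step_seqs N n. F (walk u e) * indicator (path_event n e) \<omega>)"
  proof (rule integral_cong_AE)
    show "AE \<omega> in P. F (positions \<omega>) = (\<Sum>e\<in>step_seqs N n. F (walk u e) * indicator (path_event n e) \<omega>)"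
      using AE_path_event[of n] AE_space
    proof eventually_elim
      case (elim \<omega>)
      then obtain e where e: "e \<in> step_seqs N n" "\<omega> \<in> path_event n e" by blast
      have "(\<Sum>e\<in>step_seqs N n. F (walk u e) * indicator (path_event n e) \<omega>) = (\<Sum>e\<in>{e}. F (walk u e) * indicator (path_event n e) \<omega>)"
      proof (intro sum.mono_neutral_right ballI)
        fix e' assume e': "e' \<in> step_seqs N n - {e}"
        then have "\<omega> \<notin> path_event n e'" using path_event_disjoint[OF _ e(1) _ e(2), of e'] by blast
        then show "F (walk u e') * indicator (path_event n e') \<omega> = 0" by simp
      qed (use e(1) in simp_all)
      also have "\<dots> = F (walk u e)" using e by simp
      also have "\<dots> = F (positions \<omega>)"
      proof (rule F[unfolded local_to_def, rule_format])
        fix t i assume t: "t \<le> n" and i: "i \<in> {1..N}"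
        have "(\<Sum>s<t. incr (i, s) \<omega>) = (\<Sum>s<t. e s i)"
          using e(2) t i by (intro sum.cong refl) (auto simp: path_event_def)
        then show "walk u e t i = V i t \<omega>" unfolding walk_def V_eq_sum[OF i elim(2)] by simp
      qed
      finally show ?case ..
    qed
    show "(\<lambda>\<omega>. \<Sum>e\<in>step_seqs N n. F (walk u e) * indicator (path_event n e) \<omega>) \<in> borel_measurable P"
      by (intro borel_measurable_sum borel_measurable_times borel_measurable_const borel_measurable_indicator prob_path_event(1))
  qed (rule local_to_measurable[OF F])
  also have "\<dots> = (\<Sum>e\<in>step_seqs N n. expectation (\<lambda>\<omega>. F (walk u e) * indicator (path_event n e) \<omega>))"
    using prob_path_event(1) by (intro Bochner_Integration.integral_sum integrable_mult_right integrable_real_indicator) (auto simp: emeasure_eq_measure)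
  also have "\<dots> = (\<Sum>e\<in>step_seqs N n. F (walk u e) / 2 ^ (N * n))"
    using prob_path_event by (intro sum.cong refl) (simp add: Int_absorb2 sets.sets_into_space)
  finally show ?thesis by (simp add: wexp_def sum_divide_distrib)
qed

lemma exit_time_iff: "enat n < exit_time N V \<omega> \<longleftrightarrow> noncolliding N n (positions \<omega>)"
proof -
  let ?A = "{t. 1 \<le> t \<and> restrict (\<lambda>j. V j t \<omega>) {1..N} \<notin> weyl N}"
  have weyl: "restrict (\<lambda>j. V j t \<omega>) {1..N} \<in> weyl N \<longleftrightarrow> strict_mono_on {1..N} (positions \<omega> t)" for t
    by (auto simp: weyl_def strict_mono_on_def)
  have "enat n < exit_time N V \<omega> \<longleftrightarrow> \<not> (\<exists>t\<in>?A. t \<le> n)"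
  proof
    assume less: "enat n < exit_time N V \<omega>"
    show "\<not> (\<exists>t\<in>?A. t \<le> n)"
    proof
      assume "\<exists>t\<in>?A. t \<le> n"
      then obtain t where "t \<in> ?A" "t \<le> n" by blast
      then have "exit_time N V \<omega> \<le> enat t" unfolding exit_time_def by (intro Inf_lower) auto
      also have "\<dots> \<le> enat n" using \<open>t \<le> n\<close> by simp
      finally show False using less by simp
    qed
  next
    assume "\<not> (\<exists>t\<in>?A. t \<le> n)"
    then have "enat (Suc n) \<le> exit_time N V \<omega>" unfolding exit_time_def by (intro Inf_greatest) auto
    then show "enat n < exit_time N V \<omega>" by (rule less_le_trans[rotated]) simp
  qed
  also have "\<dots> \<longleftrightarrow> noncolliding N n (positions \<omega>)"
    unfolding noncolliding_def using weyl by auto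
  finally show ?thesis .
qed

definition conf :: "(nat \<Rightarrow> nat \<Rightarrow> int) \<Rightarrow> nat \<Rightarrow> int multiset" where
  "conf w t = image_mset (w t) (mset_set {1..N})"

lemma config_eq: "config N V \<omega> = conf (positions \<omega>)"
  by (simp add: config_def conf_def fun_eq_iff)

lemma local_to_conf:
  assumes "\<And>X Y. (\<forall>t\<le>T. X t = Y t) \<Longrightarrow> F X = F Y" "T \<le> n"
  shows "local_to n (\<lambda>w. F (conf w))"
  unfolding local_to_def
proof (intro allI impI assms(1))
  fix w w' :: "nat \<Rightarrow> nat \<Rightarrow> int" and t assume "\<forall>t\<le>n. \<forall>i\<in>{1..N}. w t i = w' t i" "t \<le> T"
  then show "conf w t = conf w' t" unfolding conf_def using assms(2) by (intro image_mset_cong) auto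
qed

lemma local_to_noncolliding: "local_to n (\<lambda>w. of_bool (noncolliding N n w))"
  unfolding local_to_def noncolliding_def strict_mono_on_def
  by (intro allI impI arg_cong[where f=of_bool] ball_cong refl all_cong) auto

lemma cond_expect_eq:
  assumes F: "\<And>X Y. (\<forall>t\<le>T. X t = Y t) \<Longrightarrow> F X = F Y" "T \<le> n"
    and pos: "wexp N u n (\<lambda>w. of_bool (noncolliding N n w)) > 0"
  shows "cond_expect P N V F n = wexp N u n (\<lambda>w. F (conf w) * of_bool (noncolliding N n w)) / wexp N u n (\<lambda>w. of_bool (noncolliding N n w))"
proof -
  let ?A = "{\<omega> \<in> space P. enat n < exit_time N V \<omega>}"
  have A: "?A \<in> events"
  proof -
    have "(\<lambda>\<omega>. of_bool (noncolliding N n (positions \<omega>)) :: real) -` {1} \<inter> space P \<in> events"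
      by (rule measurable_sets[OF local_to_measurable[OF local_to_noncolliding]]) simp
    also have "(\<lambda>\<omega>. of_bool (noncolliding N n (positions \<omega>)) :: real) -` {1} \<inter> space P = ?A"
      by (auto simp: exit_time_iff)
    finally show ?thesis .
  qed
  have ind: "indicator ?A \<omega> = (of_bool (noncolliding N n (positions \<omega>)) :: real)" if "\<omega> \<in> space P" for \<omega>
    using that by (auto simp: exit_time_iff indicator_def)
  have "prob ?A = expectation (indicator ?A)" using A by simp
  also have "\<dots> = expectation (\<lambda>\<omega>. of_bool (noncolliding N n (positions \<omega>)))"
    by (rule Bochner_Integration.integral_cong) (simp_all add: ind)
  also have "\<dots> = wexp N u n (\<lambda>w. of_bool (noncolliding N n w))"
    by (rule expectation_positions[OF local_to_noncolliding])
  finally have prob: "prob ?A = wexp N u n (\<lambda>w. of_bool (noncolliding N n w))" .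
  have lF: "local_to n (\<lambda>w. F (conf w))" by (rule local_to_conf[OF F])
  have "cond_expect P N V F n = expectation (\<lambda>\<omega>. F (config N V \<omega>) * indicator ?A \<omega>) / prob ?A"
    unfolding cond_expect_def
    by (intro integral_uniform_measure A finite_measure_axioms)
       (use pos prob local_to_measurable[OF lF] in \<open>simp_all add: config_eq\<close>)
  also have "expectation (\<lambda>\<omega>. F (config N V \<omega>) * indicator ?A \<omega>) = expectation (\<lambda>\<omega>. F (conf (positions \<omega>)) * of_bool (noncolliding N n (positions \<omega>)))"
    by (rule Bochner_Integration.integral_cong) (simp_all add: ind config_eq)
  also have "\<dots> = wexp N u n (\<lambda>w. F (conf w) * of_bool (noncolliding N n w))"
  proof (rule expectation_positions)
    show "local_to n (\<lambda>w. F (conf w) * of_bool (noncolliding N n w))"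
      using lF local_to_noncolliding[of n] unfolding local_to_def by metis
  qed
  finally show ?thesis unfolding prob .
qed

end

section \<open>Fredholm expansion of exponential moments\<close>

lemma sdet_scale_rows: "sdet I (\<lambda>i j. c i * A i j) = (\<Prod>i\<in>I. c i) * sdet I A"
  by (simp add: sdet_def prod.distrib sum_distrib_left mult_ac)

fun pullback :: "(nat \<Rightarrow> int \<Rightarrow> real) \<Rightarrow> nat \<Rightarrow> (int \<Rightarrow> real) \<Rightarrow> int \<Rightarrow> real" where
  "pullback \<phi> 0 g = g"
| "pullback \<phi> (Suc T) g = pullback \<phi> T (avg1 (\<lambda>x. \<phi> (Suc T) x * g x))"

text \<open>Going back one step, the weights at the latest time are row factors of the determinant
  and enter its column functions; the result is alternating, so the collision constraint drops out,
  and averaging the independent rows averages each column function.\<close>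

lemma wexp_prod_sdet:
  assumes u: "strict_mono_on {1..N} u" "\<forall>j\<in>{1..N}. even (u j)"
  shows "wexp N u T (\<lambda>w. (\<Prod>t\<in>{1..T}. \<Prod>i\<in>{1..N}. \<phi> t (w t i)) * of_bool (noncolliding N T w) * sdet {1..N} (\<lambda>i j. g j (w T i)))
    = sdet {1..N} (\<lambda>i j. pullback \<phi> T (g j) (u i))"
proof (induction T arbitrary: g)
  case 0
  show ?case by (subst wexp_0) (auto simp: noncolliding_def)
next
  case (Suc T)
  let ?g = "\<lambda>j x. \<phi> (Suc T) x * g j x"
  let ?F = "\<lambda>w. \<Prod>t\<in>{1..T}. \<Prod>i\<in>{1..N}. \<phi> t (w t i)"
  have "wexp N u (Suc T) (\<lambda>w. (\<Prod>t\<in>{1..Suc T}. \<Prod>i\<in>{1..N}. \<phi> t (w t i)) * of_bool (noncolliding N (Suc T) w) * sdet {1..N} (\<lambda>i j. g j (w (Suc T) i)))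
    = wexp N u (Suc T) (\<lambda>w. ?F w * of_bool (noncolliding N (Suc T) w) * sdet {1..N} (\<lambda>i j. ?g j (w (Suc T) i)))"
    unfolding sdet_scale_rows by (rule wexp_cong) (simp add: mult_ac)
  also have "\<dots> = wexp N u T (\<lambda>w. ?F w * of_bool (noncolliding N T w) * avg N (\<lambda>x. sdet {1..N} (\<lambda>i j. ?g j (x i))) (w T))"
    by (rule wexp_noncolliding_Suc[OF u _ alternating_sdet]) (auto intro!: prod.cong)
  also have "\<dots> = wexp N u T (\<lambda>w. ?F w * of_bool (noncolliding N T w) * sdet {1..N} (\<lambda>i j. avg1 (?g j) (w T i)))"
    unfolding avg_sdet[where f = ?g] ..
  also have "\<dots> = sdet {1..N} (\<lambda>i j. pullback \<phi> T (avg1 (?g j)) (u i))"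
    by (rule Suc.IH)
  finally show ?case by simp
qed

lemma trans_prob_eq: "trans_prob n y x = (avg1 ^^ n) (\<lambda>z. of_bool (z = y)) x"
proof -
  have "(\<Sum>c\<le>n. real (n choose c) * of_bool (x + 2 * int c - int n = y)) = 2 ^ n * trans_prob n y x"
  proof (cases "\<bar>y - x\<bar> \<le> int n \<and> even (int n + y - x)")
    case True
    then obtain k where k: "int n + y - x = 2 * k" by blast
    have k0: "0 \<le> k" "k \<le> int n" using True k by auto
    have "(\<Sum>c\<le>n. real (n choose c) * of_bool (x + 2 * int c - int n = y)) = (\<Sum>c\<in>{nat k}. real (n choose c))"
      by (rule sum.mono_neutral_cong_right) (use k k0 in auto)
    then show ?thesis using True k by (simp add: trans_prob_def power_one_over)
  next
    case False
    have "(\<Sum>c\<le>n. real (n choose c) * of_bool (x + 2 * int c - int n = y)) = 0"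
      by (rule sum.neutral) (use False in auto)
    then show ?thesis using False by (auto simp: trans_prob_def)
  qed
  then show ?thesis by (simp add: avg1_funpow)
qed

lemma avg1_funpow_finite_support:
  assumes A: "finite A" and g: "\<And>y. y \<notin> A \<Longrightarrow> g y = 0"
  shows "(avg1 ^^ n) g x = (\<Sum>y\<in>A. trans_prob n y x * g y)"
proof -
  have "g z = (\<Sum>y\<in>A. g y * of_bool (z = y))" for z
  proof (cases "z \<in> A")
    case True
    then have "(\<Sum>y\<in>A. g y * of_bool (z = y)) = (\<Sum>y\<in>{z}. g y * of_bool (z = y))"
      using A by (intro sum.mono_neutral_right) auto
    then show ?thesis by simp
  next
    case False
    then have "(\<Sum>y\<in>A. g y * of_bool (z = y)) = 0" by (intro sum.neutral) auto
    then show ?thesis using g False by simp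
  qed
  then have "(avg1 ^^ n) g x = (\<Sum>c\<le>n. real (n choose c) * (\<Sum>y\<in>A. g y * of_bool (x + 2 * int c - int n = y))) / 2 ^ n"
    unfolding avg1_funpow by metis
  also have "\<dots> = (\<Sum>y\<in>A. (\<Sum>c\<le>n. real (n choose c) * of_bool (x + 2 * int c - int n = y)) / 2 ^ n * g y)"
    unfolding sum_distrib_left sum_divide_distrib sum_distrib_right
    by (subst sum.swap) (simp add: mult_ac)
  finally show ?thesis by (simp add: trans_prob_eq avg1_funpow)
qed

lemma avg1_sum: "avg1 (\<lambda>x. \<Sum>j\<in>J. f j x) x = (\<Sum>j\<in>J. avg1 (f j) x)"
  by (simp add: avg1_def sum.distrib sum_divide_distrib[symmetric])


section \<open>Elimination over space-time points by Sylvester's identity\<close>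

locale martingale_functions =
  fixes N :: nat and u :: "nat \<Rightarrow> int" and m :: "nat \<Rightarrow> nat \<Rightarrow> int \<Rightarrow> real"
  assumes N: "1 \<le> N" and u: "strict_mono_on {1..N} u" and u_even: "\<forall>j\<in>{1..N}. even (u j)"
    and m_avg1: "\<And>j t y. avg1 (m j (Suc t)) y = m j t y"
    and m_0: "\<And>i j. i \<in> {1..N} \<Longrightarrow> j \<in> {1..N} \<Longrightarrow> m j 0 (u i) = of_bool (i = j)"
    and m_det: "\<And>t y. sdet {1..N} (\<lambda>i j. m j t (y i)) * vandermonde N (\<lambda>i. of_int (u i)) = vandermonde N (\<lambda>i. of_int (y i))"
begin

definition rkernel :: "nat \<times> int \<Rightarrow> nat \<times> int \<Rightarrow> real" where
  "rkernel a b = (\<Sum>j=1..N. trans_prob (fst a) (snd a) (u j) * m j (fst b) (snd b))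
     - (if fst a > fst b then trans_prob (fst a - fst b) (snd a) (snd b) else 0)"

text \<open>The recursion counts the distance \<open>d\<close> from the final time \<open>T\<close>,
  since it starts from the martingale function there; by \<open>back_rev_back\<close> the remaining
  pullback from time \<open>T - d\<close> always yields the same function.\<close>

fun rev_back :: "(nat \<Rightarrow> int \<Rightarrow> real) \<Rightarrow> nat \<Rightarrow> nat \<Rightarrow> nat \<Rightarrow> int \<Rightarrow> real" where
  "rev_back \<phi> T j 0 = m j T"
| "rev_back \<phi> T j (Suc d) = avg1 (\<lambda>x. \<phi> (T - d) x * rev_back \<phi> T j d x)"

lemma back_rev_back: "d \<le> T \<Longrightarrow> pullback \<phi> (T - d) (rev_back \<phi> T j d) = pullback \<phi> T (m j T)"
proof (induction d)
  case (Suc d)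
  have "Suc (T - Suc d) = T - d" using Suc.prems by simp
  then have "pullback \<phi> (T - d) (rev_back \<phi> T j d) = pullback \<phi> (T - Suc d) (avg1 (\<lambda>x. \<phi> (T - d) x * rev_back \<phi> T j d x))"
    by (metis pullback.simps(2))
  then show ?case using Suc by simp
qed simp

context
  fixes T :: nat and S :: "(nat \<times> int) set" and \<psi> :: "nat \<Rightarrow> int \<Rightarrow> real"
  assumes S: "finite S" "\<And>a. a \<in> S \<Longrightarrow> 1 \<le> fst a \<and> fst a \<le> T"
    and \<psi>: "\<And>s x. (s, x) \<notin> S \<Longrightarrow> \<psi> s x = 0"
begin

definition bf :: "nat \<Rightarrow> nat \<Rightarrow> int \<Rightarrow> real" where
  "bf j s = rev_back (\<lambda>t x. 1 + \<psi> t x) T j (T - s)"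

lemma bf_T: "bf j T = m j T" by (simp add: bf_def)

lemma bf_step: "s < T \<Longrightarrow> bf j s = avg1 (\<lambda>x. (1 + \<psi> (Suc s) x) * bf j (Suc s) x)"
proof -
  assume "s < T"
  then have *: "T - s = Suc (T - Suc s)" "T - (T - Suc s) = Suc s" by auto
  show ?thesis unfolding bf_def *(1) rev_back.simps *(2) ..
qed

lemma back_eq_bf: "pullback (\<lambda>t x. 1 + \<psi> t x) T (m j T) = bf j 0"
  using back_rev_back[of T T "\<lambda>t x. 1 + \<psi> t x" j] by (simp add: bf_def)

text \<open>A discrete Duhamel formula: at each time the factor \<open>1 + \<psi>\<close> splits
  into free evolution and a source. The martingale property carries \<open>m j T\<close> back to
  \<open>m j s\<close>, and the source at time \<open>t\<close> is averaged over
  \<open>t - s\<close> steps.\<close>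

lemma bf_expand:
  assumes "s \<le> T"
  shows "bf j s x = m j s x + (\<Sum>t\<in>{s<..T}. (avg1 ^^ (t - s)) (\<lambda>y. \<psi> t y * bf j t y) x)"
  using assms
proof (induction s arbitrary: x rule: inc_induct)
  case base
  show ?case by (simp add: bf_T)
next
  case (step s)
  let ?h = "\<lambda>t y. \<psi> t y * bf j t y"
  have "bf j s x = avg1 (\<lambda>x. (m j (Suc s) x + (\<Sum>t\<in>{Suc s<..T}. (avg1 ^^ (t - Suc s)) (?h t) x)) + ?h (Suc s) x) x"
    unfolding bf_step[OF step.hyps(2)] step.IH[symmetric] by (simp add: algebra_simps)
  also have "\<dots> = avg1 (m j (Suc s)) x + (\<Sum>t\<in>{Suc s<..T}. avg1 ((avg1 ^^ (t - Suc s)) (?h t)) x) + avg1 (?h (Suc s)) x"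
    unfolding avg1_sum[symmetric] by (simp add: avg1_def add_divide_distrib)
  also have "(\<Sum>t\<in>{Suc s<..T}. avg1 ((avg1 ^^ (t - Suc s)) (?h t)) x) = (\<Sum>t\<in>{Suc s<..T}. (avg1 ^^ (t - s)) (?h t) x)"
  proof (intro sum.cong refl)
    fix t assume "t \<in> {Suc s<..T}"
    then have "t - s = Suc (t - Suc s)" by auto
    then show "avg1 ((avg1 ^^ (t - Suc s)) (?h t)) x = (avg1 ^^ (t - s)) (?h t) x" by simp
  qed
  also have "avg1 (?h (Suc s)) x = (avg1 ^^ (Suc s - s)) (?h (Suc s)) x" by simp
  finally have "bf j s x = m j s x + ((avg1 ^^ (Suc s - s)) (?h (Suc s)) x + (\<Sum>t\<in>{Suc s<..T}. (avg1 ^^ (t - s)) (?h t) x))"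
    unfolding m_avg1 by simp
  also have "(avg1 ^^ (Suc s - s)) (?h (Suc s)) x + (\<Sum>t\<in>{Suc s<..T}. (avg1 ^^ (t - s)) (?h t) x) = (\<Sum>t\<in>insert (Suc s) {Suc s<..T}. (avg1 ^^ (t - s)) (?h t) x)"
    by (rule sum.insert[symmetric]) auto
  also have "insert (Suc s) {Suc s<..T} = {s<..T}" using step.hyps by auto
  finally show ?case .
qed

text \<open>With the sources written as a sum over \<open>S\<close>, this is a linear system for the
  values of \<open>bf\<close> at the points of \<open>S\<close>; at \<open>s = 0\<close> it
  expresses the values at the starting points through them.\<close>

lemma bf_expand_points:
  assumes "s \<le> T"
  shows "bf j s x = m j s x + (\<Sum>b\<in>S. of_bool (s < fst b) * trans_prob (fst b - s) (snd b) x * \<psi> (fst b) (snd b) * bf j (fst b) (snd b))"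
proof -
  have fin: "finite {y. (t, y) \<in> S}" for t
    by (rule finite_subset[OF _ finite_imageI[OF S(1)], of _ snd]) (auto intro: rev_image_eqI)
  have "(\<Sum>t\<in>{s<..T}. (avg1 ^^ (t - s)) (\<lambda>y. \<psi> t y * bf j t y) x)
    = (\<Sum>t\<in>{s<..T}. \<Sum>y\<in>{y. (t, y) \<in> S}. trans_prob (t - s) y x * (\<psi> t y * bf j t y))"
  proof (rule sum.cong[OF refl], rule avg1_funpow_finite_support[OF fin])
    fix t y assume "y \<notin> {y. (t, y) \<in> S}"
    then show "\<psi> t y * bf j t y = 0" by (simp add: \<psi>)
  qed
  also have "\<dots> = (\<Sum>(t, y)\<in>(SIGMA t:{s<..T}. {y. (t, y) \<in> S}). trans_prob (t - s) y x * (\<psi> t y * bf j t y))"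
    by (rule sum.Sigma) (simp_all add: fin)
  also have "(SIGMA t:{s<..T}. {y. (t, y) \<in> S}) = {b\<in>S. s < fst b}"
    using S(2) by auto
  also have "(\<Sum>(t, y)\<in>{b\<in>S. s < fst b}. trans_prob (t - s) y x * (\<psi> t y * bf j t y))
    = (\<Sum>b\<in>{b\<in>S. s < fst b}. trans_prob (fst b - s) (snd b) x * (\<psi> (fst b) (snd b) * bf j (fst b) (snd b)))"
    by (simp add: case_prod_unfold)
  also have "\<dots> = (\<Sum>b\<in>S. of_bool (s < fst b) * trans_prob (fst b - s) (snd b) x * \<psi> (fst b) (snd b) * bf j (fst b) (snd b))"
    by (subst sum.inter_filter[OF S(1)]) (auto intro!: sum.cong)
  finally show ?thesis unfolding bf_expand[OF assms] by simp
qed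

text \<open>In matrix terms F = G + U F on \<open>S\<close>, and the left side is det(1 + Q F) over
  the labels. Sylvester's identity moves it to det(1 + F Q) over \<open>S\<close>. Multiplication by
  1 - U, which has determinant 1, replaces F by G: (1 - U)(1 + F Q) = 1 - U + G Q, where G Q - U is
  the transposed kernel with columns scaled by \<open>c\<close>. Its principal minors give the
  expansion.\<close>

lemma sdet_bf_0:
  "sdet {1..N} (\<lambda>i j. bf j 0 (u i)) = (\<Sum>R\<in>Pow S. (\<Prod>a\<in>R. \<psi> (fst a) (snd a)) * sdet R rkernel)"
proof -
  define F where "F a j = bf j (fst a) (snd a)" for a j
  define G where "G a j = m j (fst a) (snd a)" for a j
  define c where "c a = \<psi> (fst a) (snd a)" for a
  define U where "U a b = of_bool (fst a < fst b) * trans_prob (fst b - fst a) (snd b) (snd a) * c b" for a b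
  define Q where "Q i b = trans_prob (fst b) (snd b) (u i) * c b" for i b
  have F: "F a j = G a j + (\<Sum>b\<in>S. U a b * F b j)" if "a \<in> S" for a j
    unfolding F_def G_def U_def c_def by (rule bf_expand_points) (use S(2)[OF that] in simp)
  have Z: "bf j 0 (u i) = of_bool (i = j) + (\<Sum>b\<in>S. Q i b * F b j)" if "i \<in> {1..N}" "j \<in> {1..N}" for i j
  proof -
    have "bf j 0 (u i) = m j 0 (u i) + (\<Sum>b\<in>S. of_bool (0 < fst b) * trans_prob (fst b - 0) (snd b) (u i) * \<psi> (fst b) (snd b) * bf j (fst b) (snd b))"
      by (rule bf_expand_points) simp
    also have "(\<Sum>b\<in>S. of_bool (0 < fst b) * trans_prob (fst b - 0) (snd b) (u i) * \<psi> (fst b) (snd b) * bf j (fst b) (snd b)) = (\<Sum>b\<in>S. Q i b * F b j)"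
    proof (intro sum.cong refl)
      fix b assume "b \<in> S"
      then have "0 < fst b" using S(2)[of b] by simp
      then show "of_bool (0 < fst b) * trans_prob (fst b - 0) (snd b) (u i) * \<psi> (fst b) (snd b) * bf j (fst b) (snd b) = Q i b * F b j"
        by (simp add: Q_def F_def c_def)
    qed
    finally show ?thesis unfolding m_0[OF that] .
  qed
  have "sdet {1..N} (\<lambda>i j. bf j 0 (u i)) = sdet {1..N} (\<lambda>i j. of_bool (i = j) + (\<Sum>b\<in>S. Q i b * F b j))"
    by (rule sdet_cong) (rule Z)
  also have "\<dots> = sdet S (\<lambda>a b. of_bool (a = b) + (\<Sum>i\<in>{1..N}. F a i * Q i b))"
    by (rule sdet_one_plus_mult_commute) (simp_all add: S)
  \<comment> \<open>A nonzero entry of \<open>U\<close> strictly raises the time, so 1 - U is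
    triangular with unit diagonal.\<close>
  also have "\<dots> = sdet S (\<lambda>a b. of_bool (a = b) - U a b) * sdet S (\<lambda>a b. of_bool (a = b) + (\<Sum>i\<in>{1..N}. F a i * Q i b))"
  proof -
    have "sdet S (\<lambda>a b. of_bool (a = b) - U a b) = (\<Prod>a\<in>S. of_bool (a = a) - U a a)"
      by (rule sdet_triangular[where r = fst]) (auto simp: S U_def)
    also have "\<dots> = 1" by (simp add: U_def)
    finally show ?thesis by simp
  qed
  also have "\<dots> = sdet S (\<lambda>a b. \<Sum>d\<in>S. (of_bool (a = d) - U a d) * (of_bool (d = b) + (\<Sum>i\<in>{1..N}. F d i * Q i b)))"
    by (rule sdet_mult[symmetric]) (rule S)
  also have "\<dots> = sdet S (\<lambda>a b. of_bool (a = b) + rkernel b a * c b)"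
  proof (rule sdet_cong)
    fix a b assume ab: "a \<in> S" "b \<in> S"
    have delta: "(\<Sum>d\<in>S. of_bool (a = d) * h d) = h a" for h :: "nat \<times> int \<Rightarrow> real"
    proof -
      have "(\<Sum>d\<in>S. of_bool (a = d) * h d) = (\<Sum>d\<in>{a}. of_bool (a = d) * h d)"
        using ab S by (intro sum.mono_neutral_right) auto
      then show ?thesis by simp
    qed
    have delta': "(\<Sum>d\<in>S. U a d * of_bool (d = b)) = U a b"
    proof -
      have "(\<Sum>d\<in>S. U a d * of_bool (d = b)) = (\<Sum>d\<in>{b}. U a d * of_bool (d = b))"
        using ab S by (intro sum.mono_neutral_right) auto
      then show ?thesis by simp
    qed
    have "(\<Sum>d\<in>S. (of_bool (a = d) - U a d) * (of_bool (d = b) + (\<Sum>i\<in>{1..N}. F d i * Q i b)))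
      = (\<Sum>d\<in>S. of_bool (a = d) * (of_bool (d = b) + (\<Sum>i\<in>{1..N}. F d i * Q i b)))
        - ((\<Sum>d\<in>S. U a d * of_bool (d = b)) + (\<Sum>d\<in>S. \<Sum>i\<in>{1..N}. U a d * F d i * Q i b))"
      unfolding sum.distrib[symmetric] sum_subtractf[symmetric]
      by (intro sum.cong refl) (simp add: left_diff_distrib distrib_left sum_distrib_left sum_subtractf sum_negf mult.assoc)
    also have "\<dots> = of_bool (a = b) + (\<Sum>i\<in>{1..N}. F a i * Q i b) - (U a b + (\<Sum>d\<in>S. \<Sum>i\<in>{1..N}. U a d * F d i * Q i b))"
      unfolding delta delta' ..
    \<comment> \<open>Here U F = F - G enters; in the next line all occurrences of \<open>F\<close>
      cancel.\<close>
    also have "(\<Sum>d\<in>S. \<Sum>i\<in>{1..N}. U a d * F d i * Q i b) = (\<Sum>i\<in>{1..N}. (F a i - G a i) * Q i b)"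
      by (subst sum.swap) (simp add: F[OF ab(1)] sum_distrib_right)
    also have "of_bool (a = b) + (\<Sum>i\<in>{1..N}. F a i * Q i b) - (U a b + (\<Sum>i\<in>{1..N}. (F a i - G a i) * Q i b)) = of_bool (a = b) + ((\<Sum>i\<in>{1..N}. G a i * Q i b) - U a b)"
      by (simp add: left_diff_distrib sum_subtractf)
    also have "(\<Sum>i\<in>{1..N}. G a i * Q i b) - U a b = rkernel b a * c b"
    proof -
      have "(\<Sum>i\<in>{1..N}. G a i * Q i b) = (\<Sum>j=1..N. trans_prob (fst b) (snd b) (u j) * m j (fst a) (snd a)) * c b"
        by (simp only: sum_distrib_right sum_distrib_left G_def Q_def mult_ac)
      then show ?thesis by (simp add: rkernel_def U_def left_diff_distrib)
    qed
    finally show "(\<Sum>d\<in>S. (of_bool (a = d) - U a d) * (of_bool (d = b) + (\<Sum>i\<in>{1..N}. F d i * Q i b))) = of_bool (a = b) + rkernel b a * c b" .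
  qed
  also have "\<dots> = (\<Sum>R\<in>Pow S. sdet R (\<lambda>a b. rkernel b a * c b))"
    by (rule sdet_one_plus_minors) (rule S)
  also have "\<dots> = (\<Sum>R\<in>Pow S. (\<Prod>a\<in>R. c a) * sdet R rkernel)"
  proof (intro sum.cong refl)
    fix R assume "R \<in> Pow S"
    then have R: "finite R" using S(1) by (auto intro: finite_subset)
    show "sdet R (\<lambda>a b. rkernel b a * c b) = (\<Prod>a\<in>R. c a) * sdet R rkernel"
      unfolding sdet_scale_columns[OF R] sdet_transpose[OF R, of rkernel] ..
  qed
  finally show ?thesis unfolding c_def .
qed

text \<open>The walkers only visit sites whose parity is that of the time, so the weight
  \<open>\<phi>\<close> may differ from \<open>1 + \<psi>\<close> at all other sites, and
  \<open>\<psi>\<close> can be taken to vanish there. By \<open>m_det\<close> the Vandermonde ratio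
  of the \<open>h\<close>-transform is a determinant of martingale functions.\<close>

lemma wexp_product_eq:
  assumes par: "\<And>s x. even (int s + x) \<Longrightarrow> s \<in> {1..T} \<Longrightarrow> \<phi> s x = 1 + \<psi> s x"
  shows "wexp N u T (\<lambda>w. (\<Prod>t\<in>{1..T}. \<Prod>i\<in>{1..N}. \<phi> t (w t i)) * of_bool (noncolliding N T w) * vandermonde N (\<lambda>i. of_int (w T i))) / vandermonde N (\<lambda>i. of_int (u i))
    = (\<Sum>R\<in>Pow S. (\<Prod>a\<in>R. \<psi> (fst a) (snd a)) * sdet R rkernel)"
proof -
  let ?h = "vandermonde N (\<lambda>i. of_int (u i)) :: real"
  have h: "?h > 0" using u by (intro vandermonde_pos) (auto simp: strict_mono_on_def)
  have "wexp N u T (\<lambda>w. (\<Prod>t\<in>{1..T}. \<Prod>i\<in>{1..N}. \<phi> t (w t i)) * of_bool (noncolliding N T w) * vandermonde N (\<lambda>i. of_int (w T i)))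
    = ?h * wexp N u T (\<lambda>w. (\<Prod>t\<in>{1..T}. \<Prod>i\<in>{1..N}. 1 + \<psi> t (w t i)) * of_bool (noncolliding N T w) * sdet {1..N} (\<lambda>i j. m j T (w T i)))"
    unfolding wexp_def times_divide_eq_right sum_distrib_left
  proof (intro arg_cong2[where f="(/)"] refl sum.cong)
    fix e assume e: "e \<in> step_seqs N T"
    have "(\<Prod>t\<in>{1..T}. \<Prod>i\<in>{1..N}. \<phi> t (walk u e t i)) = (\<Prod>t\<in>{1..T}. \<Prod>i\<in>{1..N}. 1 + \<psi> t (walk u e t i))"
    proof (intro prod.cong refl par)
      fix t i assume t: "t \<in> {1..T}" and i: "i \<in> {1..N}"
      have "even (walk u e t i - u i - int t)" using walk_parity(1)[OF e i, of t u] t by auto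
      moreover have "even (u i)" using u_even i by blast
      ultimately have "even ((walk u e t i - u i - int t) + u i + 2 * int t)" by (intro dvd_add) auto
      then show "even (int t + walk u e t i)" by (simp add: algebra_simps)
    qed
    then show "(\<Prod>t\<in>{1..T}. \<Prod>i\<in>{1..N}. \<phi> t (walk u e t i)) * of_bool (noncolliding N T (walk u e)) * vandermonde N (\<lambda>i. of_int (walk u e T i))
      = ?h * ((\<Prod>t\<in>{1..T}. \<Prod>i\<in>{1..N}. 1 + \<psi> t (walk u e t i)) * of_bool (noncolliding N T (walk u e)) * sdet {1..N} (\<lambda>i j. m j T (walk u e T i)))"
      unfolding m_det[of T "walk u e T", symmetric] by (simp only: mult_ac)
  qed
  also have "wexp N u T (\<lambda>w. (\<Prod>t\<in>{1..T}. \<Prod>i\<in>{1..N}. 1 + \<psi> t (w t i)) * of_bool (noncolliding N T w) * sdet {1..N} (\<lambda>i j. m j T (w T i)))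
     = sdet {1..N} (\<lambda>i j. pullback (\<lambda>t x. 1 + \<psi> t x) T (m j T) (u i))"
    by (rule wexp_prod_sdet[OF u u_even])
  also have "\<dots> = (\<Sum>R\<in>Pow S. (\<Prod>a\<in>R. \<psi> (fst a) (snd a)) * sdet R rkernel)"
    unfolding back_eq_bf by (rule sdet_bf_0)
  finally show ?thesis using h by simp
qed

end

end

section \<open>Ordered point vectors and finite sets of space-time points\<close>

definition enum_set :: "int set \<Rightarrow> nat \<Rightarrow> int" where
  "enum_set A = (\<lambda>j\<in>{1..card A}. sorted_list_of_set A ! (j - 1))"

lemma sorted_list_of_weyl:
  assumes x: "x \<in> weyl n" shows "sorted_list_of_set (x ` {1..n}) = map x [1..<Suc n]"
proof -
  have mono: "strict_mono_on {1..n} x" using x by (simp add: weyl_def)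
  have "sorted_wrt (<) (map x [1..<Suc n])"
    unfolding sorted_wrt_map
    by (rule sorted_wrt_mono_rel[OF _ sorted_wrt_upt]) (use mono in \<open>auto simp: strict_mono_on_def\<close>)
  moreover have "set (map x [1..<Suc n]) = x ` {1..n}" by (simp add: atLeastLessThanSuc_atLeastAtMost del: upt_Suc)
  ultimately show ?thesis
    by (metis finite_atLeastAtMost finite_imageI strict_sorted_equal sorted_list_of_set.strict_sorted_key_list_of_set set_sorted_list_of_set)
qed

lemma card_image_weyl: "x \<in> weyl n \<Longrightarrow> card (x ` {1..n}) = n"
  by (subst card_image) (auto simp: weyl_def intro: strict_mono_on_imp_inj_on)

lemma enum_set_weyl:
  assumes x: "x \<in> weyl n" shows "enum_set (x ` {1..n}) = x"
proof -
  have "x \<in> extensional {1..n}" using x by (simp add: weyl_def PiE_def)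
  moreover have "enum_set (x ` {1..n}) \<in> extensional {1..n}"
    unfolding enum_set_def card_image_weyl[OF x] by simp
  moreover have "enum_set (x ` {1..n}) j = x j" if "j \<in> {1..n}" for j
    using that unfolding enum_set_def card_image_weyl[OF x] sorted_list_of_weyl[OF x] by (auto simp del: upt_Suc)
  ultimately show ?thesis by (intro extensionalityI)
qed

lemma enum_set:
  assumes A: "finite A" shows "enum_set A \<in> weyl (card A)" "enum_set A ` {1..card A} = A"
proof -
  let ?l = "sorted_list_of_set A"
  have len: "length ?l = card A" by simp
  have "strict_mono_on {1..card A} (enum_set A)"
  proof (rule strict_mono_onI)
    fix i j assume "i \<in> {1..card A}" "j \<in> {1..card A}" "i < j"
    then show "enum_set A i < enum_set A j"
      unfolding enum_set_def using sorted_wrt_nth_less[OF sorted_list_of_set.strict_sorted_key_list_of_set, of "i - 1" "j - 1" A] by auto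
  qed
  then show "enum_set A \<in> weyl (card A)" by (auto simp: weyl_def enum_set_def)
  have "enum_set A ` {1..card A} = (\<lambda>j. ?l ! j) ` {..<card A}"
  proof -
    have "{1..card A} = Suc ` {..<card A}" by (simp add: image_Suc_lessThan)
    then show ?thesis by (force simp: enum_set_def image_image)
  qed
  also have "\<dots> = set ?l" using nth_image[of "card A" ?l] by (simp add: atLeast0LessThan)
  finally show "enum_set A ` {1..card A} = A" using A by simp
qed

text \<open>Together with \<open>point_counts\<close> and \<open>point_coords\<close> this
  identifies the index pairs (n, x) of \<open>multi_sum\<close> with the finite sets of points at
  the times \<open>t 1, ..., t M\<close>.\<close>

definition point_set :: "nat \<Rightarrow> (nat \<Rightarrow> nat) \<Rightarrow> (nat \<Rightarrow> nat) \<Rightarrow> (nat \<Rightarrow> nat \<Rightarrow> int) \<Rightarrow> (nat \<times> int) set" where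
  "point_set M t n x = (\<lambda>(m, j). (t m, x m j)) ` (SIGMA m:{1..M}. {1..n m})"

definition point_counts :: "nat \<Rightarrow> (nat \<Rightarrow> nat) \<Rightarrow> (nat \<times> int) set \<Rightarrow> nat \<Rightarrow> nat" where
  "point_counts M t R = (\<lambda>m\<in>{1..M}. card (R `` {t m}))"

definition point_coords :: "nat \<Rightarrow> (nat \<Rightarrow> nat) \<Rightarrow> (nat \<times> int) set \<Rightarrow> nat \<Rightarrow> nat \<Rightarrow> int" where
  "point_coords M t R = (\<lambda>m\<in>{1..M}. enum_set (R `` {t m}))"

context
  fixes M :: nat and t :: "nat \<Rightarrow> nat"
  assumes t: "inj_on t {1..M}"
begin

lemma point_set_section:
  assumes "m \<in> {1..M}" shows "point_set M t n x `` {t m} = x m ` {1..n m}"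
  unfolding point_set_def using assms inj_onD[OF t] by fastforce

lemma point_counts_point_set:
  assumes n: "n \<in> {1..M} \<rightarrow>\<^sub>E UNIV" and x: "x \<in> (\<Pi>\<^sub>E m\<in>{1..M}. weyl (n m))"
  shows "point_counts M t (point_set M t n x) = n" "point_coords M t (point_set M t n x) = x"
proof -
  have xm: "x m \<in> weyl (n m)" if "m \<in> {1..M}" for m using PiE_mem[OF x that] .
  show "point_counts M t (point_set M t n x) = n"
    by (rule extensionalityI[of _ "{1..M}"]) (use n in \<open>auto simp: point_counts_def point_set_section card_image_weyl[OF xm] PiE_def\<close>)
  show "point_coords M t (point_set M t n x) = x"
    by (rule extensionalityI[of _ "{1..M}"]) (use x in \<open>auto simp: point_coords_def point_set_section enum_set_weyl[OF xm] PiE_def\<close>)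
qed

lemma point_set_point_coords:
  assumes R: "finite R" "R \<subseteq> t ` {1..M} \<times> UNIV"
  shows "point_counts M t R \<in> {1..M} \<rightarrow>\<^sub>E UNIV" "point_coords M t R \<in> (\<Pi>\<^sub>E m\<in>{1..M}. weyl (point_counts M t R m))"
    "point_set M t (point_counts M t R) (point_coords M t R) = R"
proof -
  have fin: "finite (R `` {s})" for s using R(1) by (rule finite_Image)
  show "point_counts M t R \<in> {1..M} \<rightarrow>\<^sub>E UNIV" by (auto simp: point_counts_def)
  show "point_coords M t R \<in> (\<Pi>\<^sub>E m\<in>{1..M}. weyl (point_counts M t R m))"
  proof (rule PiE_I)
    fix m assume m: "m \<in> {1..M}"
    show "point_coords M t R m \<in> weyl (point_counts M t R m)"
      using m enum_set(1)[OF fin[of "t m"]] by (simp add: point_counts_def point_coords_def)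
  next
    fix m assume "m \<notin> {1..M}"
    then show "point_coords M t R m = undefined" by (simp only: point_coords_def restrict_apply if_False)
  qed
  have sec: "point_set M t (point_counts M t R) (point_coords M t R) `` {t m} = R `` {t m}" if m: "m \<in> {1..M}" for m
    unfolding point_set_section[OF m] using m enum_set(2)[OF fin[of "t m"]] by (simp add: point_counts_def point_coords_def)
  show "point_set M t (point_counts M t R) (point_coords M t R) = R"
  proof (rule Set.set_eqI)
    fix a :: "nat \<times> int"
    show "a \<in> point_set M t (point_counts M t R) (point_coords M t R) \<longleftrightarrow> a \<in> R"
    proof (cases "fst a \<in> t ` {1..M}")
      case True
      then obtain m where m: "m \<in> {1..M}" "fst a = t m" by auto
      have *: "a \<in> Q \<longleftrightarrow> snd a \<in> Q `` {t m}" for Q using m(2) by (metis Image_singleton_iff prod.collapse)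
      show ?thesis unfolding *[of R] *[of "point_set M t (point_counts M t R) (point_coords M t R)"] sec[OF m(1)] ..
    next
      case False
      have "a \<notin> R"
      proof
        assume "a \<in> R"
        then have "a \<in> t ` {1..M} \<times> UNIV" using R(2) by (rule subsetD[rotated])
        then show False using False by (simp add: mem_Times_iff)
      qed
      moreover have "a \<notin> point_set M t (point_counts M t R) (point_coords M t R)"
        using False by (auto simp: point_set_def)
      ultimately show ?thesis by simp
    qed
  qed
qed

lemma inj_on_points:
  assumes x: "x \<in> (\<Pi>\<^sub>E m\<in>{1..M}. weyl (n m))"
  shows "inj_on (\<lambda>(m, j). (t m, x m j)) (SIGMA m:{1..M}. {1..n m})"
proof (rule inj_onI, clarify)
  fix m j m' j'
  assume a: "m \<in> {1..M}" "j \<in> {1..n m}" "m' \<in> {1..M}" "j' \<in> {1..n m'}" "t m = t m'" "x m j = x m' j'"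
  then have m: "m = m'" using inj_onD[OF t] by blast
  have "inj_on (x m) {1..n m}" using PiE_mem[OF x a(1)] by (auto simp: weyl_def intro: strict_mono_on_imp_inj_on)
  then show "m = m' \<and> j = j'" using a m by (auto dest: inj_onD)
qed

lemma prod_points:
  assumes x: "x \<in> (\<Pi>\<^sub>E m\<in>{1..M}. weyl (n m))"
  shows "(\<Prod>m=1..M. \<Prod>j=1..n m. g (t m) (x m j)) = (\<Prod>a\<in>point_set M t n x. g (fst a) (snd a))"
  unfolding point_set_def prod.reindex[OF inj_on_points[OF x]]
  by (subst prod.Sigma) (auto intro!: prod.cong)

text \<open>The lexicographic list enumerates the point set without repetition, because
  \<open>t\<close> is injective and each vector increases; the order of enumeration does not affect
  the determinant.\<close>

lemma block_det_eq_sdet: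
  assumes x: "x \<in> (\<Pi>\<^sub>E m\<in>{1..M}. weyl (n m))"
  shows "block_det M t K n x = sdet (point_set M t n x) K"
proof -
  let ?ms = "concat (map (\<lambda>m. map (\<lambda>j. (m, j)) [1..<Suc (n m)]) [1..<Suc M])"
  let ?pts = "concat (map (\<lambda>m. map (\<lambda>j. (t m, x m j)) [1..<Suc (n m)]) [1..<Suc M])"
  have pts: "?pts = map (\<lambda>(m, j). (t m, x m j)) ?ms"
    by (simp add: map_concat o_def)
  have set_ms: "set ?ms = (SIGMA m:{1..M}. {1..n m})" by (auto simp: atLeastLessThanSuc_atLeastAtMost simp del: upt_Suc)
  have "distinct (concat (map (\<lambda>m. map (\<lambda>j. (m, j)) [1..<Suc (n m)]) ms))" if "distinct ms" for ms
    using that by (induction ms) (auto simp: distinct_map inj_on_def simp del: upt_Suc)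
  then have "distinct ?ms" by (simp del: upt_Suc)
  then have "distinct ?pts" unfolding pts using inj_on_points[OF x] set_ms by (subst distinct_map) (simp del: upt_Suc)
  moreover have "set ?pts = point_set M t n x" unfolding pts point_set_def set_map set_ms ..
  ultimately show ?thesis
    unfolding block_det_def Let_def using det_mat_list_eq_sdet[of ?pts K] by simp
qed

text \<open>A term with a point outside \<open>P\<close> contains a factor 0, so both infinite sums
  reduce to finite ones: \<open>Y\<close> holds the relevant counts and \<open>D n\<close> the
  relevant vectors.\<close>

lemma multi_sum_eq:
  assumes P: "finite P" "P \<subseteq> t ` {1..M} \<times> UNIV"
    and h: "\<And>m y. m \<in> {1..M} \<Longrightarrow> (t m, y) \<notin> P \<Longrightarrow> h (t m) y = 0"
  shows "multi_sum M t h c = (\<Sum>R\<in>Pow P. (\<Prod>a\<in>R. complex_of_real (h (fst a) (snd a))) * c (point_counts M t R) (point_coords M t R))"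
proof -
  define X where "X n = (\<Pi>\<^sub>E m\<in>{1..M}. weyl (n m))" for n :: "nat \<Rightarrow> nat"
  define D where "D n = {x \<in> X n. point_set M t n x \<subseteq> P}" for n
  define Y where "Y = point_counts M t ` Pow P"
  define g where "g n x = (\<Prod>m=1..M. \<Prod>j=1..n m. complex_of_real (h (t m) (x m j))) * c n x" for n x
  have PP: "finite R \<and> R \<subseteq> t ` {1..M} \<times> UNIV" if "R \<in> Pow P" for R
    using that P finite_subset by auto
  have g_eq: "g n x = (\<Prod>a\<in>point_set M t n x. complex_of_real (h (fst a) (snd a))) * c n x" if "x \<in> X n" for n x
    using that unfolding g_def X_def by (subst prod_points) auto
  have g0: "g n x = 0" if x: "x \<in> X n - D n" for n x
  proof -
    have "\<not> point_set M t n x \<subseteq> P" using x by (auto simp: D_def)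
    then obtain a where a: "a \<in> point_set M t n x" "a \<notin> P" by blast
    then obtain m j where mj: "m \<in> {1..M}" "a = (t m, x m j)" by (auto simp: point_set_def)
    have "(t m, x m j) \<notin> P" using a(2) mj(2) by simp
    then have 0: "complex_of_real (h (fst a) (snd a)) = 0" unfolding mj(2) by (simp add: h[OF mj(1)])
    have fin: "finite (point_set M t n x)" by (simp add: point_set_def)
    have "\<exists>a\<in>point_set M t n x. complex_of_real (h (fst a) (snd a)) = 0" using 0 a(1) by blast
    then have "(\<Prod>a\<in>point_set M t n x. complex_of_real (h (fst a) (snd a))) = 0"
      by (rule prod_zero[OF fin])
    moreover have "x \<in> X n" using x by blast
    ultimately show ?thesis by (simp only: g_eq mult_zero_left)
  qed
  have Yn: "n \<in> {1..M} \<rightarrow>\<^sub>E UNIV" if n: "n \<in> Y" for n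
  proof -
    obtain R where R: "R \<in> Pow P" "n = point_counts M t R" using n unfolding Y_def by blast
    show ?thesis unfolding R(2) by (rule point_set_point_coords(1)[OF conjunct1[OF PP[OF R(1)]] conjunct2[OF PP[OF R(1)]]])
  qed
  have Dfin: "finite (D n)" if n: "n \<in> {1..M} \<rightarrow>\<^sub>E UNIV" for n
  proof (rule finite_subset)
    show "D n \<subseteq> point_coords M t ` Pow P"
    proof
      fix x assume x: "x \<in> D n"
      then have "x = point_coords M t (point_set M t n x)" "point_set M t n x \<in> Pow P"
        using point_counts_point_set(2)[OF n, of x] by (auto simp: D_def X_def)
      then show "x \<in> point_coords M t ` Pow P" by blast
    qed
  qed (use P in simp)
  have inner: "(\<Sum>\<^sub>\<infinity>x\<in>X n. g n x) = (\<Sum>x\<in>D n. g n x)" if n: "n \<in> {1..M} \<rightarrow>\<^sub>E UNIV" for n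
  proof -
    have "(\<Sum>\<^sub>\<infinity>x\<in>X n. g n x) = (\<Sum>\<^sub>\<infinity>x\<in>D n. g n x)"
      by (rule infsum_cong_neutral) (use g0 in \<open>auto simp: D_def\<close>)
    then show ?thesis using Dfin[OF n] by simp
  qed
  have "multi_sum M t h c = (\<Sum>\<^sub>\<infinity>n\<in>({1..M} \<rightarrow>\<^sub>E UNIV). \<Sum>\<^sub>\<infinity>x\<in>X n. g n x)"
    by (simp add: multi_sum_def X_def g_def)
  also have "\<dots> = (\<Sum>\<^sub>\<infinity>n\<in>({1..M} \<rightarrow>\<^sub>E UNIV). \<Sum>x\<in>D n. g n x)"
    by (rule infsum_cong) (rule inner)
  also have "\<dots> = (\<Sum>\<^sub>\<infinity>n\<in>Y. \<Sum>x\<in>D n. g n x)"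
  proof (rule infsum_cong_neutral)
    fix n assume "n \<in> ({1..M} \<rightarrow>\<^sub>E UNIV) - Y"
    then have n: "n \<in> {1..M} \<rightarrow>\<^sub>E UNIV" "n \<notin> Y" by blast+
    have "x \<notin> D n" for x
    proof
      assume x: "x \<in> D n"
      have "n = point_counts M t (point_set M t n x)"
        by (rule point_counts_point_set(1)[OF n(1), symmetric]) (use x in \<open>simp add: D_def X_def\<close>)
      moreover have "point_set M t n x \<in> Pow P" using x by (simp add: D_def)
      ultimately have "n \<in> Y" unfolding Y_def by (rule image_eqI)
      then show False using n(2) by blast
    qed
    then have "D n = {}" by blast
    then show "(\<Sum>x\<in>D n. g n x) = 0" by simp
  next
    fix n assume "n \<in> Y - ({1..M} \<rightarrow>\<^sub>E UNIV)"
    then show "(\<Sum>x\<in>D n. g n x) = 0" using Yn by blast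
  qed simp
  also have "\<dots> = (\<Sum>n\<in>Y. \<Sum>x\<in>D n. g n x)" using P by (simp add: Y_def)
  also have "\<dots> = (\<Sum>(n, x)\<in>Sigma Y D. g n x)"
  proof (rule sum.Sigma)
    show "\<forall>n\<in>Y. finite (D n)" using Dfin Yn by blast
  qed (use P in \<open>simp add: Y_def\<close>)
  also have "\<dots> = (\<Sum>R\<in>Pow P. (\<Prod>a\<in>R. complex_of_real (h (fst a) (snd a))) * c (point_counts M t R) (point_coords M t R))"
  proof (rule sum.reindex_bij_witness[where j = "\<lambda>(n, x). point_set M t n x" and i = "\<lambda>R. (point_counts M t R, point_coords M t R)"])
    fix a assume a: "a \<in> Sigma Y D"
    then obtain n x where nx: "a = (n, x)" "n \<in> Y" "x \<in> X n" "point_set M t n x \<subseteq> P" by (auto simp: D_def)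
    note n = Yn[OF nx(2)]
    note e = point_counts_point_set[OF n nx(3)[unfolded X_def]]
    show "(point_counts M t (case a of (n, x) \<Rightarrow> point_set M t n x), point_coords M t (case a of (n, x) \<Rightarrow> point_set M t n x)) = a"
      by (simp add: nx(1) e)
    show "(case a of (n, x) \<Rightarrow> point_set M t n x) \<in> Pow P" using nx by simp
    show "(\<Prod>a\<in>(case a of (n, x) \<Rightarrow> point_set M t n x). complex_of_real (h (fst a) (snd a))) *
         c (point_counts M t (case a of (n, x) \<Rightarrow> point_set M t n x)) (point_coords M t (case a of (n, x) \<Rightarrow> point_set M t n x)) =
         (case a of (n, x) \<Rightarrow> g n x)"
      by (simp add: nx(1) e g_eq[OF nx(3)])
  next
    fix R assume R: "R \<in> Pow P"
    note r = point_set_point_coords[OF PP[OF R, THEN conjunct1] PP[OF R, THEN conjunct2]]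
    show "(case (point_counts M t R, point_coords M t R) of (n, x) \<Rightarrow> point_set M t n x) = R" by (simp add: r)
    have "point_counts M t R \<in> Y" unfolding Y_def using R by (rule imageI)
    moreover have "point_coords M t R \<in> D (point_counts M t R)" using R r by (simp add: D_def X_def)
    ultimately show "(point_counts M t R, point_coords M t R) \<in> Sigma Y D" by (simp add: mem_Sigma_iff)
  qed
  finally show ?thesis .
qed

text \<open>Testing with weight 1 on a finite set \<open>R\<close> and 0 elsewhere gives the sum of
  the coefficients over all subsets of \<open>R\<close>; induction over proper subsets isolates the
  coefficient of \<open>R\<close>.\<close>

lemma multi_sum_unique:
  assumes eq: "\<And>f. f \<in> test_functions M t \<Longrightarrow> multi_sum M t (\<lambda>s y. exp (f s y) - 1) c = multi_sum M t (\<lambda>s y. exp (f s y) - 1) c'"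
    and n: "n \<in> {1..M} \<rightarrow>\<^sub>E UNIV" and x: "x \<in> (\<Pi>\<^sub>E m\<in>{1..M}. weyl (n m))"
  shows "c n x = c' n x"
proof -
  have *: "c (point_counts M t R) (point_coords M t R) = c' (point_counts M t R) (point_coords M t R)"
    if "finite R" "R \<subseteq> t ` {1..M} \<times> UNIV" for R
    using that
  proof (induction R rule: finite_psubset_induct)
    case (psubset R)
    \<comment> \<open>The value \<open>ln 2\<close> makes the weight exp f - 1 equal to 1 on
      \<open>R\<close>.\<close>
    define f where "f s y = (if (s, y) \<in> R then ln 2 else 0 :: real)" for s :: nat and y :: int
    have f: "f \<in> test_functions M t"
    proof -
      have "{y. f s y \<noteq> 0} \<subseteq> R `` {s}" for s by (auto simp: f_def)
      then have "finite {y. f s y \<noteq> 0}" for s using finite_Image[OF psubset.hyps] finite_subset by metis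
      then show ?thesis by (simp add: test_functions_def)
    qed
    have sum: "multi_sum M t (\<lambda>s y. exp (f s y) - 1) d = (\<Sum>Q\<in>Pow R. d (point_counts M t Q) (point_coords M t Q))" for d
    proof -
      have "multi_sum M t (\<lambda>s y. exp (f s y) - 1) d = (\<Sum>Q\<in>Pow R. (\<Prod>a\<in>Q. complex_of_real (exp (f (fst a) (snd a)) - 1)) * d (point_counts M t Q) (point_coords M t Q))"
        by (rule multi_sum_eq) (use psubset in \<open>auto simp: f_def\<close>)
      also have "\<dots> = (\<Sum>Q\<in>Pow R. d (point_counts M t Q) (point_coords M t Q))"
      proof (intro sum.cong refl)
        fix Q assume Q: "Q \<in> Pow R"
        have "(\<Prod>a\<in>Q. complex_of_real (exp (f (fst a) (snd a)) - 1)) = 1"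
          by (rule prod.neutral) (use Q in \<open>auto simp: f_def\<close>)
        then show "(\<Prod>a\<in>Q. complex_of_real (exp (f (fst a) (snd a)) - 1)) * d (point_counts M t Q) (point_coords M t Q) = d (point_counts M t Q) (point_coords M t Q)" by simp
      qed
      finally show ?thesis .
    qed
    have fin: "finite (Pow R - {R})" using psubset.hyps by simp
    have split: "(\<Sum>Q\<in>Pow R. d Q) = d R + (\<Sum>Q\<in>Pow R - {R}. d Q)" for d :: "(nat \<times> int) set \<Rightarrow> complex"
      using psubset.hyps by (intro sum.remove) auto
    have "(\<Sum>Q\<in>Pow R - {R}. c (point_counts M t Q) (point_coords M t Q)) = (\<Sum>Q\<in>Pow R - {R}. c' (point_counts M t Q) (point_coords M t Q))"
      using psubset by (intro sum.cong refl psubset.IH) auto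
    then show ?case using eq[OF f] unfolding sum split by simp
  qed
  have "finite (point_set M t n x)" "point_set M t n x \<subseteq> t ` {1..M} \<times> UNIV" by (auto simp: point_set_def)
  from *[OF this] show ?thesis unfolding point_counts_point_set[OF n x] .
qed

end

section \<open>Determinantal expansion for the conditioned walk\<close>

locale walkers_martingale = walkers P N u V + martingale_functions N u m
  for P :: "'a measure" and N u V m
begin

lemma cond_expect_tendsto:
  assumes F: "\<And>X Y. (\<forall>s\<le>T. X s = Y s) \<Longrightarrow> F X = F Y"
  shows "cond_expect P N V F \<longlonglongrightarrow> wexp N u T (\<lambda>w. F (conf w) * of_bool (noncolliding N T w) * vandermonde N (\<lambda>i. of_int (w T i))) / vandermonde N (\<lambda>i. of_int (u i))"
proof -
  have Fw: "F (conf w) = F (conf w')" if "\<And>s. s \<le> T \<Longrightarrow> w s = w' s" for w w'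
    by (rule F) (simp add: conf_def that)
  note lim = wexp_conditioned_tendsto[OF u u_even N, where T = T and F = "\<lambda>w. F (conf w)"]
  have l1: "(\<lambda>n. wexp N u n (\<lambda>w. F (conf w) * of_bool (noncolliding N n w)) / wexp N u n (\<lambda>w. of_bool (noncolliding N n w)))
    \<longlonglongrightarrow> wexp N u T (\<lambda>w. F (conf w) * of_bool (noncolliding N T w) * vandermonde N (\<lambda>i. of_int (w T i))) / vandermonde N (\<lambda>i. of_int (u i))"
    by (rule lim(1)) (rule Fw)
  have l2: "\<forall>\<^sub>F n in sequentially. wexp N u n (\<lambda>w. of_bool (noncolliding N n w)) > 0"
    by (rule lim(2)) (rule Fw)
  show ?thesis
  proof (rule Lim_transform_eventually[OF l1])
    show "\<forall>\<^sub>F n in sequentially. wexp N u n (\<lambda>w. F (conf w) * of_bool (noncolliding N n w)) / wexp N u n (\<lambda>w. of_bool (noncolliding N n w)) = cond_expect P N V F n"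
      using l2 eventually_ge_at_top[of T]
      by eventually_elim (rule cond_expect_eq[OF F, symmetric])
  qed
qed

lemma convergent_cond_expect:
  assumes "local_functional N F" shows "convergent (cond_expect P N V F)"
proof -
  obtain T where T: "\<forall>X Y. (\<forall>s\<le>T. X s = Y s) \<longrightarrow> F X = F Y"
    using conjunct2[OF assms[unfolded local_functional_def]] by (rule exE)
  show ?thesis by (rule convergentI, rule cond_expect_tendsto) (rule T[rule_format], blast)
qed

text \<open>The product is filled up with factors 1 at the unobserved times, so that there is a
  weight at every step of the walk, as the pullback requires.\<close>

lemma exp_functional_conf:
  assumes t: "strict_mono_on {1..M} t" "0 < t 1" and M: "1 \<le> M"
  shows "exp_functional M t f (conf w) = (\<Prod>s\<in>{1..t M}. \<Prod>i\<in>{1..N}. if s \<in> t ` {1..M} then exp (f s (w s i)) else 1)"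
proof -
  have inj: "inj_on t {1..M}" using t(1) by (rule strict_mono_on_imp_inj_on)
  have mono: "t i \<le> t j" if "i \<in> {1..M}" "j \<in> {1..M}" "i \<le> j" for i j
    using strict_mono_onD[OF t(1), of i j] that by (cases "i = j") auto
  have sub: "t ` {1..M} \<subseteq> {1..t M}"
  proof
    fix s assume "s \<in> t ` {1..M}"
    then obtain i where i: "i \<in> {1..M}" "s = t i" by blast
    then show "s \<in> {1..t M}" using mono[of 1 i] mono[of i M] t(2) M by auto
  qed
  have "exp_functional M t f (conf w) = (\<Prod>k=1..M. \<Prod>i\<in>{1..N}. exp (f (t k) (w (t k) i)))"
    by (simp add: exp_functional_def conf_def exp_sum sum_unfold_sum_mset[symmetric] image_mset.compositionality o_def)
  also have "\<dots> = (\<Prod>s\<in>t ` {1..M}. \<Prod>i\<in>{1..N}. exp (f s (w s i)))"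
    by (simp add: prod.reindex[OF inj])
  also have "\<dots> = (\<Prod>s\<in>{1..t M}. if s \<in> t ` {1..M} then \<Prod>i\<in>{1..N}. exp (f s (w s i)) else 1)"
    by (rule prod.mono_neutral_cong_left) (use sub in auto)
  also have "\<dots> = (\<Prod>s\<in>{1..t M}. \<Prod>i\<in>{1..N}. if s \<in> t ` {1..M} then exp (f s (w s i)) else 1)"
    by (intro prod.cong refl) auto
  finally show ?thesis .
qed

text \<open>The real form of \<open>nc_kernel\<close>: the two agree for
  \<open>m = mfun N u\<close>, once \<open>calM\<close> is known to be real and equal to these
  functions.\<close>

definition pkernel :: "nat \<times> int \<Rightarrow> nat \<times> int \<Rightarrow> real" where
  "pkernel a b = (if even (int (fst a) + snd a) \<and> even (int (fst b) + snd b) then rkernel a b else 0)"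

lemma nc_expect_exp_functional:
  assumes M: "1 \<le> M" and t: "0 < t 1" "strict_mono_on {1..M} t" and f: "f \<in> test_functions M t"
    and Q: "Q = {a. fst a \<in> t ` {1..M} \<and> f (fst a) (snd a) \<noteq> 0}"
  shows "finite Q" "nc_expect P N V (exp_functional M t f) = (\<Sum>R\<in>Pow Q. (\<Prod>a\<in>R. exp (f (fst a) (snd a)) - 1) * sdet R pkernel)"
proof -
  have mono: "t i \<le> t j" if "i \<in> {1..M}" "j \<in> {1..M}" "i \<le> j" for i j
    using strict_mono_onD[OF t(2), of i j] that by (cases "i = j") auto
  have Qeq: "Q = (SIGMA s:t ` {1..M}. {y. f s y \<noteq> 0})" by (auto simp: Q)
  show fin: "finite Q"
    unfolding Qeq using f by (intro finite_SigmaI) (auto simp: test_functions_def)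
  \<comment> \<open>The points of \<open>Q\<close> that have the parity of their time. The walk
    never visits the others, and in \<open>pkernel\<close> they produce zero rows, so passing
    between \<open>S\<close> and \<open>Q\<close> changes neither side.\<close>
  define S where "S = {a\<in>Q. even (int (fst a) + snd a)}"
  define \<psi> where "\<psi> s x = (if (s, x) \<in> S then exp (f s x) - 1 else 0)" for s x
  define \<phi> where "\<phi> s x = (if s \<in> t ` {1..M} then exp (f s x) else 1)" for s x
  have S: "finite S" "S \<subseteq> Q" unfolding S_def using fin by auto
  have S1: "1 \<le> fst a \<and> fst a \<le> t M" if a: "a \<in> S" for a
  proof -
    obtain i where i: "i \<in> {1..M}" "fst a = t i" using a unfolding S_def Q by blast
    then show ?thesis using mono[of 1 i] mono[of i M] t(1) M by auto
  qed
  have loc: "exp_functional M t f X = exp_functional M t f Y" if "\<forall>s\<le>t M. X s = Y s" for X Y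
    unfolding exp_functional_def using that mono M by (intro arg_cong[where f=exp] sum.cong refl) auto
  have "nc_expect P N V (exp_functional M t f) = wexp N u (t M) (\<lambda>w. exp_functional M t f (conf w) * of_bool (noncolliding N (t M) w) * vandermonde N (\<lambda>i. of_int (w (t M) i))) / vandermonde N (\<lambda>i. of_int (u i))"
    unfolding nc_expect_def by (rule limI) (rule cond_expect_tendsto[OF loc])
  also have "\<dots> = wexp N u (t M) (\<lambda>w. (\<Prod>s\<in>{1..t M}. \<Prod>i\<in>{1..N}. \<phi> s (w s i)) * of_bool (noncolliding N (t M) w) * vandermonde N (\<lambda>i. of_int (w (t M) i))) / vandermonde N (\<lambda>i. of_int (u i))"
    unfolding exp_functional_conf[OF t(2,1) M] \<phi>_def ..
  also have "\<dots> = (\<Sum>R\<in>Pow S. (\<Prod>a\<in>R. \<psi> (fst a) (snd a)) * sdet R rkernel)"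
  proof (rule wexp_product_eq[OF S(1) S1])
    show "\<psi> s x = 0" if "(s, x) \<notin> S" for s x using that by (simp add: \<psi>_def)
    show "\<phi> s x = 1 + \<psi> s x" if "even (int s + x)" for s x
      using that by (auto simp: \<phi>_def \<psi>_def S_def Q)
  qed
  also have "\<dots> = (\<Sum>R\<in>Pow S. (\<Prod>a\<in>R. exp (f (fst a) (snd a)) - 1) * sdet R pkernel)"
  proof (intro sum.cong refl arg_cong2[where f="(*)"] prod.cong sdet_cong)
    fix R a assume "R \<in> Pow S" "a \<in> R"
    then show "\<psi> (fst a) (snd a) = exp (f (fst a) (snd a)) - 1" by (auto simp: \<psi>_def)
  next
    fix R a b assume "R \<in> Pow S" "a \<in> R" "b \<in> R"
    then have "a \<in> S" "b \<in> S" by auto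
    then show "rkernel a b = pkernel a b" by (simp add: pkernel_def S_def)
  qed
  also have "\<dots> = (\<Sum>R\<in>Pow Q. (\<Prod>a\<in>R. exp (f (fst a) (snd a)) - 1) * sdet R pkernel)"
  proof (rule sum.mono_neutral_left)
    show "finite (Pow Q)" using fin by simp
    show "Pow S \<subseteq> Pow Q" using S(2) by blast
    show "\<forall>R\<in>Pow Q - Pow S. (\<Prod>a\<in>R. exp (f (fst a) (snd a)) - 1) * sdet R pkernel = 0"
    proof
      fix R assume R: "R \<in> Pow Q - Pow S"
      then obtain a where a: "a \<in> R" "odd (int (fst a) + snd a)" by (auto simp: S_def)
      have "finite R" using R fin finite_subset by blast
      then have "sdet R pkernel = 0" by (rule sdet_zero_row[OF _ a(1)]) (use a(2) in \<open>simp add: pkernel_def\<close>)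
      then show "(\<Prod>a\<in>R. exp (f (fst a) (snd a)) - 1) * sdet R pkernel = 0" by simp
    qed
  qed
  finally show "nc_expect P N V (exp_functional M t f) = (\<Sum>R\<in>Pow Q. (\<Prod>a\<in>R. exp (f (fst a) (snd a)) - 1) * sdet R pkernel)" .
qed

context
  fixes K :: "nat \<times> int \<Rightarrow> nat \<times> int \<Rightarrow> complex" and M :: nat and t :: "nat \<Rightarrow> nat"
  assumes K: "\<And>a b. K a b = complex_of_real (pkernel a b)"
    and M: "1 \<le> M" and t: "0 < t 1" "strict_mono_on {1..M} t"
begin

lemma sdet_K: "sdet R K = complex_of_real (sdet R pkernel)"
  by (simp add: sdet_def K)

lemma inj_t: "inj_on t {1..M}" using t(2) by (rule strict_mono_on_imp_inj_on)

lemma nc_expect_eq_multi_sum: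
  assumes f: "f \<in> test_functions M t"
    and c: "\<And>R. finite R \<Longrightarrow> R \<subseteq> t ` {1..M} \<times> UNIV \<Longrightarrow> c (point_counts M t R) (point_coords M t R) = sdet R K"
  shows "complex_of_real (nc_expect P N V (exp_functional M t f)) = multi_sum M t (\<lambda>s y. exp (f s y) - 1) c"
proof -
  define Q where "Q = {a. fst a \<in> t ` {1..M} \<and> f (fst a) (snd a) \<noteq> 0}"
  note E = nc_expect_exp_functional[OF M t f Q_def]
  have QM: "Q \<subseteq> t ` {1..M} \<times> UNIV" by (auto simp: Q_def)
  have "multi_sum M t (\<lambda>s y. exp (f s y) - 1) c
    = (\<Sum>R\<in>Pow Q. (\<Prod>a\<in>R. complex_of_real (exp (f (fst a) (snd a)) - 1)) * c (point_counts M t R) (point_coords M t R))"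
    by (rule multi_sum_eq[OF inj_t E(1) QM]) (auto simp: Q_def)
  also have "\<dots> = (\<Sum>R\<in>Pow Q. complex_of_real ((\<Prod>a\<in>R. exp (f (fst a) (snd a)) - 1) * sdet R pkernel))"
  proof (intro sum.cong refl)
    fix R assume "R \<in> Pow Q"
    then have "c (point_counts M t R) (point_coords M t R) = sdet R K"
      using finite_subset[OF _ E(1), of R] QM by (intro c) auto
    then show "(\<Prod>a\<in>R. complex_of_real (exp (f (fst a) (snd a)) - 1)) * c (point_counts M t R) (point_coords M t R)
      = complex_of_real ((\<Prod>a\<in>R. exp (f (fst a) (snd a)) - 1) * sdet R pkernel)"
      by (simp add: sdet_K)
  qed
  finally show ?thesis using E(2) by simp
qed

lemma block_det_points:
  assumes "finite R" "R \<subseteq> t ` {1..M} \<times> UNIV"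
  shows "block_det M t K (point_counts M t R) (point_coords M t R) = sdet R K"
  using block_det_eq_sdet[OF inj_t point_set_point_coords(2)[OF inj_t assms], of K]
  unfolding point_set_point_coords(3)[OF inj_t assms] .

lemma nc_expect_eq_fredholm_det:
  "f \<in> test_functions M t \<Longrightarrow> complex_of_real (nc_expect P N V (exp_functional M t f)) = fredholm_det M t K (\<lambda>s y. exp (f s y) - 1)"
  unfolding fredholm_det_def by (rule nc_expect_eq_multi_sum) (simp_all add: block_det_points)

text \<open>Taking the real part loses nothing, because the kernel is real-valued.\<close>

lemma correlation_functions_exist: "\<exists>\<rho>. correlation_functions P N V M t \<rho>"
proof
  show "correlation_functions P N V M t (\<lambda>n x. Re (block_det M t K n x))"
    unfolding correlation_functions_def
  proof
    fix f assume "f \<in> test_functions M t"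
    then show "complex_of_real (nc_expect P N V (exp_functional M t f)) = multi_sum M t (\<lambda>s y. exp (f s y) - 1) (\<lambda>n x. complex_of_real (Re (block_det M t K n x)))"
      by (rule nc_expect_eq_multi_sum) (simp add: block_det_points sdet_K)
  qed
qed

lemma correlation_functions_eq:
  assumes \<rho>: "correlation_functions P N V M t \<rho>"
    and n: "n \<in> {1..M} \<rightarrow>\<^sub>E UNIV" and x: "x \<in> (\<Pi>\<^sub>E m\<in>{1..M}. weyl (n m))"
  shows "complex_of_real (\<rho> n x) = (if \<forall>m\<in>{1..M}. \<forall>j\<in>{1..n m}. even (x m j) \<longleftrightarrow> even (t m) then block_det M t K n x else 0)"
proof -
  have "complex_of_real (\<rho> n x) = block_det M t K n x"
  proof (rule multi_sum_unique[OF inj_t _ n x])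
    fix f assume f: "f \<in> test_functions M t"
    show "multi_sum M t (\<lambda>s y. exp (f s y) - 1) (\<lambda>n x. complex_of_real (\<rho> n x)) = multi_sum M t (\<lambda>s y. exp (f s y) - 1) (block_det M t K)"
      using \<rho> f nc_expect_eq_fredholm_det[OF f] unfolding correlation_functions_def fredholm_det_def by metis
  qed
  \<comment> \<open>A point of the wrong parity produces a zero row of the kernel matrix.\<close>
  moreover have "block_det M t K n x = 0" if wrong: "\<not> (\<forall>m\<in>{1..M}. \<forall>j\<in>{1..n m}. even (x m j) \<longleftrightarrow> even (t m))"
  proof -
    obtain k j where kj: "k \<in> {1..M}" "j \<in> {1..n k}" "\<not> (even (x k j) \<longleftrightarrow> even (t k))" using wrong by blast
    have "(t k, x k j) \<in> point_set M t n x" unfolding point_set_def using kj(1,2) by force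
    moreover have "finite (point_set M t n x)" by (simp add: point_set_def)
    ultimately show ?thesis unfolding block_det_eq_sdet[OF inj_t x]
      by (intro sdet_zero_row) (use kj(3) in \<open>auto simp: K pkernel_def\<close>)
  qed
  ultimately show ?thesis by simp
qed

end

end

section \<open>Martingale polynomials\<close>

definition fps_cosh :: "real fps" where
  "fps_cosh = fps_const (1 / 2) * (fps_exp 1 + fps_exp (-1))"

text \<open>\<open>fact l\<close> times the coefficients of exp(x y) / (cosh x)^t in x: the
  generalised Euler polynomials of order \<open>t\<close>, rescaled as 2^l E_l((y + t) / 2).\<close>

definition mpoly :: "nat \<Rightarrow> nat \<Rightarrow> real \<Rightarrow> real" where
  "mpoly l t y = fact l * fps_nth (fps_exp y * inverse fps_cosh ^ t) l"

lemma fps_cosh_0: "fps_nth fps_cosh 0 = 1"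
  by (simp add: fps_cosh_def)

text \<open>Averaging exp(x (y + 1)) and exp(x (y - 1)) gives exp(x y) cosh x, which cancels one of
  the factors 1 / cosh x.\<close>

lemma mpoly_avg: "(mpoly l (Suc t) (y + 1) + mpoly l (Suc t) (y - 1)) / 2 = mpoly l t y"
proof -
  have "inverse fps_cosh ^ Suc t * fps_cosh = inverse fps_cosh ^ t * (inverse fps_cosh * fps_cosh)"
    by (simp add: mult_ac)
  also have "inverse fps_cosh * fps_cosh = 1" by (rule inverse_mult_eq_1) (simp add: fps_cosh_0)
  finally have c: "inverse fps_cosh ^ Suc t * fps_cosh = inverse fps_cosh ^ t" by simp
  have e: "fps_const (1 / 2) * (fps_exp (y + 1) + fps_exp (y - 1)) = fps_exp y * fps_cosh"
    using fps_exp_add_mult[of y 1] fps_exp_add_mult[of y "-1"] by (simp add: fps_cosh_def algebra_simps)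
  have "fps_const (1 / 2) * (fps_exp (y + 1) * inverse fps_cosh ^ Suc t + fps_exp (y - 1) * inverse fps_cosh ^ Suc t)
    = (fps_const (1 / 2) * (fps_exp (y + 1) + fps_exp (y - 1))) * inverse fps_cosh ^ Suc t"
    by (simp only: distrib_left distrib_right mult.assoc)
  also have "\<dots> = fps_exp y * (inverse fps_cosh ^ Suc t * fps_cosh)" unfolding e by (simp only: mult_ac)
  finally have "fps_nth (fps_const (1 / 2) * (fps_exp (y + 1) * inverse fps_cosh ^ Suc t + fps_exp (y - 1) * inverse fps_cosh ^ Suc t)) l
     = fps_nth (fps_exp y * inverse fps_cosh ^ t) l" unfolding c by (rule arg_cong)
  then have *: "(fps_nth (fps_exp (y + 1) * inverse fps_cosh ^ Suc t) l + fps_nth (fps_exp (y - 1) * inverse fps_cosh ^ Suc t) l) / 2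
     = fps_nth (fps_exp y * inverse fps_cosh ^ t) l" by (simp only: fps_mult_left_const_nth fps_add_nth)
  have "(mpoly l (Suc t) (y + 1) + mpoly l (Suc t) (y - 1)) / 2 = fact l * ((fps_nth (fps_exp (y + 1) * inverse fps_cosh ^ Suc t) l + fps_nth (fps_exp (y - 1) * inverse fps_cosh ^ Suc t) l) / 2)"
    by (simp only: mpoly_def distrib_left times_divide_eq_right)
  then show ?thesis unfolding * mpoly_def .
qed

lemma mpoly_0: "mpoly l 0 y = y ^ l"
  by (simp add: mpoly_def)

lemma mpoly_eq_sum: "mpoly l t y = (\<Sum>i\<le>l. real (l choose i) * y ^ i * (fact (l - i) * fps_nth (inverse fps_cosh ^ t) (l - i)))"
  unfolding mpoly_def fps_mult_nth sum_distrib_left atLeast0AtMost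
  by (intro sum.cong refl) (simp add: binomial_fact)

lemma mpoly_eq_poly:
  obtains p where "degree p \<le> l" "coeff p l = 1" "\<And>y. mpoly l t y = poly p y"
proof
  define p where "p = (\<Sum>i\<le>l. monom (real (l choose i) * (fact (l - i) * fps_nth (inverse fps_cosh ^ t) (l - i))) i)"
  have c0: "fps_nth (inverse fps_cosh ^ t) 0 = 1" by (simp add: fps_cosh_0 fps_nth_power_0)
  show "degree p \<le> l" unfolding p_def by (intro degree_sum_le) (auto intro: order.trans[OF degree_monom_le])
  show "coeff p l = 1" unfolding p_def by (simp add: coeff_sum c0 sum.delta)
  show "mpoly l t y = poly p y" for y
    unfolding mpoly_eq_sum p_def by (simp add: poly_sum poly_monom mult_ac)
qed

definition lagrange :: "nat \<Rightarrow> (nat \<Rightarrow> int) \<Rightarrow> nat \<Rightarrow> real poly" where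
  "lagrange N u j = (\<Prod>i\<in>{1..N} - {j}. Polynomial.smult (1 / of_int (u j - u i)) [:- of_int (u i), 1:])"

text \<open>The Lagrange polynomial of the node \<open>u j\<close> with each power of y replaced by
  the corresponding \<open>mpoly\<close>; since \<open>mpoly\<close> at time 0 is the power itself,
  this extends the Lagrange polynomial to a martingale in time.\<close>

definition mfun :: "nat \<Rightarrow> (nat \<Rightarrow> int) \<Rightarrow> nat \<Rightarrow> nat \<Rightarrow> int \<Rightarrow> real" where
  "mfun N u j t y = (\<Sum>l<N. coeff (lagrange N u j) l * mpoly l t (of_int y))"

lemma degree_lagrange:
  assumes "j \<in> {1..N}" shows "degree (lagrange N u j) < N"
proof -
  have "degree (lagrange N u j) \<le> (\<Sum>i\<in>{1..N} - {j}. degree (Polynomial.smult (1 / of_int (u j - u i)) [:- of_int (u i), 1::real:]))"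
    unfolding lagrange_def using degree_prod_sum_le by (metis (no_types, lifting) finite_Diff finite_atLeastAtMost o_apply sum.cong)
  also have "\<dots> \<le> (\<Sum>i\<in>{1..N} - {j}. 1)"
    by (intro sum_mono order.trans[OF degree_smult_le]) simp
  also have "\<dots> = N - 1" using assms by simp
  finally show ?thesis using assms by auto
qed

lemma poly_lagrange_sum:
  assumes "j \<in> {1..N}"
  shows "(\<Sum>l<N. coeff (lagrange N u j) l * y ^ l) = poly (lagrange N u j) y"
  unfolding poly_altdef using degree_lagrange[OF assms, of u]
  by (intro sum.mono_neutral_right) (auto simp: coeff_eq_0 not_le)

lemma martingale_functions_mfun:
  assumes N: "1 \<le> N" and u: "strict_mono_on {1..N} u" "\<forall>j\<in>{1..N}. even (u j)"
  shows "martingale_functions N u (mfun N u)"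
proof
  show "1 \<le> N" "strict_mono_on {1..N} u" "\<forall>j\<in>{1..N}. even (u j)" by fact+
  show "avg1 (mfun N u j (Suc t)) y = mfun N u j t y" for j t y
  proof -
    have "avg1 (mfun N u j (Suc t)) y = (\<Sum>l<N. coeff (lagrange N u j) l * ((mpoly l (Suc t) (of_int y + 1) + mpoly l (Suc t) (of_int y - 1)) / 2))"
      by (simp add: avg1_def mfun_def sum.distrib[symmetric] sum_divide_distrib distrib_left add_divide_distrib)
    then show ?thesis by (simp only: mpoly_avg mfun_def)
  qed
  have inj: "u i = u j \<longleftrightarrow> i = j" if "i \<in> {1..N}" "j \<in> {1..N}" for i j
    using strict_mono_on_imp_inj_on[OF u(1)] that by (rule inj_on_eq_iff)
  show m0: "mfun N u j 0 (u i) = of_bool (i = j)" if i: "i \<in> {1..N}" and j: "j \<in> {1..N}" for i j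
  proof -
    have "mfun N u j 0 (u i) = poly (lagrange N u j) (of_int (u i))"
      by (simp add: mfun_def mpoly_0 poly_lagrange_sum[OF j])
    also have "\<dots> = (\<Prod>k\<in>{1..N} - {j}. (of_int (u i) - of_int (u k)) / of_int (u j - u k))"
      by (simp add: lagrange_def poly_prod diff_divide_distrib)
    also have "\<dots> = of_bool (i = j)"
    proof (cases "i = j")
      case True
      then show ?thesis using inj[OF j] by (simp add: prod.neutral)
    next
      case False
      then show ?thesis using i by (auto intro!: prod_zero bexI[of _ i])
    qed
    finally show ?thesis .
  qed
  \<comment> \<open>By \<open>vand\<close> below, the determinant is \<open>c\<close> times the
    Vandermonde determinant at all times and points; evaluation at time 0 and the nodes, where it is
    1, identifies \<open>c\<close> as the reciprocal of the Vandermonde determinant of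
    \<open>u\<close>.\<close>
  define c where "c = sdet {1..N} (\<lambda>l j. coeff (lagrange N u j) (l - 1))"
  have vand: "sdet {1..N} (\<lambda>i j. mfun N u j t (y i)) = vandermonde N (\<lambda>i. of_int (y i)) * c" for t and y :: "nat \<Rightarrow> int"
  proof -
    have "\<exists>p. degree p \<le> l \<and> coeff p l = 1 \<and> (\<forall>y. mpoly l t y = poly p y)" for l
      by (rule mpoly_eq_poly[of l t]) blast
    then have "\<exists>p. \<forall>l. degree (p l) \<le> l \<and> coeff (p l) l = 1 \<and> (\<forall>y. mpoly l t y = poly (p l) y)"
      by (intro choice allI)
    then obtain p where p: "\<And>l. degree (p l) \<le> l \<and> coeff (p l) l = 1 \<and> (\<forall>y. mpoly l t y = poly (p l) y)"
      by blast
    have "sdet {1..N} (\<lambda>i j. mfun N u j t (y i)) = sdet {1..N} (\<lambda>i j. \<Sum>l\<in>{1..N}. poly (p (l - 1)) (of_int (y i)) * coeff (lagrange N u j) (l - 1))"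
    proof (rule sdet_cong)
      fix i j
      have "mfun N u j t (y i) = (\<Sum>l<N. poly (p l) (of_int (y i)) * coeff (lagrange N u j) l)"
        using p by (simp add: mfun_def mult.commute)
      also have "\<dots> = (\<Sum>l\<in>{1..N}. poly (p (l - 1)) (of_int (y i)) * coeff (lagrange N u j) (l - 1))"
        by (rule sum.reindex_bij_witness[of _ "\<lambda>l. l - 1" Suc]) auto
      finally show "mfun N u j t (y i) = (\<Sum>l\<in>{1..N}. poly (p (l - 1)) (of_int (y i)) * coeff (lagrange N u j) (l - 1))" .
    qed
    also have "\<dots> = sdet {1..N} (\<lambda>i l. poly (p (l - 1)) (of_int (y i))) * c"
      unfolding c_def by (rule sdet_mult) simp
    also have "sdet {1..N} (\<lambda>i l. poly (p (l - 1)) (of_int (y i))) = vandermonde N (\<lambda>i. of_int (y i)) * (\<Prod>l\<in>{1..N}. coeff (p (l - 1)) (l - 1))"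
      by (rule sdet_poly_columns) (use p in blast)
    also have "(\<Prod>l\<in>{1..N}. coeff (p (l - 1)) (l - 1)) = 1" by (rule prod.neutral) (use p in blast)
    finally show ?thesis by simp
  qed
  have "vandermonde N (\<lambda>i. of_int (u i)) * c = sdet {1..N} (\<lambda>i j. of_bool (i = j))"
    unfolding vand[of 0 u, symmetric] by (rule sdet_cong) (rule m0)
  also have "\<dots> = (1 :: real)" by (subst sdet_triangular[where r = id]) (auto split: if_splits)
  finally have 1: "vandermonde N (\<lambda>i. of_int (u i)) * c = 1" .
  show "sdet {1..N} (\<lambda>i j. mfun N u j t (y i)) * vandermonde N (\<lambda>i. of_int (u i)) = vandermonde N (\<lambda>i. of_int (y i))" for t and y :: "nat \<Rightarrow> int"
    unfolding vand mult.assoc using 1 by (simp add: mult.commute)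
qed

section \<open>Moments from the characteristic function\<close>

lemma poly_small_imp_0:
  fixes d :: "nat \<Rightarrow> complex"
  assumes "\<forall>\<^sub>F x in at_right (0::real). cmod (\<Sum>k\<le>n. d k * of_real x ^ k) \<le> C * x ^ Suc n"
  shows "k \<le> n \<Longrightarrow> d k = 0"
proof (induction k rule: less_induct)
  case (less k)
  \<comment> \<open>The coefficients below \<open>k\<close> vanish by induction; dividing by x^k
    leaves a polynomial that has the value \<open>d k\<close> at 0 and is bounded by C x^(n + 1 -
    k).\<close>
  have "((\<lambda>x. \<Sum>j\<le>n - k. d (k + j) * of_real x ^ j) \<longlongrightarrow> (\<Sum>j\<le>n - k. d (k + j) * of_real 0 ^ j)) (at_right (0::real))"
    by (intro tendsto_intros)
  also have "(\<Sum>j\<le>n - k. d (k + j) * of_real 0 ^ j) = d k"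
    by (subst sum.atMost_shift) simp
  finally have lim1: "((\<lambda>x. \<Sum>j\<le>n - k. d (k + j) * of_real x ^ j) \<longlongrightarrow> d k) (at_right (0::real))" .
  have lim2: "((\<lambda>x. \<Sum>j\<le>n - k. d (k + j) * of_real x ^ j) \<longlongrightarrow> 0) (at_right (0::real))"
  proof (rule Lim_null_comparison)
    show "\<forall>\<^sub>F x in at_right (0::real). norm (\<Sum>j\<le>n - k. d (k + j) * of_real x ^ j) \<le> C * x ^ (Suc n - k)"
      using assms eventually_at_right_less[of 0]
    proof eventually_elim
      case (elim x)
      have "(\<Sum>j\<le>n. d j * of_real x ^ j) = (\<Sum>j\<in>{k..n}. d j * of_real x ^ j)"
        using less.IH by (intro sum.mono_neutral_right) auto
      also have "\<dots> = (\<Sum>j\<le>n - k. d (k + j) * of_real x ^ (k + j))"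
        by (rule sum.reindex_bij_witness[of _ "\<lambda>j. k + j" "\<lambda>j. j - k"]) (use less.prems in auto)
      also have "\<dots> = of_real x ^ k * (\<Sum>j\<le>n - k. d (k + j) * of_real x ^ j)"
        by (simp add: sum_distrib_left power_add mult_ac)
      finally have "cmod (\<Sum>j\<le>n. d j * of_real x ^ j) = x ^ k * cmod (\<Sum>j\<le>n - k. d (k + j) * of_real x ^ j)"
        using elim(2) by (simp add: norm_mult norm_power)
      then have "x ^ k * cmod (\<Sum>j\<le>n - k. d (k + j) * of_real x ^ j) \<le> C * x ^ (Suc n - k + k)"
        using elim(1) less.prems by simp
      then have "x ^ k * cmod (\<Sum>j\<le>n - k. d (k + j) * of_real x ^ j) \<le> x ^ k * (C * x ^ (Suc n - k))"
        by (simp only: power_add mult_ac)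
      then show ?case using elim(2) by (simp only: mult_le_cancel_left_pos zero_less_power)
    qed
    have "((\<lambda>x. C * x ^ (Suc n - k)) \<longlongrightarrow> C * 0 ^ (Suc n - k)) (at_right (0::real))"
      by (intro tendsto_intros)
    then show "((\<lambda>x. C * x ^ (Suc n - k)) \<longlongrightarrow> 0) (at_right (0::real))"
      using less.prems by (simp add: power_0_left)
  qed
  show ?case by (rule tendsto_unique[OF _ lim1 lim2]) simp
qed

text \<open>After subtraction of the Taylor polynomial the series is divisible by X^(n + 1); the
  quotient again has an expansion, so it is continuous at 0 and hence bounded nearby. The zero
  series is treated apart, since its \<open>subdegree\<close> is 0.\<close>

lemma has_fps_expansion_remainder:
  fixes f :: "real \<Rightarrow> real"
  assumes f: "f has_fps_expansion F"
  shows "\<exists>C. \<forall>\<^sub>F x in at_right 0. \<bar>f x - (\<Sum>k\<le>n. fps_nth F k * x ^ k)\<bar> \<le> C * x ^ Suc n"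
proof -
  define p where "p x = (\<Sum>k\<le>n. fps_nth F k * x ^ k)" for x
  define H where "H = F - (\<Sum>k\<le>n. fps_const (fps_nth F k) * fps_X ^ k)"
  have "p has_fps_expansion (\<Sum>k\<le>n. fps_const (fps_nth F k) * fps_X ^ k)"
    unfolding p_def by (intro fps_expansion_intros)
  with f have fH: "(\<lambda>x. f x - p x) has_fps_expansion H"
    unfolding H_def by (rule has_fps_expansion_diff)
  have H0: "fps_nth H k = 0" if "k < Suc n" for k
    using that by (simp add: H_def fps_sum_nth if_distrib[where f="\<lambda>x. _ * x"] sum.delta' less_Suc_eq_le cong: if_cong)
  show ?thesis
  proof (cases "H = 0")
    case True
    have "\<forall>\<^sub>F x in nhds 0. eval_fps H x = f x - p x" using fH by (simp add: has_fps_expansion_def)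
    then have "\<forall>\<^sub>F x in at_right 0. f x - p x = 0"
      unfolding True by (intro eventually_at_filter[THEN iffD2]) (auto elim!: eventually_mono)
    then have "\<forall>\<^sub>F x in at_right 0. \<bar>f x - (\<Sum>k\<le>n. fps_nth F k * x ^ k)\<bar> \<le> 0 * x ^ Suc n"
      by eventually_elim (simp add: p_def)
    then show ?thesis by blast
  next
    case False
    have sub: "Suc n \<le> subdegree H" by (rule subdegree_geI[OF False H0])
    define g where "g x = (if x = 0 then fps_nth H (Suc n) else (f x - p x) / x ^ Suc n)" for x
    have "g has_fps_expansion fps_shift (Suc n) H"
      unfolding g_def by (rule has_fps_expansion_shift[OF fH sub refl])
    then have "continuous (at 0) g" by (rule has_fps_expansion_imp_continuous)
    then have "(g \<longlongrightarrow> g 0) (at_right 0)"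
      by (simp add: continuous_within filterlim_at_split)
    then have "((\<lambda>x. \<bar>g x\<bar>) \<longlongrightarrow> \<bar>g 0\<bar>) (at_right 0)" by (rule tendsto_rabs)
    then have "\<forall>\<^sub>F x in at_right 0. \<bar>g x\<bar> < \<bar>g 0\<bar> + 1" by (rule order_tendstoD) simp
    then have "\<forall>\<^sub>F x in at_right 0. \<bar>f x - (\<Sum>k\<le>n. fps_nth F k * x ^ k)\<bar> \<le> (\<bar>g 0\<bar> + 1) * x ^ Suc n"
      using eventually_at_right_less[of 0]
    proof eventually_elim
      case (elim x)
      have "f x - p x = g x * x ^ Suc n" using elim(2) by (simp add: g_def)
      then have "\<bar>f x - p x\<bar> = \<bar>g x\<bar> * x ^ Suc n" using elim(2) by (simp add: abs_mult del: power_Suc)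
      also have "\<dots> \<le> (\<bar>g 0\<bar> + 1) * x ^ Suc n" using elim by (intro mult_right_mono) auto
      finally show ?case unfolding p_def .
    qed
    then show ?thesis by blast
  qed
qed

lemma cosh_power_has_fps_expansion:
  "(\<lambda>x::real. (1 / cosh x) ^ t) has_fps_expansion inverse fps_cosh ^ t"
proof (induction t)
  case (Suc t)
  have "(\<lambda>x::real. (1 / 2) * (exp (1 * x) + exp (- 1 * x))) has_fps_expansion fps_cosh"
    unfolding fps_cosh_def by (intro fps_expansion_intros)
  then have "(\<lambda>x::real. inverse ((1 / 2) * (exp (1 * x) + exp (- 1 * x)))) has_fps_expansion inverse fps_cosh"
    by (rule has_fps_expansion_inverse) (simp add: fps_cosh_0)
  also have "(\<lambda>x::real. inverse ((1 / 2) * (exp (1 * x) + exp (- 1 * x)))) = (\<lambda>x. 1 / cosh x)"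
    by (simp add: cosh_def fun_eq_iff field_simps)
  finally have "(\<lambda>x::real. 1 / cosh x) has_fps_expansion inverse fps_cosh" .
  then show ?case unfolding power_Suc using Suc by (rule has_fps_expansion_mult)
qed simp

text \<open>Near 0 the characteristic function has two polynomial approximations up to O(x^(n + 1)),
  one from the moments and one from the series of the power of 1 / cosh; their coefficients must
  agree.\<close>

lemma moments_of_char:
  assumes M: "real_distribution M" and int: "\<And>k. integrable M (\<lambda>x. x ^ k)"
    and char: "\<And>x. char M x = complex_of_real ((1 / cosh x) ^ t)"
  shows "(\<integral>w. (\<i> * complex_of_real w) ^ n \<partial>M) = complex_of_real (fact n * fps_nth (inverse fps_cosh ^ t) n)"
proof -
  interpret real_distribution M by (rule M)
  define e where "e k = expectation (\<lambda>x. x ^ k)" for k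
  define d where "d k = \<i> ^ k * complex_of_real (e k) / fact k - complex_of_real (fps_nth (inverse fps_cosh ^ t) k)" for k
  obtain C where C: "\<forall>\<^sub>F x in at_right 0. \<bar>(1 / cosh x) ^ t - (\<Sum>k\<le>n. fps_nth (inverse fps_cosh ^ t) k * x ^ k)\<bar> \<le> C * x ^ Suc n"
    using has_fps_expansion_remainder[OF cosh_power_has_fps_expansion] by blast
  \<comment> \<open>The error in \<open>char_approx1\<close> has the same order as the last term of
    its sum, so it is applied up to n + 1; that extra term is of order x^(n + 1) and joins the
    bound.\<close>
  define E where "E = 2 / fact (Suc n) * expectation (\<lambda>x. \<bar>x\<bar> ^ Suc n) + cmod (\<i> ^ Suc n * complex_of_real (e (Suc n)) / fact (Suc n))"
  have bound: "\<forall>\<^sub>F x in at_right (0::real). cmod (\<Sum>k\<le>n. d k * of_real x ^ k) \<le> (E + C) * x ^ Suc n"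
    using C eventually_at_right_less[of 0]
  proof eventually_elim
    case (elim x)
    let ?a = "\<lambda>k. \<i> ^ k * complex_of_real (e k) / fact k"
    have eq: "(\<Sum>k\<le>n. d k * of_real x ^ k) = (\<Sum>k\<le>n. ?a k * of_real x ^ k) - complex_of_real (\<Sum>k\<le>n. fps_nth (inverse fps_cosh ^ t) k * x ^ k)"
      by (simp add: d_def left_diff_distrib sum_subtractf)
    have "cmod (char M x - (\<Sum>k\<le>Suc n. ((\<i> * x) ^ k / fact k) * expectation (\<lambda>x. x ^ k))) \<le> (2 * \<bar>x\<bar> ^ Suc n / fact (Suc n)) * expectation (\<lambda>x. \<bar>x\<bar> ^ Suc n)"
      by (rule char_approx1) (rule int)
    also have "(\<Sum>k\<le>Suc n. ((\<i> * x) ^ k / fact k) * expectation (\<lambda>x. x ^ k)) = (\<Sum>k\<le>Suc n. ?a k * of_real x ^ k)"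
      by (intro sum.cong refl) (simp add: e_def power_mult_distrib)
    finally have 1: "cmod (char M x - (\<Sum>k\<le>Suc n. ?a k * of_real x ^ k)) \<le> 2 / fact (Suc n) * expectation (\<lambda>x. \<bar>x\<bar> ^ Suc n) * x ^ Suc n"
      using elim(2) by (simp add: mult_ac)
    have 2: "cmod (char M x - complex_of_real (\<Sum>k\<le>n. fps_nth (inverse fps_cosh ^ t) k * x ^ k)) \<le> C * x ^ Suc n"
      using elim(1) unfolding char of_real_diff[symmetric] norm_of_real .
    have 3: "cmod (?a (Suc n) * of_real x ^ Suc n) = cmod (?a (Suc n)) * x ^ Suc n"
      using elim(2) by (simp only: norm_mult norm_power norm_of_real abs_of_pos)
    have "(\<Sum>k\<le>n. d k * of_real x ^ k) = (char M x - complex_of_real (\<Sum>k\<le>n. fps_nth (inverse fps_cosh ^ t) k * x ^ k))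
        - (char M x - (\<Sum>k\<le>Suc n. ?a k * of_real x ^ k)) - ?a (Suc n) * of_real x ^ Suc n"
      unfolding eq sum.atMost_Suc by simp
    then have "cmod (\<Sum>k\<le>n. d k * of_real x ^ k) \<le> cmod (char M x - complex_of_real (\<Sum>k\<le>n. fps_nth (inverse fps_cosh ^ t) k * x ^ k))
        + cmod (char M x - (\<Sum>k\<le>Suc n. ?a k * of_real x ^ k)) + cmod (?a (Suc n) * of_real x ^ Suc n)"
      by (simp only:) (rule order.trans[OF norm_triangle_ineq4 add_right_mono[OF norm_triangle_ineq4]])
    also have "\<dots> \<le> C * x ^ Suc n + 2 / fact (Suc n) * expectation (\<lambda>x. \<bar>x\<bar> ^ Suc n) * x ^ Suc n + cmod (?a (Suc n)) * x ^ Suc n"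
      unfolding 3 by (intro add_mono 1 2 order.refl)
    also have "\<dots> = (E + C) * x ^ Suc n" unfolding E_def by (simp only: distrib_right add_ac)
    finally show ?case .
  qed
  have "d n = 0" using poly_small_imp_0[OF bound] by simp
  then have "\<i> ^ n * complex_of_real (e n) = complex_of_real (fact n * fps_nth (inverse fps_cosh ^ t) n)"
    by (simp add: d_def field_simps)
  moreover have "(\<integral>w. (\<i> * complex_of_real w) ^ n \<partial>M) = \<i> ^ n * complex_of_real (e n)"
    using int[of n] by (simp add: power_mult_distrib e_def flip: of_real_power)
  ultimately show ?thesis by simp
qed

lemma map_poly_of_real_prod:
  "map_poly complex_of_real (\<Prod>i\<in>I. p i) = (\<Prod>i\<in>I. map_poly complex_of_real (p i))"
proof (induction I rule: infinite_finite_induct)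
  case (insert i I)
  have "map_poly complex_of_real (p * q) = map_poly complex_of_real p * map_poly complex_of_real q" for p q
    by (rule poly_eqI) (simp add: coeff_map_poly coeff_mult)
  then show ?case using insert by simp
qed simp_all

text \<open>\<open>Phi\<close> is the Lagrange polynomial read over the complex numbers, and the
  binomial expansion of (y + i w)^l turns the moments into \<open>mpoly\<close>.\<close>

lemma integral_Phi_eq_mfun:
  assumes M: "real_distribution M" and int: "\<And>k. integrable M (\<lambda>x. x ^ k)"
    and mom: "\<And>n. (\<integral>w. (\<i> * complex_of_real w) ^ n \<partial>M) = complex_of_real (fact n * fps_nth (inverse fps_cosh ^ t) n)"
    and j: "j \<in> {1..N}"
  shows "(\<integral>w. Phi N u j (of_int y + \<i> * complex_of_real w) \<partial>M) = complex_of_real (mfun N u j t y)"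
proof -
  have int': "integrable M (\<lambda>w. (\<i> * complex_of_real w) ^ n)" for n
    using int[of n] by (simp add: power_mult_distrib flip: of_real_power)
  have Phi: "Phi N u j z = (\<Sum>l<N. complex_of_real (coeff (lagrange N u j) l) * z ^ l)" for z
  proof -
    have "Phi N u j z = poly (map_poly complex_of_real (lagrange N u j)) z"
    proof -
      have "Phi N u j z = (\<Prod>i\<in>{1..N} - {j}. poly (map_poly complex_of_real (Polynomial.smult (1 / of_int (u j - u i)) [:- of_int (u i), 1:])) z)"
        unfolding Phi_def by (intro prod.cong refl) (simp add: map_poly_pCons diff_divide_distrib)
      also have "\<dots> = poly (map_poly complex_of_real (lagrange N u j)) z"
        unfolding lagrange_def map_poly_of_real_prod poly_prod ..
      finally show ?thesis .
    qed
    also have "\<dots> = (\<Sum>l<N. coeff (map_poly complex_of_real (lagrange N u j)) l * z ^ l)"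
    proof -
      have "degree (map_poly complex_of_real (lagrange N u j)) < N"
        using degree_lagrange[OF j, of u] by (simp add: degree_map_poly)
      then show ?thesis unfolding poly_altdef
        by (intro sum.mono_neutral_left) (auto simp: coeff_eq_0)
    qed
    also have "\<dots> = (\<Sum>l<N. complex_of_real (coeff (lagrange N u j) l) * z ^ l)"
      by (simp add: coeff_map_poly)
    finally show ?thesis .
  qed
  have pw: "(of_int y + \<i> * complex_of_real w) ^ l = (\<Sum>i\<le>l. of_nat (l choose i) * of_int y ^ i * (\<i> * complex_of_real w) ^ (l - i))" for w l
    by (rule binomial_ring)
  have pint: "(\<integral>w. (of_int y + \<i> * complex_of_real w) ^ l \<partial>M) = complex_of_real (mpoly l t (of_int y))" for l
  proof -
    have "(\<integral>w. (of_int y + \<i> * complex_of_real w) ^ l \<partial>M) = (\<Sum>i\<le>l. \<integral>w. of_nat (l choose i) * of_int y ^ i * (\<i> * complex_of_real w) ^ (l - i) \<partial>M)"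
      unfolding pw by (rule Bochner_Integration.integral_sum) (intro integrable_mult_right int')
    also have "\<dots> = (\<Sum>i\<le>l. of_nat (l choose i) * of_int y ^ i * complex_of_real (fact (l - i) * fps_nth (inverse fps_cosh ^ t) (l - i)))"
      by (simp add: mom)
    also have "\<dots> = complex_of_real (mpoly l t (of_int y))"
      by (simp add: mpoly_eq_sum)
    finally show ?thesis .
  qed
  have pint': "integrable M (\<lambda>w. (of_int y + \<i> * complex_of_real w) ^ l)" for l
    unfolding pw by (intro Bochner_Integration.integrable_sum integrable_mult_right int')
  have "(\<integral>w. Phi N u j (of_int y + \<i> * complex_of_real w) \<partial>M)
     = (\<Sum>l<N. \<integral>w. complex_of_real (coeff (lagrange N u j) l) * (of_int y + \<i> * complex_of_real w) ^ l \<partial>M)"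
    unfolding Phi by (rule Bochner_Integration.integral_sum) (intro integrable_mult_right pint')
  then show ?thesis by (simp add: pint mfun_def)
qed

section \<open>Brownian motion at an independent random time\<close>

text \<open>Euler's product for the sine of pi z at the imaginary point z = i x / pi.\<close>

lemma sinh_product:
  fixes x :: real
  shows "(\<lambda>n. x * (\<Prod>k=1..n. 1 + x\<^sup>2 / (pi\<^sup>2 * (real k)\<^sup>2))) \<longlonglongrightarrow> sinh x"
proof -
  define z where "z = \<i> * complex_of_real (x / pi)"
  have "(\<lambda>n. of_real pi * z * (\<Prod>k=1..n. 1 - z^2 / of_nat k^2)) \<longlonglongrightarrow> sin (of_real pi * z)"
    by (rule sin_product_formula_complex)
  moreover have "of_real pi * z = \<i> * complex_of_real x" by (simp add: z_def)
  moreover have "1 - z^2 / of_nat k^2 = complex_of_real (1 + x\<^sup>2 / (pi\<^sup>2 * (real k)\<^sup>2))" for k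
    by (simp add: z_def power_mult_distrib power_divide)
  moreover have "sin (\<i> * complex_of_real x) = \<i> * complex_of_real (sinh x)"
    by (simp add: sinh_field_def sin_exp_eq exp_of_real[symmetric] exp_minus field_simps flip: of_real_minus)
       (simp add: exp_minus_inverse)
  ultimately have "(\<lambda>n. \<i> * complex_of_real x * (\<Prod>k=1..n. complex_of_real (1 + x\<^sup>2 / (pi\<^sup>2 * (real k)\<^sup>2)))) \<longlonglongrightarrow> \<i> * complex_of_real (sinh x)"
    by (simp only:)
  then have T: "(\<lambda>n. Im (\<i> * complex_of_real x * (\<Prod>k=1..n. complex_of_real (1 + x\<^sup>2 / (pi\<^sup>2 * (real k)\<^sup>2))))) \<longlonglongrightarrow> Im (\<i> * complex_of_real (sinh x))"
    by (rule tendsto_Im)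
  have im: "Im (\<i> * complex_of_real a * complex_of_real b) = a * b" "Im (\<i> * complex_of_real a) = a" for a b by simp_all
  show ?thesis using T unfolding of_real_prod[symmetric] im .
qed

text \<open>The odd factors of the product of \<open>sinh (2 x)\<close> remain after division by \<open>2 sinh x\<close>.\<close>

lemma cosh_product:
  fixes x :: real
  shows "(\<lambda>n. \<Prod>l<n. 1 + x\<^sup>2 / (pi\<^sup>2 * (real l + 1 / 2)\<^sup>2)) \<longlonglongrightarrow> cosh x"
proof (cases "x = 0")
  case False
  define A where "A y n = y * (\<Prod>k=1..n. 1 + y\<^sup>2 / (pi\<^sup>2 * (real k)\<^sup>2))" for y :: real and n
  have A: "A y \<longlonglongrightarrow> sinh y" for y unfolding A_def by (rule sinh_product)
  have A0: "A x n \<noteq> 0" for n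
  proof -
    have "(\<Prod>k=1..n. 1 + x\<^sup>2 / (pi\<^sup>2 * (real k)\<^sup>2)) > 0" by (intro prod_pos ballI add_pos_nonneg) auto
    then show ?thesis using False unfolding A_def by (metis less_irrefl mult_eq_0_iff)
  qed
  have split: "(\<Prod>k=1..2*n. 1 + (2 * x)\<^sup>2 / (pi\<^sup>2 * (real k)\<^sup>2))
    = (\<Prod>l<n. 1 + x\<^sup>2 / (pi\<^sup>2 * (real l + 1 / 2)\<^sup>2)) * (\<Prod>k=1..n. 1 + x\<^sup>2 / (pi\<^sup>2 * (real k)\<^sup>2))" for n
  proof (induction n)
    case (Suc n)
    let ?f = "\<lambda>k. 1 + (2 * x)\<^sup>2 / (pi\<^sup>2 * (real k)\<^sup>2)"
    have "{1..2 * Suc n} = insert (2 * n + 2) (insert (2 * n + 1) {1..2 * n})" by auto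
    then have P: "(\<Prod>k=1..2 * Suc n. ?f k) = ?f (2 * n + 2) * (?f (2 * n + 1) * (\<Prod>k=1..2 * n. ?f k))" by simp
    have f1: "?f (2 * n + 1) = 1 + x\<^sup>2 / (pi\<^sup>2 * (real n + 1 / 2)\<^sup>2)"
    proof -
      have "real (2 * n + 1) = 2 * (real n + 1 / 2)" by simp
      then show ?thesis by (simp only: power_mult_distrib) (simp add: mult.left_commute)
    qed
    have f2: "?f (2 * n + 2) = 1 + x\<^sup>2 / (pi\<^sup>2 * (real (Suc n))\<^sup>2)"
    proof -
      have "real (2 * n + 2) = 2 * real (Suc n)" by simp
      then show ?thesis by (simp only: power_mult_distrib) (simp add: mult.left_commute)
    qed
    have "(\<Prod>k=1..Suc n. 1 + x\<^sup>2 / (pi\<^sup>2 * (real k)\<^sup>2)) = (\<Prod>k=1..n. 1 + x\<^sup>2 / (pi\<^sup>2 * (real k)\<^sup>2)) * (1 + x\<^sup>2 / (pi\<^sup>2 * (real (Suc n))\<^sup>2))"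
      by (simp add: atLeastAtMostSuc_conv mult.commute)
    then show ?case unfolding P f1 f2 Suc.IH prod.lessThan_Suc by (simp only: mult_ac)
  qed simp
  have "(\<lambda>n. A (2 * x) (2 * n)) \<longlonglongrightarrow> sinh (2 * x)"
    using LIMSEQ_subseq_LIMSEQ[OF A[of "2 * x"], of "\<lambda>n. 2 * n"] by (simp add: strict_mono_def o_def)
  then have "(\<lambda>n. A (2 * x) (2 * n) / (2 * A x n)) \<longlonglongrightarrow> sinh (2 * x) / (2 * sinh x)"
    using False by (intro tendsto_intros A) auto
  moreover have "A (2 * x) (2 * n) / (2 * A x n) = (\<Prod>l<n. 1 + x\<^sup>2 / (pi\<^sup>2 * (real l + 1 / 2)\<^sup>2))" for n
  proof -
    have "A (2 * x) (2 * n) = (2 * A x n) * (\<Prod>l<n. 1 + x\<^sup>2 / (pi\<^sup>2 * (real l + 1 / 2)\<^sup>2))"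
      unfolding A_def split by (simp only: mult_ac)
    then show ?thesis using A0[of n] by simp
  qed
  moreover have "sinh (2 * x) / (2 * sinh x) = cosh x" using False by (simp add: sinh_double)
  ultimately show ?thesis by simp
qed simp

section \<open>Exponential moments of gamma and Gaussian variables\<close>

lemma has_bochner_integral_erlang:
  assumes "0 < l" shows "has_bochner_integral lborel (erlang_density k l) 1"
proof (rule has_bochner_integral_nn_integral)
  show "(\<integral>\<^sup>+ x. ennreal (erlang_density k l x) \<partial>lborel) = ennreal 1"
    using nn_integral_erlang_ith_moment[OF assms, of k 0] by simp
qed (use assms in auto)

text \<open>Multiplying the density by exp(-a x) gives a multiple of an Erlang density of rate 1 +
  a. Negative \<open>a\<close> is included because the clock is shown to have a finite positive
  exponential moment.\<close>

lemma (in prob_space) gamma_mgf: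
  assumes X: "distributed M lborel X (gamma_density t)" and t: "1 \<le> t" and a: "a > -1"
  shows "integrable M (\<lambda>\<omega>. exp (- a * X \<omega>))" "expectation (\<lambda>\<omega>. exp (- a * X \<omega>)) = (1 / (1 + a)) ^ t"
    "AE \<omega> in M. 0 < X \<omega>"
proof -
  have G: "Gamma (real t) = fact (t - 1)" using Gamma_fact[of "t - 1", where 'a = real] t by (simp add: of_nat_diff)
  have nonneg: "0 \<le> gamma_density t x" for x by (auto simp: gamma_density_def G)
  have [measurable]: "gamma_density t \<in> borel_measurable borel" unfolding gamma_density_def by measurable
  \<comment> \<open>At 0 the two sides differ for t = 1, so this point is left out and later
    discarded as a null set.\<close>
  have eq: "gamma_density t x * exp (- a * x) = (1 / (1 + a)) ^ t * erlang_density (t - 1) (1 + a) x" if "x \<noteq> 0" for x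
  proof -
    define b where "b = 1 + a"
    have b: "(1 / b) ^ t * b ^ Suc (t - 1) = 1" using a t by (simp add: b_def power_divide)
    have e: "exp (- x) * exp (- a * x) = exp (- b * x)" by (simp add: b_def algebra_simps flip: exp_add)
    show ?thesis
    proof (cases "x < 0")
      case False
      then have "gamma_density t x * exp (- a * x) = x ^ (t - 1) * (exp (- x) * exp (- a * x)) / fact (t - 1)"
        using that by (simp add: gamma_density_def G)
      also have "\<dots> = ((1 / b) ^ t * b ^ Suc (t - 1)) * (x ^ (t - 1) * exp (- b * x) / fact (t - 1))"
        unfolding e b by simp
      also have "\<dots> = (1 / b) ^ t * erlang_density (t - 1) b x"
        unfolding erlang_density_def using False by (simp add: mult_ac)
      finally show ?thesis unfolding b_def .
    qed (simp add: gamma_density_def erlang_density_def)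
  qed
  have hb: "has_bochner_integral lborel (\<lambda>x. gamma_density t x * exp (- a * x)) ((1 / (1 + a)) ^ t * 1)"
  proof (rule has_bochner_integralI_AE)
    show "has_bochner_integral lborel (\<lambda>x. (1 / (1 + a)) ^ t * erlang_density (t - 1) (1 + a) x) ((1 / (1 + a)) ^ t * 1)"
      using a by (intro has_bochner_integral_mult_right has_bochner_integral_erlang) auto
    show "AE x in lborel. (1 / (1 + a)) ^ t * erlang_density (t - 1) (1 + a) x = gamma_density t x * exp (- a * x)"
      using AE_lborel_singleton[of 0] by eventually_elim (rule eq[symmetric])
  qed measurable
  show "integrable M (\<lambda>\<omega>. exp (- a * X \<omega>))"
    using distributed_integrable[OF X, of "\<lambda>x. exp (- a * x)"] hb nonneg by (simp add: has_bochner_integral_iff)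
  show "expectation (\<lambda>\<omega>. exp (- a * X \<omega>)) = (1 / (1 + a)) ^ t"
    using distributed_integral[OF X, of "\<lambda>x. exp (- a * x)"] hb nonneg by (simp add: has_bochner_integral_iff)
  have "AE x in lborel. 0 < ennreal (gamma_density t x) \<longrightarrow> 0 < x"
    by (auto simp: gamma_density_def)
  then show "AE \<omega> in M. 0 < X \<omega>" using distributed_AE2[OF X, of "\<lambda>x. 0 < x"] by simp
qed

text \<open>Completing the square: the factor exp(a x) shifts the mean to a s^2.\<close>

lemma has_bochner_integral_exp_normal:
  assumes s: "0 < s"
  shows "has_bochner_integral lborel (\<lambda>x. normal_density 0 s x * exp (a * x)) (exp (a\<^sup>2 * s\<^sup>2 / 2))"
proof -
  have "normal_density 0 s x * exp (a * x) = exp (a\<^sup>2 * s\<^sup>2 / 2) * normal_density (a * s\<^sup>2) s x" for x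
  proof -
    have "- x\<^sup>2 / (2 * s\<^sup>2) + a * x = a\<^sup>2 * s\<^sup>2 / 2 + - (x - a * s\<^sup>2)\<^sup>2 / (2 * s\<^sup>2)"
      using s by (simp add: field_simps power2_eq_square)
    then have "exp (- x\<^sup>2 / (2 * s\<^sup>2)) * exp (a * x) = exp (a\<^sup>2 * s\<^sup>2 / 2) * exp (- (x - a * s\<^sup>2)\<^sup>2 / (2 * s\<^sup>2))"
      by (simp only: exp_add[symmetric])
    then show ?thesis by (simp add: normal_density_def)
  qed
  then show ?thesis using s by (simp add: has_bochner_integral_iff integrable_normal_density integral_normal_density)
qed

lemma bm_exp_moments:
  assumes bm: "brownian_motion Q W" and s: "0 \<le> s"
  shows "W s \<in> borel_measurable Q"
    and "integrable Q (\<lambda>\<omega>. exp (a * W s \<omega>))" "(\<integral>\<omega>. exp (a * W s \<omega>) \<partial>Q) = exp (a\<^sup>2 * s / 2)"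
    and "(\<integral>\<omega>. iexp (a * W s \<omega>) \<partial>Q) = complex_of_real (exp (- (a\<^sup>2 * s / 2)))"
proof -
  interpret prob_space Q using bm by (simp add: brownian_motion_def)
  show meas[measurable]: "W s \<in> borel_measurable Q" using bm s by (simp add: brownian_motion_def)
  have W0: "W 0 \<omega> = 0" if "\<omega> \<in> space Q" for \<omega> using bm that by (simp add: brownian_motion_def)
  have "integrable Q (\<lambda>\<omega>. exp (a * W s \<omega>)) \<and> expectation (\<lambda>\<omega>. exp (a * W s \<omega>)) = exp (a\<^sup>2 * s / 2)
    \<and> expectation (\<lambda>\<omega>. iexp (a * W s \<omega>)) = complex_of_real (exp (- (a\<^sup>2 * s / 2)))"
  proof (cases "s = 0")
    \<comment> \<open>The Gaussian law is given only for increments over intervals of positive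
      length, so time 0 is separate.\<close>
    case True
    have e: "expectation (\<lambda>\<omega>. exp (a * W s \<omega>)) = expectation (\<lambda>\<omega>. 1)" "expectation (\<lambda>\<omega>. iexp (a * W s \<omega>)) = expectation (\<lambda>\<omega>. 1)"
      by (rule Bochner_Integration.integral_cong; simp add: W0 True)+
    have "integrable Q (\<lambda>\<omega>. exp (a * W s \<omega>)) \<longleftrightarrow> integrable Q (\<lambda>\<omega>. 1 :: real)"
      by (rule Bochner_Integration.integrable_cong) (simp_all add: W0 True)
    then show ?thesis unfolding e using True by (simp add: prob_space)
  next
    case False
    then have s: "0 < s" using s by simp
    let ?X = "\<lambda>\<omega>. W s \<omega> - W 0 \<omega>"
    have "distributed Q lborel ?X (normal_density 0 (sqrt (s - 0)))"
      using bm s unfolding brownian_motion_def by blast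
    then have X: "distributed Q lborel ?X (normal_density 0 (sqrt s))" by simp
    have XW: "?X \<omega> = W s \<omega>" if "\<omega> \<in> space Q" for \<omega> using W0[OF that] by simp
    note hb = has_bochner_integral_exp_normal[of "sqrt s" a]
    have "integrable Q (\<lambda>\<omega>. exp (a * ?X \<omega>))"
      using distributed_integrable[OF X, of "\<lambda>x. exp (a * x)"] hb s by (simp add: has_bochner_integral_iff)
    moreover have "integrable Q (\<lambda>\<omega>. exp (a * ?X \<omega>)) \<longleftrightarrow> integrable Q (\<lambda>\<omega>. exp (a * W s \<omega>))"
      by (rule Bochner_Integration.integrable_cong) (simp_all add: XW)
    moreover have "expectation (\<lambda>\<omega>. exp (a * ?X \<omega>)) = exp (a\<^sup>2 * s / 2)"
      using distributed_integral[OF X, of "\<lambda>x. exp (a * x)"] hb s by (simp add: has_bochner_integral_iff)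
    moreover have "expectation (\<lambda>\<omega>. exp (a * ?X \<omega>)) = expectation (\<lambda>\<omega>. exp (a * W s \<omega>))"
      by (rule Bochner_Integration.integral_cong) (simp_all add: XW)
    moreover have "expectation (\<lambda>\<omega>. iexp (a * W s \<omega>)) = complex_of_real (exp (- (a\<^sup>2 * s / 2)))"
    proof -
      have "distributed Q lborel (\<lambda>\<omega>. (?X \<omega> - 0) / sqrt s) std_normal_density"
        using X s by (subst normal_standard_normal_convert[symmetric]) simp_all
      then have Y: "distr Q lborel (\<lambda>\<omega>. ?X \<omega> / sqrt s) = std_normal_distribution"
        using distributed_distr_eq_density by fastforce
      have "W 0 \<in> borel_measurable Q" using bm by (simp add: brownian_motion_def)
      then have Ym: "(\<lambda>\<omega>. ?X \<omega> / sqrt s) \<in> measurable Q lborel" by simp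
      have "char std_normal_distribution (a * sqrt s) = (\<integral>x. iexp (a * sqrt s * x) \<partial>distr Q lborel (\<lambda>\<omega>. ?X \<omega> / sqrt s))"
        unfolding Y char_def ..
      also have "\<dots> = expectation (\<lambda>\<omega>. iexp (a * sqrt s * (?X \<omega> / sqrt s)))"
        by (rule integral_distr[OF Ym]) simp
      also have "\<dots> = expectation (\<lambda>\<omega>. iexp (a * W s \<omega>))"
        by (rule Bochner_Integration.integral_cong) (use s in \<open>simp_all add: XW\<close>)
      finally show ?thesis using s by (simp add: char_std_normal_distribution power_mult_distrib)
    qed
    ultimately show ?thesis by simp
  qed
  then show "integrable Q (\<lambda>\<omega>. exp (a * W s \<omega>))" "(\<integral>\<omega>. exp (a * W s \<omega>) \<partial>Q) = exp (a\<^sup>2 * s / 2)"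
    "(\<integral>\<omega>. iexp (a * W s \<omega>) \<partial>Q) = complex_of_real (exp (- (a\<^sup>2 * s / 2)))" by auto
qed

section \<open>From fixed times to an independent random time\<close>

lemma fatou_bound:
  assumes f: "\<And>n. f n \<in> borel_measurable M" "g \<in> borel_measurable M"
    and lim: "AE x in M. (\<lambda>n. f n x) \<longlonglongrightarrow> g x"
    and K: "\<And>n. (\<integral>\<^sup>+x. ennreal (f n x) \<partial>M) \<le> K"
  shows "(\<integral>\<^sup>+x. ennreal (g x) \<partial>M) \<le> K"
proof -
  have "(\<integral>\<^sup>+x. ennreal (g x) \<partial>M) = (\<integral>\<^sup>+x. liminf (\<lambda>n. ennreal (f n x)) \<partial>M)"
  proof (rule nn_integral_cong_AE)
    show "AE x in M. ennreal (g x) = liminf (\<lambda>n. ennreal (f n x))"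
      using lim
    proof eventually_elim
      case (elim x)
      from tendsto_ennrealI[OF this] show ?case by (rule lim_imp_Liminf[OF trivial_limit_sequentially, symmetric])
    qed
  qed
  also have "\<dots> \<le> liminf (\<lambda>n. \<integral>\<^sup>+x. ennreal (f n x) \<partial>M)"
    by (rule nn_integral_liminf) (use f in measurable)
  also have "\<dots> \<le> liminf (\<lambda>n::nat. K)" by (rule Liminf_mono) (simp add: K)
  finally show ?thesis by (simp add: Liminf_const)
qed

text \<open>A bounded approximation of \<open>x\<close> from below by \<open>grid n x / Suc n\<close> with finitely many values, so that
  expectations at an independent random time reduce to fixed times.\<close>

definition grid :: "nat \<Rightarrow> real \<Rightarrow> nat" where
  "grid n x = min (nat \<lfloor>real (Suc n) * x\<rfloor>) (Suc n * Suc n)"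

lemma grid_measurable: "grid n \<in> measurable borel (count_space UNIV)"
  unfolding grid_def by measurable

lemma grid_le: "grid n x \<le> Suc n * Suc n"
  by (simp add: grid_def)

lemma grid_div_le: 
  assumes "0 \<le> x" shows "real (grid n x) / real (Suc n) \<le> x"
proof -
  have "real (grid n x) \<le> real (nat \<lfloor>real (Suc n) * x\<rfloor>)" by (simp add: grid_def)
  also have "\<dots> \<le> real (Suc n) * x" by (rule of_nat_floor) (use assms in simp)
  finally show ?thesis by (simp add: divide_le_eq mult.commute)
qed

lemma grid_tendsto:
  assumes x: "0 \<le> x" shows "(\<lambda>n. real (grid n x) / real (Suc n)) \<longlonglongrightarrow> x"
proof (rule tendsto_sandwich)
  show "\<forall>\<^sub>F n in sequentially. real (grid n x) / real (Suc n) \<le> x" using grid_div_le[OF x] by simp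
  show "\<forall>\<^sub>F n in sequentially. x - 1 / real (Suc n) \<le> real (grid n x) / real (Suc n)"
    using eventually_ge_at_top[of "nat \<lceil>x\<rceil>"]
  proof eventually_elim
    case (elim n)
    have nx: "x \<le> real (Suc n)" using elim x by linarith
    have "real (Suc n) * x \<le> real (Suc n) * real (Suc n)" using nx by (intro mult_left_mono) auto
    then have "nat \<lfloor>real (Suc n) * x\<rfloor> \<le> Suc n * Suc n"
      by (simp only: of_nat_mult[symmetric] nat_le_iff) (simp add: floor_le_iff)
    then have "real (grid n x) = real_of_int \<lfloor>real (Suc n) * x\<rfloor>" using x by (simp add: grid_def)
    then have "real (Suc n) * x - 1 \<le> real (grid n x)" by linarith
    then have "(real (Suc n) * x - 1) / real (Suc n) \<le> real (grid n x) / real (Suc n)" by (intro divide_right_mono) auto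
    moreover have "(real (Suc n) * x - 1) / real (Suc n) = x - 1 / real (Suc n)" by (simp add: field_simps del: of_nat_Suc)
    ultimately show ?case by simp
  qed
  have "(\<lambda>n. x - 1 / real (Suc n)) \<longlonglongrightarrow> x - 0" by (intro tendsto_intros LIMSEQ_Suc[OF lim_1_over_n])
  then show "(\<lambda>n. x - 1 / real (Suc n)) \<longlonglongrightarrow> x" by simp
qed simp

locale independent_time = prob_space Q for Q :: "'b measure" +
  fixes W :: "real \<Rightarrow> 'b \<Rightarrow> real" and C :: "'b \<Rightarrow> real"
  assumes bm: "brownian_motion Q W" and C: "C \<in> borel_measurable Q" "\<And>\<omega>. 0 \<le> C \<omega>"
    and indep: "\<And>s. 0 \<le> s \<Longrightarrow> indep_var borel (W s) borel C"
begin

lemma W_measurable [measurable]: "0 \<le> s \<Longrightarrow> W s \<in> borel_measurable Q"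
  using bm by (simp add: brownian_motion_def)

definition gtime :: "nat \<Rightarrow> 'b \<Rightarrow> real" where
  "gtime n \<omega> = real (grid n (C \<omega>)) / real (Suc n)"

lemma grid_event: "{\<omega> \<in> space Q. grid n (C \<omega>) = j} \<in> events"
proof -
  have "(\<lambda>\<omega>. grid n (C \<omega>)) \<in> measurable Q (count_space UNIV)"
    by (rule measurable_compose[OF C(1) grid_measurable])
  then have "(\<lambda>\<omega>. grid n (C \<omega>)) -` {j} \<inter> space Q \<in> events" by (rule measurable_sets) simp
  also have "(\<lambda>\<omega>. grid n (C \<omega>)) -` {j} \<inter> space Q = {\<omega> \<in> space Q. grid n (C \<omega>) = j}" by auto
  finally show ?thesis .
qed

text \<open>\<open>gtime n\<close> takes finitely many values. On each of them \<open>W\<close> is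
  read at a fixed time, and the event that this value occurs depends on \<open>C\<close> alone, so
  independence factors every term.\<close>

lemma expectation_gtime:
  fixes g :: "real \<Rightarrow> 'c::{real_normed_field, banach, second_countable_topology}"
  assumes g: "g \<in> borel_measurable borel" and int: "\<And>s. 0 \<le> s \<Longrightarrow> integrable Q (\<lambda>\<omega>. g (W s \<omega>))"
    and G: "\<And>s. 0 \<le> s \<Longrightarrow> expectation (\<lambda>\<omega>. g (W s \<omega>)) = G s"
  shows "integrable Q (\<lambda>\<omega>. g (W (gtime n \<omega>) \<omega>))"
    and "expectation (\<lambda>\<omega>. g (W (gtime n \<omega>) \<omega>)) = expectation (\<lambda>\<omega>. G (gtime n \<omega>))"
proof -
  let ?s = "\<lambda>j. real j / real (Suc n)" and ?m = "Suc n * Suc n"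
  define I where "I j \<omega> = (if grid n (C \<omega>) = j then 1 else 0 :: 'c)" for j \<omega>
  have decomp: "f (gtime n \<omega>) \<omega> = (\<Sum>j\<le>?m. f (?s j) \<omega> * I j \<omega>)" for f :: "real \<Rightarrow> 'b \<Rightarrow> 'c" and \<omega>
  proof -
    have "(\<Sum>j\<le>?m. f (?s j) \<omega> * I j \<omega>) = (\<Sum>j\<in>{grid n (C \<omega>)}. f (?s j) \<omega> * I j \<omega>)"
      using grid_le[of n "C \<omega>"] by (intro sum.mono_neutral_right) (auto simp: I_def)
    then show ?thesis by (simp add: I_def gtime_def)
  qed
  have Iint: "integrable Q (I j)" for j
  proof -
    have "integrable Q (\<lambda>\<omega>. indicator {\<omega> \<in> space Q. grid n (C \<omega>) = j} \<omega> *\<^sub>R (1::'c))"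
      by (intro integrable_scaleR_left integrable_real_indicator grid_event) (simp add: emeasure_eq_measure)
    moreover have "integrable Q (\<lambda>\<omega>. indicator {\<omega> \<in> space Q. grid n (C \<omega>) = j} \<omega> *\<^sub>R (1::'c)) \<longleftrightarrow> integrable Q (I j)"
      by (rule Bochner_Integration.integrable_cong) (auto simp: I_def indicator_def)
    ultimately show ?thesis by simp
  qed
  have ind: "indep_var borel (\<lambda>\<omega>. g (W (?s j) \<omega>)) borel (I j)" for j
  proof -
    have h: "(\<lambda>x. if grid n x = j then 1 else 0 :: 'c) \<in> borel_measurable borel"
      by (rule measurable_compose[OF grid_measurable]) simp
    have "indep_var borel (g \<circ> W (?s j)) borel ((\<lambda>x. if grid n x = j then 1 else 0 :: 'c) \<circ> C)"
      by (rule indep_var_compose[OF indep g h]) simp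
    then show ?thesis by (simp add: o_def I_def[abs_def])
  qed
  have jint: "integrable Q (\<lambda>\<omega>. g (W (?s j) \<omega>) * I j \<omega>)" for j
    by (rule indep_var_integrable[OF ind int Iint]) simp
  have gs: "(\<lambda>\<omega>. g (W (gtime n \<omega>) \<omega>)) = (\<lambda>\<omega>. \<Sum>j\<le>?m. g (W (?s j) \<omega>) * I j \<omega>)"
    by (rule ext) (rule decomp[of "\<lambda>s \<omega>. g (W s \<omega>)"])
  show "integrable Q (\<lambda>\<omega>. g (W (gtime n \<omega>) \<omega>))" unfolding gs
    by (intro Bochner_Integration.integrable_sum jint)
  have "expectation (\<lambda>\<omega>. g (W (gtime n \<omega>) \<omega>)) = (\<Sum>j\<le>?m. expectation (\<lambda>\<omega>. g (W (?s j) \<omega>) * I j \<omega>))"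
    unfolding gs by (rule Bochner_Integration.integral_sum) (rule jint)
  also have "\<dots> = (\<Sum>j\<le>?m. G (?s j) * expectation (I j))"
  proof (intro sum.cong refl)
    fix j
    have "expectation (\<lambda>\<omega>. g (W (?s j) \<omega>) * I j \<omega>) = expectation (\<lambda>\<omega>. g (W (?s j) \<omega>)) * expectation (I j)"
      by (rule indep_var_lebesgue_integral[OF ind int Iint]) simp
    then show "expectation (\<lambda>\<omega>. g (W (?s j) \<omega>) * I j \<omega>) = G (?s j) * expectation (I j)"
      by (simp add: G)
  qed
  also have "\<dots> = (\<Sum>j\<le>?m. expectation (\<lambda>\<omega>. G (?s j) * I j \<omega>))" using Iint by simp
  also have "\<dots> = expectation (\<lambda>\<omega>. \<Sum>j\<le>?m. G (?s j) * I j \<omega>)"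
    by (rule Bochner_Integration.integral_sum[symmetric]) (intro integrable_mult_right Iint)
  also have "(\<lambda>\<omega>. \<Sum>j\<le>?m. G (?s j) * I j \<omega>) = (\<lambda>\<omega>. G (gtime n \<omega>))"
    by (rule ext) (rule decomp[of "\<lambda>s \<omega>. G s", symmetric])
  finally show "expectation (\<lambda>\<omega>. g (W (gtime n \<omega>) \<omega>)) = expectation (\<lambda>\<omega>. G (gtime n \<omega>))" .
qed

lemma gtime: "0 \<le> gtime n \<omega>" "gtime n \<omega> \<le> C \<omega>" "(\<lambda>n. gtime n \<omega>) \<longlonglongrightarrow> C \<omega>"
  unfolding gtime_def using grid_div_le[OF C(2)] grid_tendsto[OF C(2)] by simp_all

lemma gtime_measurable [measurable]: "gtime n \<in> borel_measurable Q"
proof -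
  have "(\<lambda>\<omega>. real (grid n (C \<omega>))) \<in> borel_measurable Q"
    by (rule measurable_compose[OF measurable_compose[OF C(1) grid_measurable]]) simp
  then show ?thesis unfolding gtime_def[abs_def] by measurable
qed

lemma W_gtime_tendsto: "\<omega> \<in> space Q \<Longrightarrow> (\<lambda>n. W (gtime n \<omega>) \<omega>) \<longlonglongrightarrow> W (C \<omega>) \<omega>"
proof -
  assume "\<omega> \<in> space Q"
  then have "continuous_on {0..} (\<lambda>s. W s \<omega>)" using bm by (simp add: brownian_motion_def)
  then show ?thesis by (rule continuous_on_tendsto_compose[OF _ gtime(3)]) (use C(2) gtime(1) in auto)
qed

lemma W_gtime_measurable [measurable]: "(\<lambda>\<omega>. W (gtime n \<omega>) \<omega>) \<in> borel_measurable Q"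
proof -
  have "(\<lambda>\<omega>. ln (exp (1 * W (gtime n \<omega>) \<omega>))) \<in> borel_measurable Q"
    using expectation_gtime(1)[of "\<lambda>x. exp (1 * x)", OF _ bm_exp_moments(2,3)[OF bm]]
    by (intro borel_measurable_ln) auto
  then show ?thesis by simp
qed

lemma W_C_measurable: "(\<lambda>\<omega>. W (C \<omega>) \<omega>) \<in> borel_measurable Q"
  by (rule borel_measurable_LIMSEQ_metric[OF W_gtime_measurable W_gtime_tendsto])

text \<open>Given \<open>C\<close>, the value of \<open>W\<close> at that time is centred Gaussian
  with variance \<open>C\<close>. Both integrands are bounded, so the identity for
  \<open>gtime n\<close> passes to the limit by dominated convergence.\<close>

lemma char_W_C: "expectation (\<lambda>\<omega>. iexp (a * W (C \<omega>) \<omega>)) = complex_of_real (expectation (\<lambda>\<omega>. exp (- (a\<^sup>2 * C \<omega> / 2))))"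
proof -
  note [measurable] = W_C_measurable C(1)
  have e: "expectation (\<lambda>\<omega>. iexp (a * W (gtime n \<omega>) \<omega>)) = expectation (\<lambda>\<omega>. complex_of_real (exp (- (a\<^sup>2 * gtime n \<omega> / 2))))" for n
  proof (rule expectation_gtime(2)[of "\<lambda>x. iexp (a * x)"])
    show "integrable Q (\<lambda>\<omega>. iexp (a * W s \<omega>))" if "0 \<le> s" for s
      using that by (intro integrable_const_bound[of _ 1]) auto
      show "expectation (\<lambda>\<omega>. iexp (a * W s \<omega>)) = complex_of_real (exp (- (a\<^sup>2 * s / 2)))" if "0 \<le> s" for s
      by (rule bm_exp_moments(4)[OF bm that])
  qed measurable
  have l1: "(\<lambda>n. expectation (\<lambda>\<omega>. iexp (a * W (gtime n \<omega>) \<omega>))) \<longlonglongrightarrow> expectation (\<lambda>\<omega>. iexp (a * W (C \<omega>) \<omega>))"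
  proof (rule integral_dominated_convergence[where w = "\<lambda>_. 1"])
    show "AE \<omega> in Q. (\<lambda>n. iexp (a * W (gtime n \<omega>) \<omega>)) \<longlonglongrightarrow> iexp (a * W (C \<omega>) \<omega>)"
      by (rule AE_I2) (intro tendsto_intros W_gtime_tendsto)
  qed auto
  have l2: "(\<lambda>n. expectation (\<lambda>\<omega>. complex_of_real (exp (- (a\<^sup>2 * gtime n \<omega> / 2))))) \<longlonglongrightarrow> expectation (\<lambda>\<omega>. complex_of_real (exp (- (a\<^sup>2 * C \<omega> / 2))))"
  proof (rule integral_dominated_convergence[where w = "\<lambda>_. 1"])
    show "AE \<omega> in Q. (\<lambda>n. complex_of_real (exp (- (a\<^sup>2 * gtime n \<omega> / 2)))) \<longlonglongrightarrow> complex_of_real (exp (- (a\<^sup>2 * C \<omega> / 2)))"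
      by (rule AE_I2) (intro tendsto_intros gtime(3), auto)
    show "AE \<omega> in Q. norm (complex_of_real (exp (- (a\<^sup>2 * gtime n \<omega> / 2)))) \<le> 1" for n
      by (rule AE_I2) (simp add: gtime(1) norm_of_real)
  qed auto
  show ?thesis using LIMSEQ_unique[OF l1[unfolded e] l2] by simp
qed

text \<open>Exponentials of \<open>W\<close> are unbounded, so Fatou's lemma replaces dominated
  convergence and yields an inequality; that \<open>gtime n\<close> lies below \<open>C\<close>
  makes the bound uniform in n.\<close>

lemma exp_W_C_bound:
  assumes K: "(\<integral>\<^sup>+\<omega>. ennreal (exp (a\<^sup>2 * C \<omega> / 2)) \<partial>Q) \<le> K"
  shows "(\<integral>\<^sup>+\<omega>. ennreal (exp (a * W (C \<omega>) \<omega>)) \<partial>Q) \<le> K"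
proof (rule fatou_bound[where f = "\<lambda>n \<omega>. exp (a * W (gtime n \<omega>) \<omega>)"])
  note [measurable] = W_C_measurable
  show "(\<lambda>\<omega>. exp (a * W (C \<omega>) \<omega>)) \<in> borel_measurable Q" "(\<lambda>\<omega>. exp (a * W (gtime n \<omega>) \<omega>)) \<in> borel_measurable Q" for n by measurable
  show "AE \<omega> in Q. (\<lambda>n. exp (a * W (gtime n \<omega>) \<omega>)) \<longlonglongrightarrow> exp (a * W (C \<omega>) \<omega>)"
    by (rule AE_I2) (intro tendsto_intros W_gtime_tendsto)
  fix n
  have bd: "exp (a\<^sup>2 * gtime n \<omega> / 2) \<le> exp (a\<^sup>2 * real (Suc n * Suc n) / 2)" for \<omega>
  proof -
    have "gtime n \<omega> \<le> real (grid n (C \<omega>)) / 1" unfolding gtime_def by (rule divide_left_mono) auto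
    also have "\<dots> \<le> real (Suc n * Suc n)" using grid_le[of n "C \<omega>"] by (simp only: div_by_1 of_nat_le_iff)
    finally show ?thesis by (simp add: mult_left_mono)
  qed
  have ig: "integrable Q (\<lambda>\<omega>. exp (a\<^sup>2 * gtime n \<omega> / 2))"
    by (rule integrable_const_bound[of _ "exp (a\<^sup>2 * real (Suc n * Suc n) / 2)"]) (use bd in auto)
  note E = expectation_gtime[of "\<lambda>x. exp (a * x)" "\<lambda>s. exp (a\<^sup>2 * s / 2)", OF _ bm_exp_moments(2,3)[OF bm], of n]
  have "(\<integral>\<^sup>+\<omega>. ennreal (exp (a * W (gtime n \<omega>) \<omega>)) \<partial>Q) = ennreal (expectation (\<lambda>\<omega>. exp (a * W (gtime n \<omega>) \<omega>)))"
    by (rule nn_integral_eq_integral) (use E(1) in auto)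
  also have "\<dots> = ennreal (expectation (\<lambda>\<omega>. exp (a\<^sup>2 * gtime n \<omega> / 2)))" using E(2) by simp
  also have "\<dots> = (\<integral>\<^sup>+\<omega>. ennreal (exp (a\<^sup>2 * gtime n \<omega> / 2)) \<partial>Q)"
    by (rule nn_integral_eq_integral[symmetric, OF ig]) simp
  also have "\<dots> \<le> (\<integral>\<^sup>+\<omega>. ennreal (exp (a\<^sup>2 * C \<omega> / 2)) \<partial>Q)"
    by (intro nn_integral_mono ennreal_leI) (simp add: gtime(2) mult_left_mono)
  also have "\<dots> \<le> K" by (rule K)
  finally show "(\<integral>\<^sup>+\<omega>. ennreal (exp (a * W (gtime n \<omega>) \<omega>)) \<partial>Q) \<le> K" .
qed

end

section \<open>The clock built from gamma variables\<close>

lemma pi_squared_ge_8: "8 \<le> pi\<^sup>2"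
proof -
  have "3 < pi" using pi_gt3 .
  then have "3\<^sup>2 \<le> pi\<^sup>2" by (intro power_mono) auto
  then show ?thesis by simp
qed

locale gamma_clock = prob_space Q for Q :: "'b measure" +
  fixes \<eta> :: "nat \<Rightarrow> nat \<Rightarrow> 'b \<Rightarrow> real" and t :: nat
  assumes t: "1 \<le> t" and indep_gamma: "indep_vars (\<lambda>_. borel) (\<lambda>l. \<eta> l t) {1..}"
    and gamma: "\<And>l. 1 \<le> l \<Longrightarrow> distributed Q lborel (\<eta> l t) (gamma_density t)"
begin

lemma eta_measurable [measurable]: "\<eta> (Suc l) t \<in> borel_measurable Q"
  using distributed_measurable[OF gamma[of "Suc l"]] by (simp add: measurable_lborel1)

text \<open>Indices are shifted by one against the series of C(t): the term with index l + 1 carries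
  (l + 1) - 1/2 = l + 1/2.\<close>

definition weight :: "nat \<Rightarrow> real" where
  "weight l = 2 / (pi\<^sup>2 * (real l + 1 / 2)\<^sup>2)"

definition clock_sum :: "nat \<Rightarrow> 'b \<Rightarrow> real" where
  "clock_sum n \<omega> = (\<Sum>l<n. weight l * \<eta> (Suc l) t \<omega>)"

lemma weight_nonneg: "0 \<le> weight l"
  by (simp add: weight_def)

text \<open>The largest weight is 8 / pi^2. The bound by 1 keeps the parameter -1/2 inside the
  domain of the gamma transform, with room for the estimate in
  \<open>exp_half_random_time\<close>.\<close>

lemma weight_le_1: "weight l \<le> 1"
proof -
  have "(1 / 2)\<^sup>2 \<le> (real l + 1 / 2)\<^sup>2" by (intro power_mono) auto
  then have "8 * (1 / 4) \<le> pi\<^sup>2 * (real l + 1 / 2)\<^sup>2"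
    by (intro mult_mono pi_squared_ge_8) (auto simp: power2_eq_square)
  then have "2 \<le> pi\<^sup>2 * (real l + 1 / 2)\<^sup>2" by simp
  then show ?thesis unfolding weight_def by (subst divide_le_eq_1_pos) auto
qed

lemma summable_inverse_squares: "summable (\<lambda>l. 1 / (real (Suc l) - 1 / 2)\<^sup>2)"
proof (rule summable_comparison_test')
  have "summable (\<lambda>n. inverse (real n ^ 2))" by (rule inverse_power_summable) simp
  then have "summable (\<lambda>n. inverse (real (Suc n) ^ 2))" by (subst summable_Suc_iff)
  then show "summable (\<lambda>n. 4 * inverse (real (Suc n) ^ 2))" by (rule summable_mult)
  fix l :: nat
  have "(real (Suc l) / 2)\<^sup>2 \<le> (real (Suc l) - 1 / 2)\<^sup>2" by (intro power_mono) auto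
  then have "1 / (real (Suc l) - 1 / 2)\<^sup>2 \<le> 1 / (real (Suc l) / 2)\<^sup>2" by (intro divide_left_mono) auto
  also have "\<dots> = 4 * inverse (real (Suc l) ^ 2)" by (simp add: power_divide inverse_eq_divide)
  finally show "norm (1 / (real (Suc l) - 1 / 2)\<^sup>2) \<le> 4 * inverse (real (Suc l) ^ 2)" by simp
qed

lemma weight_eq: "weight l = 2 / pi\<^sup>2 * (1 / (real (Suc l) - 1 / 2)\<^sup>2)"
  by (simp add: weight_def)

lemma summable_weight: "summable weight"
  unfolding weight_eq[abs_def] by (intro summable_mult summable_inverse_squares)

lemma clock_sum_mgf:
  assumes a: "\<And>l. a * weight l > -1"
  shows "integrable Q (\<lambda>\<omega>. exp (- a * clock_sum n \<omega>))"
    and "expectation (\<lambda>\<omega>. exp (- a * clock_sum n \<omega>)) = (\<Prod>l<n. (1 / (1 + a * weight l)) ^ t)"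
proof -
  define X where "X k \<omega> = exp (- (a * weight (k - 1)) * \<eta> k t \<omega>)" for k \<omega>
  have eq: "exp (- a * clock_sum n \<omega>) = (\<Prod>k\<in>{1..n}. X k \<omega>)" for \<omega>
  proof -
    have "(\<Prod>k\<in>{1..n}. X k \<omega>) = (\<Prod>l<n. X (Suc l) \<omega>)"
      using prod.atLeast1_atMost_eq[of "\<lambda>k. X k \<omega>" n] by (simp add: One_nat_def)
    then show ?thesis by (simp add: X_def clock_sum_def exp_sum sum_distrib_left sum_negf[symmetric] mult.assoc)
  qed
  have mgf: "integrable Q (X k)" "expectation (X k) = (1 / (1 + a * weight (k - 1))) ^ t" if "k \<in> {1..n}" for k
    using gamma_mgf[OF gamma[of k] t a[of "k - 1"]] that by (simp_all add: X_def[abs_def])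
  have ind: "indep_vars (\<lambda>_. borel) X {1..n}"
  proof -
    have "indep_vars (\<lambda>_. borel) (\<lambda>k \<omega>. exp (- (a * weight (k - 1)) * \<eta> k t \<omega>)) {1..n}"
      by (rule indep_vars_compose2[OF indep_vars_subset[OF indep_gamma]]) auto
    then show ?thesis by (simp add: X_def[abs_def])
  qed
  show "integrable Q (\<lambda>\<omega>. exp (- a * clock_sum n \<omega>))"
    unfolding eq by (rule indep_vars_integrable[OF _ ind mgf(1)]) simp_all
  have "expectation (\<lambda>\<omega>. exp (- a * clock_sum n \<omega>)) = (\<Prod>k\<in>{1..n}. expectation (X k))"
    unfolding eq by (rule indep_vars_lebesgue_integral[OF _ ind mgf(1)]) simp_all
  also have "\<dots> = (\<Prod>k\<in>{1..n}. (1 / (1 + a * weight (k - 1))) ^ t)"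
    by (intro prod.cong refl mgf(2))
  also have "\<dots> = (\<Prod>l<n. (1 / (1 + a * weight l)) ^ t)"
    using prod.atLeast1_atMost_eq[of "\<lambda>k. (1 / (1 + a * weight (k - 1))) ^ t" n] by (simp add: One_nat_def)
  finally show "expectation (\<lambda>\<omega>. exp (- a * clock_sum n \<omega>)) = (\<Prod>l<n. (1 / (1 + a * weight l)) ^ t)" .
qed

lemma AE_eta_pos: "AE \<omega> in Q. \<forall>l. 0 < \<eta> (Suc l) t \<omega>"
  by (subst AE_all_countable) (use gamma_mgf(3)[OF gamma t, of _ 0] in auto)

lemma random_time_measurable: "random_time \<eta> t \<in> borel_measurable Q"
  unfolding random_time_def[abs_def] by measurable

lemma random_time_nonneg: "0 \<le> random_time \<eta> t \<omega>"
  by (simp add: random_time_def)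

lemma clock_sum_measurable [measurable]: "clock_sum n \<in> borel_measurable Q"
  unfolding clock_sum_def[abs_def] by measurable

text \<open>\<open>enn2real\<close> sends an infinite sum to 0, so the series must first be shown to
  be almost surely finite. Its expectation is finite: each gamma variable is at most 2
  exp(\<eta>/2), whose mean is 2 * 2^t, and the inverse squares are summable.\<close>

lemma AE_clock_sum_tendsto: "AE \<omega> in Q. (\<lambda>n. clock_sum n \<omega>) \<longlonglongrightarrow> random_time \<eta> t \<omega>"
proof -
  define c where "c l = 1 / (real (Suc l) - 1 / 2)\<^sup>2" for l :: nat
  have c0: "0 \<le> c l" for l by (simp add: c_def)
  have c_summable: "summable c" unfolding c_def[abs_def] by (rule summable_inverse_squares)
  have le: "(\<integral>\<^sup>+\<omega>. ennreal (\<eta> (Suc l) t \<omega> * c l) \<partial>Q) \<le> ennreal (2 * 2 ^ t * c l)" for l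
  proof -
    note E = gamma_mgf[OF gamma[of "Suc l"] t, of "- (1 / 2)"]
    have "(\<integral>\<^sup>+\<omega>. ennreal (\<eta> (Suc l) t \<omega> * c l) \<partial>Q) \<le> (\<integral>\<^sup>+\<omega>. ennreal (2 * c l * exp (- (- (1 / 2)) * \<eta> (Suc l) t \<omega>)) \<partial>Q)"
    proof (intro nn_integral_mono ennreal_leI)
      fix \<omega>
      have "\<eta> (Suc l) t \<omega> \<le> 2 * exp (\<eta> (Suc l) t \<omega> / 2)" using exp_ge_add_one_self[of "\<eta> (Suc l) t \<omega> / 2"] by linarith
      then have "\<eta> (Suc l) t \<omega> * c l \<le> 2 * exp (\<eta> (Suc l) t \<omega> / 2) * c l" by (rule mult_right_mono[OF _ c0])
      then show "\<eta> (Suc l) t \<omega> * c l \<le> 2 * c l * exp (- (- (1 / 2)) * \<eta> (Suc l) t \<omega>)" by (simp add: mult_ac)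
    qed
    also have "\<dots> = ennreal (expectation (\<lambda>\<omega>. 2 * c l * exp (- (- (1 / 2)) * \<eta> (Suc l) t \<omega>)))"
      by (rule nn_integral_eq_integral) (use E(1) c0 in auto)
    also have "\<dots> = ennreal (2 * 2 ^ t * c l)" using E(2) by (simp add: mult_ac)
    finally show ?thesis .
  qed
  have "(\<integral>\<^sup>+\<omega>. (\<Sum>l. ennreal (\<eta> (Suc l) t \<omega> * c l)) \<partial>Q) = (\<Sum>l. \<integral>\<^sup>+\<omega>. ennreal (\<eta> (Suc l) t \<omega> * c l) \<partial>Q)"
    by (rule nn_integral_suminf) measurable
  also have "\<dots> \<le> (\<Sum>l. ennreal (2 * 2 ^ t * c l))"
    by (rule suminf_le[OF le]) simp_all
  also have "\<dots> = ennreal (\<Sum>l. 2 * 2 ^ t * c l)"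
    by (rule suminf_ennreal2[OF _ summable_mult[OF c_summable]]) (simp add: c0)
  finally have fin: "(\<integral>\<^sup>+\<omega>. (\<Sum>l. ennreal (\<eta> (Suc l) t \<omega> * c l)) \<partial>Q) \<noteq> \<infinity>"
    by (auto simp: top_unique)
  have "AE \<omega> in Q. (\<Sum>l. ennreal (\<eta> (Suc l) t \<omega> * c l)) \<noteq> \<infinity>"
    by (rule nn_integral_noteq_infinite[OF _ fin]) measurable
  then show ?thesis using AE_eta_pos
  proof eventually_elim
    case (elim \<omega>)
    define x where "x l = \<eta> (Suc l) t \<omega> * c l" for l
    have x0: "0 \<le> x l" for l using elim(2) c0[of l] by (simp add: x_def less_imp_le)
    have sm: "summable x" by (rule summable_suminf_not_top[OF x0]) (use elim(1) in \<open>simp add: x_def\<close>)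
    have "random_time \<eta> t \<omega> = 2 / pi\<^sup>2 * (\<Sum>l. x l)"
      unfolding random_time_def using suminf_ennreal2[OF x0 sm] suminf_nonneg[OF sm x0] by (simp add: x_def c_def)
    moreover have "clock_sum n \<omega> = 2 / pi\<^sup>2 * (\<Sum>l<n. x l)" for n
      unfolding clock_sum_def weight_eq sum_distrib_left by (intro sum.cong refl) (simp add: x_def c_def)
    ultimately show ?case using tendsto_mult_left[OF summable_LIMSEQ[OF sm], of "2 / pi\<^sup>2"] by simp
  qed
qed

lemma AE_clock_sum_nonneg: "AE \<omega> in Q. 0 \<le> clock_sum n \<omega>"
  using AE_eta_pos
  by eventually_elim (auto simp: clock_sum_def weight_nonneg less_imp_le intro!: sum_nonneg mult_nonneg_nonneg)

text \<open>For a = x^2 / 2 the numbers 1 + a \<open>weight l\<close> are the factors in the product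
  for cosh x. The partial sums are almost surely nonnegative, so the exponentials are dominated by
  1.\<close>

lemma laplace_random_time: "expectation (\<lambda>\<omega>. exp (- (x\<^sup>2 * random_time \<eta> t \<omega> / 2))) = (1 / cosh x) ^ t"
proof -
  note [measurable] = random_time_measurable
  have w: "1 + x\<^sup>2 / 2 * weight l = 1 + x\<^sup>2 / (pi\<^sup>2 * (real l + 1 / 2)\<^sup>2)" for l
    by (simp add: weight_def)
  have gt: "x\<^sup>2 / 2 * weight l > -1" for l
    by (rule less_le_trans[of _ 0]) (auto intro!: mult_nonneg_nonneg weight_nonneg)
  have "(\<lambda>n. expectation (\<lambda>\<omega>. exp (- (x\<^sup>2 / 2) * clock_sum n \<omega>))) \<longlonglongrightarrow> expectation (\<lambda>\<omega>. exp (- (x\<^sup>2 / 2) * random_time \<eta> t \<omega>))"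
  proof (rule integral_dominated_convergence[where w = "\<lambda>_. 1"])
    show "AE \<omega> in Q. (\<lambda>n. exp (- (x\<^sup>2 / 2) * clock_sum n \<omega>)) \<longlonglongrightarrow> exp (- (x\<^sup>2 / 2) * random_time \<eta> t \<omega>)"
      using AE_clock_sum_tendsto by eventually_elim (intro tendsto_intros)
    show "AE \<omega> in Q. norm (exp (- (x\<^sup>2 / 2) * clock_sum n \<omega>)) \<le> 1" for n
      using AE_clock_sum_nonneg[of n] by eventually_elim simp
  qed measurable
  moreover have "expectation (\<lambda>\<omega>. exp (- (x\<^sup>2 / 2) * clock_sum n \<omega>)) = (1 / (\<Prod>l<n. 1 + x\<^sup>2 / (pi\<^sup>2 * (real l + 1 / 2)\<^sup>2))) ^ t" for n
    unfolding clock_sum_mgf(2)[OF gt] w by (simp add: prod_power_distrib[symmetric] prod_dividef)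
  moreover have "(\<lambda>n. (1 / (\<Prod>l<n. 1 + x\<^sup>2 / (pi\<^sup>2 * (real l + 1 / 2)\<^sup>2))) ^ t) \<longlonglongrightarrow> (1 / cosh x) ^ t"
    by (intro tendsto_intros cosh_product) simp
  ultimately have "expectation (\<lambda>\<omega>. exp (- (x\<^sup>2 / 2) * random_time \<eta> t \<omega>)) = (1 / cosh x) ^ t"
    by (simp add: LIMSEQ_unique)
  then show ?thesis by simp
qed

text \<open>For 0 <= w <= 1 one has 1 / (1 - w/2) <= exp w, so the exponential moments of the
  partial sums are bounded through the sum of all weights; Fatou's lemma passes to the
  limit.\<close>

lemma exp_half_random_time: "(\<integral>\<^sup>+\<omega>. ennreal (exp (random_time \<eta> t \<omega> / 2)) \<partial>Q) \<le> ennreal (exp (suminf weight) ^ t)"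
proof (rule fatou_bound[where f = "\<lambda>n \<omega>. exp (clock_sum n \<omega> / 2)"])
  note [measurable] = random_time_measurable
  show "(\<lambda>\<omega>. exp (random_time \<eta> t \<omega> / 2)) \<in> borel_measurable Q" "(\<lambda>\<omega>. exp (clock_sum n \<omega> / 2)) \<in> borel_measurable Q" for n
    by measurable
  show "AE \<omega> in Q. (\<lambda>n. exp (clock_sum n \<omega> / 2)) \<longlonglongrightarrow> exp (random_time \<eta> t \<omega> / 2)"
    using AE_clock_sum_tendsto by eventually_elim (intro tendsto_intros, auto)
  fix n
  have gt: "- (1 / 2) * weight l > -1" for l using weight_le_1[of l] by simp
  have E: "integrable Q (\<lambda>\<omega>. exp (clock_sum n \<omega> / 2))"
    "expectation (\<lambda>\<omega>. exp (clock_sum n \<omega> / 2)) = (\<Prod>l<n. (1 / (1 - weight l / 2)) ^ t)"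
    using clock_sum_mgf[OF gt, of n] by simp_all
  have le: "1 / (1 - weight l / 2) \<le> exp (weight l)" for l
  proof -
    have "1 \<le> (1 + weight l) * (1 - weight l / 2)"
      using mult_nonneg_nonneg[of "weight l" "1 - weight l"] weight_nonneg[of l] weight_le_1[of l] by (simp add: algebra_simps)
    also have "\<dots> \<le> exp (weight l) * (1 - weight l / 2)"
      using weight_le_1[of l] by (intro mult_right_mono exp_ge_add_one_self) auto
    finally show ?thesis using weight_le_1[of l] by (simp add: divide_le_eq)
  qed
  have "expectation (\<lambda>\<omega>. exp (clock_sum n \<omega> / 2)) \<le> (\<Prod>l<n. exp (weight l) ^ t)"
    unfolding E(2) by (intro prod_mono conjI power_mono le zero_le_power) (simp_all add: order_trans[OF weight_le_1])
  also have "\<dots> = exp (\<Sum>l<n. weight l) ^ t" by (simp add: prod_power_distrib exp_sum)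
  also have "\<dots> \<le> exp (suminf weight) ^ t"
    using sum_le_suminf[OF summable_weight, of "{..<n}"] weight_nonneg by (intro power_mono) auto
  finally show "(\<integral>\<^sup>+\<omega>. ennreal (exp (clock_sum n \<omega> / 2)) \<partial>Q) \<le> ennreal (exp (suminf weight) ^ t)"
    by (subst nn_integral_eq_integral[OF E(1)]) (auto intro: ennreal_leI)
qed

end

lemma gamma_clock_time_changed_bm:
  assumes "time_changed_bm Q W \<eta>" "1 \<le> t"
  shows "gamma_clock Q \<eta> t"
  using assms unfolding time_changed_bm_def brownian_motion_def
  by (intro gamma_clock.intro gamma_clock_axioms.intro) auto

text \<open>The clock is independent of the sigma-algebra of the whole path, which contains that of
  each single \<open>W s\<close>.\<close>

lemma independent_time_time_changed_bm:
  assumes tc: "time_changed_bm Q W \<eta>" and t: "1 \<le> t"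
  shows "independent_time Q W (random_time \<eta> t)"
proof -
  interpret gamma_clock Q \<eta> t by (rule gamma_clock_time_changed_bm[OF tc t])
  have bm: "brownian_motion Q W" using tc by (simp add: time_changed_bm_def)
  let ?A = "sets (vimage_algebra (space Q) (\<lambda>\<omega>. \<lambda>s\<in>{0..}. W s \<omega>) (Pi\<^sub>M {0..} (\<lambda>_. borel)))"
  let ?B = "sets (vimage_algebra (space Q) (random_time \<eta> t) borel)"
  have "indep_set ?A ?B" using tc t by (simp add: time_changed_bm_def)
  then have ind: "?A \<subseteq> events" "?B \<subseteq> events" "\<And>a b. a \<in> ?A \<Longrightarrow> b \<in> ?B \<Longrightarrow> prob (a \<inter> b) = prob a * prob b"
    unfolding indep_sets2_eq by blast+
  have indep: "indep_var borel (W s) borel (random_time \<eta> t)" if s: "0 \<le> s" for s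
  proof -
    have "(\<lambda>\<omega>. (\<lambda>s\<in>{0..}. W s \<omega>) s) \<in> measurable (vimage_algebra (space Q) (\<lambda>\<omega>. \<lambda>s\<in>{0..}. W s \<omega>) (Pi\<^sub>M {0..} (\<lambda>_. borel))) borel"
      by (rule measurable_compose[OF measurable_vimage_algebra1 measurable_component_singleton])
        (use s in \<open>simp_all add: space_PiM Pi_iff PiE_iff extensional_def\<close>)
    then have Ws: "W s \<in> measurable (vimage_algebra (space Q) (\<lambda>\<omega>. \<lambda>s\<in>{0..}. W s \<omega>) (Pi\<^sub>M {0..} (\<lambda>_. borel))) borel"
      using s by simp
    have m: "W s \<in> borel_measurable Q" using bm s by (simp add: brownian_motion_def)
    have A: "sigma_sets (space Q) {W s -` A \<inter> space Q |A. A \<in> sets borel} \<subseteq> ?A"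
    proof (rule sets.sigma_sets_subset'[of _ "vimage_algebra (space Q) (\<lambda>\<omega>. \<lambda>s\<in>{0..}. W s \<omega>) (Pi\<^sub>M {0..} (\<lambda>_. borel))"])
      show "{W s -` A \<inter> space Q |A. A \<in> sets borel} \<subseteq> ?A"
        using measurable_sets[OF Ws] by auto
      show "space Q \<in> ?A" using sets.top[of "vimage_algebra (space Q) (\<lambda>\<omega>. \<lambda>s\<in>{0..}. W s \<omega>) (Pi\<^sub>M {0..} (\<lambda>_. borel))"] by simp
    qed
    have B: "sigma_sets (space Q) {random_time \<eta> t -` A \<inter> space Q |A. A \<in> sets borel} \<subseteq> ?B"
      by (simp add: sets_vimage_algebra)
    show ?thesis unfolding indep_var_eq indep_sets2_eq
      by (intro conjI ballI m random_time_measurable subset_trans[OF A ind(1)] subset_trans[OF B ind(2)] ind(3)[OF subsetD[OF A] subsetD[OF B]])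
  qed
  show ?thesis
    by (intro independent_time.intro independent_time_axioms.intro prob_space_axioms bm indep random_time_measurable random_time_nonneg)
qed

section \<open>The law of the time-changed Brownian motion and the kernel\<close>

lemma tilde_law_properties:
  assumes tc: "time_changed_bm Q W \<eta>"
  shows "real_distribution (tilde_law Q W \<eta> t)" "integrable (tilde_law Q W \<eta> t) (\<lambda>x. x ^ k)"
    and "char (tilde_law Q W \<eta> t) x = complex_of_real ((1 / cosh x) ^ t)"
proof -
  have "real_distribution (tilde_law Q W \<eta> t) \<and> integrable (tilde_law Q W \<eta> t) (\<lambda>x. x ^ k) \<and>
    char (tilde_law Q W \<eta> t) x = complex_of_real ((1 / cosh x) ^ t)"
  proof (cases "t = 0")
    case True
    have p: "prob_space (return borel (0::real))" by (rule prob_space_return) simp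
    have "integrable (return borel (0::real)) (\<lambda>x. x ^ k)"
      by (rule integrableI_bounded) (auto simp: nn_integral_return)
    then show ?thesis using True p
      by (simp add: tilde_law_def real_distribution_def real_distribution_axioms_def char_def integral_return)
  next
    case False
    then have t: "1 \<le> t" by simp
    interpret gamma_clock Q \<eta> t by (rule gamma_clock_time_changed_bm[OF tc t])
    interpret T: independent_time Q W "random_time \<eta> t" by (rule independent_time_time_changed_bm[OF tc t])
    define X where "X \<omega> = W (random_time \<eta> t \<omega>) \<omega>" for \<omega>
    have X[measurable]: "X \<in> borel_measurable Q" unfolding X_def[abs_def] by (rule T.W_C_measurable)
    have L: "tilde_law Q W \<eta> t = distr Q borel X" using False by (simp add: tilde_law_def X_def[abs_def])
    \<comment> \<open>Both signs of \<open>a\<close> are used, as |z|^k is at most k! (exp z +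
      exp(-z)); either way the factor a^2 / 2 is the 1/2 of
      \<open>exp_half_random_time\<close>.\<close>
    have e: "integrable Q (\<lambda>\<omega>. exp (a * X \<omega>))" if "a\<^sup>2 = 1" for a
    proof (rule integrableI_bounded)
      have "(\<integral>\<^sup>+\<omega>. ennreal (exp (a * X \<omega>)) \<partial>Q) \<le> ennreal (exp (suminf weight) ^ t)"
        unfolding X_def by (rule T.exp_W_C_bound) (use exp_half_random_time that in simp)
      then show "(\<integral>\<^sup>+\<omega>. ennreal (norm (exp (a * X \<omega>))) \<partial>Q) < \<infinity>"
        by (simp add: le_less_trans[OF _ ennreal_less_top])
    qed measurable
    have "integrable Q (\<lambda>\<omega>. X \<omega> ^ k)"
    proof (rule Bochner_Integration.integrable_bound)
      show "integrable Q (\<lambda>\<omega>. fact k * (exp (1 * X \<omega>) + exp ((-1) * X \<omega>)))"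
        by (intro integrable_mult_right Bochner_Integration.integrable_add e) simp_all
      have "\<bar>z\<bar> ^ k \<le> fact k * (exp (1 * z) + exp (- 1 * z))" for z :: real
      proof -
        have "\<bar>z\<bar> ^ k \<le> fact k * exp \<bar>z\<bar>" by (rule power_le_fact_mult_exp) simp
        also have "\<dots> \<le> fact k * (exp (1 * z) + exp (- 1 * z))" by (intro mult_left_mono) (auto simp: abs_if)
        finally show ?thesis .
      qed
      then have "norm (X \<omega> ^ k) \<le> norm (fact k * (exp (1 * X \<omega>) + exp (- 1 * X \<omega>)))" for \<omega>
        unfolding real_norm_def power_abs by (rule order_trans) (rule abs_ge_self)
      then show "AE \<omega> in Q. norm (X \<omega> ^ k) \<le> norm (fact k * (exp (1 * X \<omega>) + exp (- 1 * X \<omega>)))"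
        by (rule AE_I2)
    qed measurable
    then have "integrable (distr Q borel X) (\<lambda>x. x ^ k)" by (subst integrable_distr_eq) auto
    moreover have "char (distr Q borel X) x = complex_of_real ((1 / cosh x) ^ t)"
      unfolding char_def using T.char_W_C[of x] laplace_random_time[of x]
      by (subst integral_distr) (auto simp: X_def)
    ultimately show ?thesis unfolding L using real_distribution_distr[OF X] by simp
  qed
  then show "real_distribution (tilde_law Q W \<eta> t)" "integrable (tilde_law Q W \<eta> t) (\<lambda>x. x ^ k)"
    "char (tilde_law Q W \<eta> t) x = complex_of_real ((1 / cosh x) ^ t)" by simp_all
qed

lemma calM_tilde_law:
  assumes "time_changed_bm Q W \<eta>" "j \<in> {1..N}"
  shows "calM (tilde_law Q W \<eta>) N u j t y = complex_of_real (mfun N u j t y)"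
  unfolding calM_def using tilde_law_properties[OF assms(1), of t]
  by (intro integral_Phi_eq_mfun moments_of_char assms(2)) auto

theorem corollary6p2:
  fixes P :: "'a measure" and V :: "nat \<Rightarrow> nat \<Rightarrow> 'a \<Rightarrow> int"
    and Q :: "'b measure" and W :: "real \<Rightarrow> 'b \<Rightarrow> real" and \<eta> :: "nat \<Rightarrow> nat \<Rightarrow> 'b \<Rightarrow> real"
    and N :: nat and u :: "nat \<Rightarrow> int"
    and K :: "nat \<times> int \<Rightarrow> nat \<times> int \<Rightarrow> complex"
  assumes "1 \<le> N"
    and "strict_mono_on {1..N} u"
    and "\<forall>j\<in>{1..N}. even (u j)"
    and "srws P N u V"
    and "time_changed_bm Q W \<eta>"
  defines "K \<equiv> nc_kernel (tilde_law Q W \<eta>) N u"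
  shows
    \<comment> \<open>the limits defining the expectation of the noncolliding random walk exist\<close>
    "(\<forall>F. local_functional N F \<longrightarrow> convergent (cond_expect P N V F)) \<and>
     (\<forall>M t. 1 \<le> M \<and> 0 < t 1 \<and> strict_mono_on {1..M} t \<longrightarrow>
        (\<forall>f\<in>test_functions M t.
           complex_of_real (nc_expect P N V (exp_functional M t f)) =
           fredholm_det M t K (\<lambda>s y. exp (f s y) - 1)) \<and>
        (\<exists>\<rho>. correlation_functions P N V M t \<rho>) \<and>
        (\<forall>\<rho>. correlation_functions P N V M t \<rho> \<longrightarrow>
           (\<forall>n\<in>({1..M} \<rightarrow>\<^sub>E {0..N}). \<forall>x \<in> (\<Pi>\<^sub>E m\<in>{1..M}. weyl (n m)).
              complex_of_real (\<rho> n x) =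
              (if \<forall>m\<in>{1..M}. \<forall>j\<in>{1..n m}. even (x m j) \<longleftrightarrow> even (t m)
               then block_det M t K n x else 0))))"
proof -
  have mono: "strict_mono_on {1..N} u" and even: "\<forall>j\<in>{1..N}. even (u j)" by fact+
  interpret walkers_martingale P N u V "mfun N u"
    using assms(1-4) by (intro walkers_martingale.intro walkers.intro martingale_functions_mfun)
  \<comment> \<open>The kernel is complex only through the complex argument of \<open>Phi\<close>;
    its values are real, and equal to those of the kernel for which the expansion was
    derived.\<close>
  have K: "K a b = complex_of_real (pkernel a b)" for a b
  proof -
    have "calM (tilde_law Q W \<eta>) N u j (fst b) (snd b) = complex_of_real (mfun N u j (fst b) (snd b))"
      if "j \<in> {1..N}" for j
      using calM_tilde_law[OF assms(5) that] .
    then show ?thesis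
      unfolding K_def nc_kernel_def pkernel_def rkernel_def by (simp add: case_prod_unfold)
  qed
  show ?thesis
  proof (intro conjI allI impI ballI)
    fix F assume "local_functional N F"
    then show "convergent (cond_expect P N V F)" by (rule convergent_cond_expect)
  next
    fix M and t :: "nat \<Rightarrow> nat"
    assume "1 \<le> M \<and> 0 < t 1 \<and> strict_mono_on {1..M} t"
    then have t: "1 \<le> M" "0 < t 1" "strict_mono_on {1..M} t" by simp_all
    note H = K t
    show "complex_of_real (nc_expect P N V (exp_functional M t f)) = fredholm_det M t K (\<lambda>s y. exp (f s y) - 1)"
      if "f \<in> test_functions M t" for f
      by (rule nc_expect_eq_fredholm_det[OF H that])
    show "\<exists>\<rho>. correlation_functions P N V M t \<rho>" by (rule correlation_functions_exist[OF H])
    show "complex_of_real (\<rho> n x) = (if \<forall>m\<in>{1..M}. \<forall>j\<in>{1..n m}. even (x m j) \<longleftrightarrow> even (t m) then block_det M t K n x else 0)"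
      if "correlation_functions P N V M t \<rho>" "n \<in> {1..M} \<rightarrow>\<^sub>E {0..N}" "x \<in> (\<Pi>\<^sub>E m\<in>{1..M}. weyl (n m))" for \<rho> n x
      by (rule correlation_functions_eq[OF H that(1) _ that(3)]) (use that(2) in \<open>simp add: PiE_iff\<close>)
  qed
qed

end
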